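(* Let $[U_{i,j},\beta_{i,j}]_{0\le i\le d,\,1\le j\le\alpha_i}$ be an SKP. For any acceptable vector $\alpha'$, the mapping $\nu_{\alpha'}:k[[X_0,\ldots,X_d]]\setminus\{0\}\to\Phi$ extends (via $\nu_{\alpha'}(f/g)=\nu_{\alpha'}(f)-\nu_{\alpha'}(g)$) to a $k$-valuation of the field $k((X_0,\ldots,X_d))$. Moreover, for any two acceptable vectors $\alpha'\le\alpha''$ (componentwise) and any nonzero $f\in k[[X_0,\ldots,X_d]]$, we have $\nu_{\alpha'}(f)\le\nu_{\alpha''}(f)$.
   Context: Let $k$ be a field, $d\ge0$, $k^{(i)}=k[[X_0,\ldots,X_i]]$, $k_{(i)}=k((X_0,\ldots,X_i))=\mathrm{Frac}(k^{(i)})$, $k^{(-1)}=k$. Let $\Phi$ be a totally ordered abelian group of rank $d+1$. **Sequence of values.** A family $(\beta_{i,j})_{0\le i\le d,\,1\le j\le\tilde\alpha_i}$ of positive elements of $\Phi$ ($\tilde\alpha_i\ge1$ ordinals, $\tilde\alpha_0=1$; pairs $(i,j)$ ordered lexicographically). Put $n_{i,j}=\min\{r\in\{1,2,\dots\}\cup\{\infty\}: r\beta_{i,j}\in(\beta_{i',j'})_{(i',j')<_{lex}(i,j)}\}$ (subgroup generated; $\infty$ if no finite $r$ works). Requirements: $\beta_{i,j+1}>n_{i,j}\beta_{i,j}$ and $n_{i,j}\ne\infty$ for $j<\tilde\alpha_i$; $\beta_{i,j}>\beta_{i,j'}$ for $j'<j$ if $j$ is a limit ordinal; and (positive type) whenever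 $n_{i,j}\neq\infty$, in the unique representation $n_{i,j}\beta_{i,j}=\sum_{(i',j')<_{lex}(i,j)}m^{(i,j)}_{i',j'}\beta_{i',j'}$ (integers, almost all $0$, with $0\le m^{(i,j)}_{i',j'}<n_{i',j'}$ if $n_{i',j'}\ne\infty$) all coefficients are $\ge0$. Put $S_{i,j}=\{(i',j')<_{lex}(i,j): m^{(i,j)}_{i',j'}>0\}$. **SKP.** Given a sequence of values and constants $\theta_{i,j}\in k^*$, define $U_{i,j}$ inductively (on $i$, then $j$): $U_{i,1}=X_i$; for a successor $j$, $U_{i,j}=U_{i,j-1}^{n_{i,j-1}}-\theta_{i,j-1}U^{m^{(i,j-1)}}$ where $U^{m^{(i,j)}}=\prod_{(i',j')\in S_{i,j}}U_{i',j'}^{m^{(i,j)}_{i',j'}}$; for a limit ordinal $j$, $U_{i,j}=\lim_{j'\to j}U_{i,j'}$ (adic limit in $k^{(i-1)}[[X_i]]$; it exists and lies in $k^{(i-1)}[X_i]$). If such a limit is $0$, put $\alpha_i=j$, $\beta_{i,j}=\infty$ and stop for this $i$; otherwise continue. If the construction never stops, $\alpha_i=\tilde\alpha_i$. The datum $[U_{i,j},\beta_{i,j}]_{0\le i\le d,1\le j\le\alpha_i}$ is called an SKP. **Acceptable vectors and adic expansions.** A vector $\alpha'=(\alpha'_0,\dots,\alpha'_d)$ of ordinals with $1\le\alpha'_i\le\alpha_i$ is acceptable if the definition of the $U_{i,j}$ with $j\le\alpha'_i$ involves only key polynomials with indices in $\alpha'$: for all $i$ and $j<\alpha'_i$, every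 $(i',j')\in S_{i,j}$ with $i'<i$ has $j'\le\alpha'_{i'}$. The $(U)_{\alpha'}$-adic expansion of $f\in k^{(d)}$ is the unique expansion $f=\sum_I c_IU^I$ ($c_I\in k$), a power series in the $U_{i,j}$, $j\le\alpha'_i$ (zero key polynomials are not used), where each $U^I=\prod U_{i,j}^{I_{i,j}}$ is a finite product and $0\le I_{i,j}<n_{i,j}$ for all $j<\alpha'_i$. **The map.** $\nu_{\alpha'}(U^I)=\sum_{i,j}I_{i,j}\beta_{i,j}$ for monomials of this form, and $\nu_{\alpha'}(f)=\min\{\nu_{\alpha'}(U^I): c_I\ne0\}$.
   Formalization: An SKP is additionally required to have every monomial U^{m^{(i,j)}} used in the construction involve only constructed, nonzero key polynomials (none of value ∞); if a zero limit key polynomial were allowed there, the claim would fail. *)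

theory Defs
  imports
    "HOL-Library.FuncSet"
    "HOL-Library.Function_Algebras"
    "HOL-Library.Extended_Nat"
    "HOL-Computational_Algebra.Group_Closure"
    "HOL-Computational_Algebra.Fraction_Field"
begin

section \<open>Power series in finitely many variables\<close>

text \<open>
  The variables are indexed by a finite type \<^typ>\<open>'n\<close>; when \<^typ>\<open>'n\<close> is a linear order with
  \<open>d + 1\<close> elements it plays the role of \<open>{0, ..., d}\<close>, and \<open>('n, 'k) mfps\<close> is
  \<open>k[[X_0, ..., X_d]]\<close>. An exponent is a function \<^typ>\<open>'n \<Rightarrow> nat\<close>, with pointwise addition.
\<close>

typedef ('n, 'k) mfps = "UNIV :: (('n \<Rightarrow> nat) \<Rightarrow> 'k) set"
  morphisms mcoeff Abs_mfps ..

lemma mcoeff_Abs [simp]: "mcoeff (Abs_mfps c) = c"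
  by (simp add: Abs_mfps_inverse)

lemma mfps_eqI: "(\<And>e. mcoeff f e = mcoeff g e) \<Longrightarrow> f = g"
  by (simp add: mcoeff_inject [symmetric] fun_eq_iff)

lemma mfps_eq_iff: "f = g \<longleftrightarrow> (\<forall>e. mcoeff f e = mcoeff g e)"
  by (auto intro: mfps_eqI)

lemma finite_exponent_splits:
  fixes e :: "'n::finite \<Rightarrow> nat"
  shows "finite {(a, b). a + b = e}"
proof -
  have "finite (Pi\<^sub>E UNIV (\<lambda>i::'n. {..e i}))"
    by (rule finite_PiE) auto
  then have "finite (Pi\<^sub>E UNIV (\<lambda>i::'n. {..e i}) \<times> Pi\<^sub>E UNIV (\<lambda>i::'n. {..e i}))"
    by (rule finite_cartesian_product) fact
  then show ?thesis
    by (rule rev_finite_subset) auto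
qed

lemma finite_exponent_splits':
  fixes e :: "'n::finite \<Rightarrow> nat"
  shows "finite {p. fst p + snd p = e}"
  using finite_exponent_splits [of e] by (simp add: case_prod_unfold)

instantiation mfps :: (finite, comm_ring_1) comm_ring_1
begin

definition zero_mfps :: "('a, 'b) mfps" where
  "0 = Abs_mfps (\<lambda>e. 0)"

definition one_mfps :: "('a, 'b) mfps" where
  "1 = Abs_mfps (\<lambda>e. if e = 0 then 1 else 0)"

definition plus_mfps :: "('a, 'b) mfps \<Rightarrow> ('a, 'b) mfps \<Rightarrow> ('a, 'b) mfps" where
  "f + g = Abs_mfps (\<lambda>e. mcoeff f e + mcoeff g e)"

definition minus_mfps :: "('a, 'b) mfps \<Rightarrow> ('a, 'b) mfps \<Rightarrow> ('a, 'b) mfps" where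
  "f - g = Abs_mfps (\<lambda>e. mcoeff f e - mcoeff g e)"

definition uminus_mfps :: "('a, 'b) mfps \<Rightarrow> ('a, 'b) mfps" where
  "- f = Abs_mfps (\<lambda>e. - mcoeff f e)"

definition times_mfps :: "('a, 'b) mfps \<Rightarrow> ('a, 'b) mfps \<Rightarrow> ('a, 'b) mfps" where
  "f * g = Abs_mfps (\<lambda>e. \<Sum>(a, b)\<in>{(a, b). a + b = e}. mcoeff f a * mcoeff g b)"

lemma mcoeff_simps [simp]:
  fixes f g :: "('a, 'b) mfps"
  shows "mcoeff (0 :: ('a, 'b) mfps) e = 0"
    and "mcoeff (1 :: ('a, 'b) mfps) e = (if e = 0 then 1 else 0)"
    and "mcoeff (f + g) e = mcoeff f e + mcoeff g e"
    and "mcoeff (f - g) e = mcoeff f e - mcoeff g e"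
    and "mcoeff (- f) e = - mcoeff f e"
  by (simp_all add: zero_mfps_def one_mfps_def plus_mfps_def minus_mfps_def uminus_mfps_def)

lemma mcoeff_mult:
  fixes f g :: "('a, 'b) mfps"
  shows "mcoeff (f * g) e = (\<Sum>(a, b)\<in>{(a, b). a + b = e}. mcoeff f a * mcoeff g b)"
  by (simp add: times_mfps_def)

instance
proof
  fix f g h :: "('a, 'b) mfps"
  show "f * g * h = f * (g * h)"
  proof (rule mfps_eqI)
    fix e :: "'a \<Rightarrow> nat"
    have "mcoeff (f * g * h) e =
        (\<Sum>x\<in>{(p, c). p + c = e}. \<Sum>y\<in>{(a, b). a + b = fst x}.
           mcoeff f (fst y) * mcoeff g (snd y) * mcoeff h (snd x))"
      by (simp add: mcoeff_mult sum_distrib_right case_prod_unfold)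
    also have "\<dots> = (\<Sum>z\<in>(SIGMA x:{(p, c). p + c = e}. {(a, b). a + b = fst x}).
           mcoeff f (fst (snd z)) * mcoeff g (snd (snd z)) * mcoeff h (snd (fst z)))"
      by (subst sum.Sigma) (simp_all add: finite_exponent_splits' case_prod_unfold)
    also have "\<dots> = (\<Sum>z\<in>(SIGMA x:{(a, p). a + p = e}. {(b, c). b + c = snd x}).
           mcoeff f (fst (fst z)) * (mcoeff g (fst (snd z)) * mcoeff h (snd (snd z))))"
      by (rule sum.reindex_bij_witness
            [where i = "\<lambda>((a, p), (b, c)). ((a + b, c), (a, b))"
               and j = "\<lambda>((p, c), (a, b)). ((a, b + c), (b, c))"])
         (clarsimp simp: add.assoc mult.assoc)+
    also have "\<dots> = (\<Sum>x\<in>{(a, p). a + p = e}. \<Sum>y\<in>{(b, c). b + c = snd x}.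
           mcoeff f (fst x) * (mcoeff g (fst y) * mcoeff h (snd y)))"
      by (subst sum.Sigma) (simp_all add: finite_exponent_splits' case_prod_unfold)
    also have "\<dots> = mcoeff (f * (g * h)) e"
      by (simp add: mcoeff_mult sum_distrib_left case_prod_unfold)
    finally show "mcoeff (f * g * h) e = mcoeff (f * (g * h)) e" .
  qed
  show "f * g = g * f"
  proof (rule mfps_eqI)
    fix e :: "'a \<Rightarrow> nat"
    show "mcoeff (f * g) e = mcoeff (g * f) e"
      unfolding mcoeff_mult
      by (rule sum.reindex_bij_witness [where i = prod.swap and j = prod.swap])
         (auto simp: add.commute mult.commute)
  qed
  show "1 * f = f"
  proof (rule mfps_eqI)
    fix e :: "'a \<Rightarrow> nat"
    have "mcoeff (1 * f) e = (\<Sum>x\<in>{(0, e)}. mcoeff 1 (fst x) * mcoeff f (snd x))"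
      unfolding mcoeff_mult case_prod_unfold
      by (rule sum.mono_neutral_right) (auto simp: finite_exponent_splits')
    then show "mcoeff (1 * f) e = mcoeff f e" by simp
  qed
  show "(f + g) * h = f * h + g * h"
    by (rule mfps_eqI)
       (simp add: mcoeff_mult case_prod_unfold distrib_right sum.distrib)
  show "(0 :: ('a, 'b) mfps) \<noteq> 1"
    by (auto simp: mfps_eq_iff)
qed (rule mfps_eqI, simp add: algebra_simps)+

end

lemma exposed_exponents:
  fixes A B :: "('n \<Rightarrow> nat) set"
  assumes "finite V" "A \<noteq> {}" "B \<noteq> {}"
  shows "\<exists>a\<in>A. \<exists>b\<in>B. \<forall>a'\<in>A. \<forall>b'\<in>B. a' + b' = a + b \<longrightarrow> (\<forall>i\<in>V. a' i = a i \<and> b' i = b i)"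
  using assms
proof (induction V arbitrary: A B rule: finite_induct)
  case empty
  then show ?case by auto
next
  case (insert x V)
  define p where "p = (LEAST p. p \<in> (\<lambda>a. a x) ` A)"
  define q where "q = (LEAST q. q \<in> (\<lambda>b. b x) ` B)"
  have p: "p \<in> (\<lambda>a. a x) ` A"
    unfolding p_def by (rule LeastI_ex) (use insert.prems in blast)
  have q: "q \<in> (\<lambda>b. b x) ` B"
    unfolding q_def by (rule LeastI_ex) (use insert.prems in blast)
  have pl: "p \<le> a x" if "a \<in> A" for a
    unfolding p_def by (rule Least_le) (use that in blast)
  have ql: "q \<le> b x" if "b \<in> B" for b
    unfolding q_def by (rule Least_le) (use that in blast)
  have "{a\<in>A. a x = p} \<noteq> {}" "{b\<in>B. b x = q} \<noteq> {}"
    using p q by blast+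
  from insert.IH [OF this]
  obtain a b where ab: "a \<in> A" "a x = p" "b \<in> B" "b x = q"
    and *: "\<And>a' b'. \<lbrakk>a' \<in> A; a' x = p; b' \<in> B; b' x = q; a' + b' = a + b\<rbrakk>
              \<Longrightarrow> \<forall>i\<in>V. a' i = a i \<and> b' i = b i"
    by blast
  have "\<forall>i\<in>insert x V. a' i = a i \<and> b' i = b i"
    if h: "a' \<in> A" "b' \<in> B" "a' + b' = a + b" for a' b'
  proof -
    have "a' x + b' x = a x + b x"
      using fun_cong [OF h(3), of x] by simp
    with pl [OF h(1)] ql [OF h(2)] ab have "a' x = p" "b' x = q" by linarith+
    with * [OF h(1) _ h(2) _ h(3)] ab show ?thesis by simp
  qed
  with ab show ?case by blast
qed

instance mfps :: (finite, idom) idom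
proof
  fix f g :: "('a, 'b) mfps"
  assume "f \<noteq> 0" "g \<noteq> 0"
  then have "{a. mcoeff f a \<noteq> 0} \<noteq> {}" "{b. mcoeff g b \<noteq> 0} \<noteq> {}"
    by (auto simp: mfps_eq_iff)
  from exposed_exponents [OF finite [of UNIV] this]
  obtain a b where ab: "mcoeff f a \<noteq> 0" "mcoeff g b \<noteq> 0"
    and *: "\<And>a' b'. \<lbrakk>mcoeff f a' \<noteq> 0; mcoeff g b' \<noteq> 0; a' + b' = a + b\<rbrakk>
              \<Longrightarrow> a' = a \<and> b' = b"
    unfolding fun_eq_iff [of _ a] fun_eq_iff [of _ b] by blast
  have "mcoeff (f * g) (a + b) = (\<Sum>x\<in>{(a, b)}. mcoeff f (fst x) * mcoeff g (snd x))"
    unfolding mcoeff_mult case_prod_unfold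
    by (rule sum.mono_neutral_right) (use * in \<open>auto simp: finite_exponent_splits'\<close>)
  then have "mcoeff (f * g) (a + b) \<noteq> 0"
    using ab by simp
  then show "f * g \<noteq> 0"
    by (metis mcoeff_simps(1))
qed

definition mconst :: "'k \<Rightarrow> ('n::finite, 'k::comm_ring_1) mfps" where
  "mconst c = Abs_mfps (\<lambda>e. if e = 0 then c else 0)"

definition mvar :: "'n \<Rightarrow> ('n::finite, 'k::comm_ring_1) mfps" where
  "mvar i = Abs_mfps (\<lambda>e. if e = (\<lambda>l. if l = i then 1 else 0) then 1 else 0)"

text \<open>\<open>f\<close> and \<open>g\<close> are congruent modulo the \<open>N\<close>-th power of the maximal ideal \<open>(X_0, ..., X_d)\<close>.\<close>

definition adic_close :: "nat \<Rightarrow> ('n::finite, 'k) mfps \<Rightarrow> ('n, 'k) mfps \<Rightarrow> bool" where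
  "adic_close N f g \<longleftrightarrow> (\<forall>e. (\<Sum>i\<in>UNIV. e i) < N \<longrightarrow> mcoeff f e = mcoeff g e)"

text \<open>Unconditional summation in the adic topology, along the finite subsets of the index set.\<close>

definition has_adic_sum ::
  "('a \<Rightarrow> ('n::finite, 'k::comm_ring_1) mfps) \<Rightarrow> ('n, 'k) mfps \<Rightarrow> bool" where
  "has_adic_sum t f \<longleftrightarrow>
     (\<forall>N. \<exists>F. finite F \<and> (\<forall>F'. finite F' \<and> F \<subseteq> F' \<longrightarrow> adic_close N (\<Sum>x\<in>F'. t x) f))"


section \<open>Ordered groups\<close>

definition nsmul :: "nat \<Rightarrow> 'g \<Rightarrow> 'g::ab_group_add" where
  "nsmul r x = (\<Sum>_<r. x)"

definition zsmul :: "int \<Rightarrow> 'g \<Rightarrow> 'g::ab_group_add" where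
  "zsmul z x = (if 0 \<le> z then nsmul (nat z) x else - nsmul (nat (- z)) x)"

definition convex_subgroup :: "'g::linordered_ab_group_add set \<Rightarrow> bool" where
  "convex_subgroup H \<longleftrightarrow>
     0 \<in> H \<and> (\<forall>x\<in>H. \<forall>y\<in>H. x - y \<in> H) \<and> (\<forall>x\<in>H. \<forall>y. 0 \<le> y \<and> y \<le> x \<longrightarrow> y \<in> H)"

text \<open>The rank is the number of proper convex subgroups (the trivial one included). As always
  with \<^const>\<open>card\<close>, an infinite rank gives 0, which is also the rank of the trivial group.\<close>

definition convex_rank :: "'g::linordered_ab_group_add itself \<Rightarrow> nat" where
  "convex_rank _ = card {H :: 'g set. convex_subgroup H \<and> H \<noteq> UNIV}"


section \<open>Ordinal indices\<close>

text \<open>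
  The ordinals \<open>\<ge> 1\<close> are represented by the elements of an arbitrary well-ordered type: its least
  element stands for 1. Only the order of the indices matters, and an index set
  \<open>1 \<le> j \<le> \<alpha>\<close> becomes \<open>{j. j \<le> \<alpha>}\<close>.
\<close>

definition ofirst :: "'o::wellorder" where
  "ofirst = (LEAST j. True)"

text \<open>Only meaningful if \<open>j\<close> is not the greatest element.\<close>

definition osuc :: "'o::wellorder \<Rightarrow> 'o" where
  "osuc j = (LEAST x. j < x)"

definition olimit :: "'o::wellorder \<Rightarrow> bool" where
  "olimit j \<longleftrightarrow> j \<noteq> ofirst \<and> (\<forall>x<j. osuc x < j)"


section \<open>Sequences of values\<close>

text \<open>\<open>a i\<close> is the ordinal written \<open>\<alpha>~_i\<close>. The indices \<open>(i', j')\<close> of the family that are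
  lexicographically smaller than \<open>(i, j)\<close>:\<close>

definition prec :: "('n::linorder \<Rightarrow> 'o::wellorder) \<Rightarrow> 'n \<Rightarrow> 'o \<Rightarrow> ('n \<times> 'o) set" where
  "prec a i j = {(i', j'). j' \<le> a i' \<and> (i' < i \<or> i' = i \<and> j' < j)}"

definition rel_order ::
  "('n::linorder \<Rightarrow> 'o::wellorder) \<Rightarrow> ('n \<Rightarrow> 'o \<Rightarrow> 'g::linordered_ab_group_add) \<Rightarrow> 'n \<Rightarrow> 'o \<Rightarrow> enat"
  where
  "rel_order a \<beta> i j =
     Inf {enat r | r. 1 \<le> r \<and> nsmul r (\<beta> i j) \<in> group_closure ((\<lambda>(i', j'). \<beta> i' j') ` prec a i j)}"

definition value_repr ::
  "('n::linorder \<Rightarrow> 'o::wellorder) \<Rightarrow> ('n \<Rightarrow> 'o \<Rightarrow> 'g::linordered_ab_group_add) \<Rightarrow> 'n \<Rightarrow> 'o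
     \<Rightarrow> ('n \<times> 'o \<Rightarrow> int) \<Rightarrow> bool" where
  "value_repr a \<beta> i j m \<longleftrightarrow>
     finite {q. m q \<noteq> 0} \<and> {q. m q \<noteq> 0} \<subseteq> prec a i j \<and>
     (\<forall>(i', j')\<in>prec a i j. rel_order a \<beta> i' j' \<noteq> \<infinity> \<longrightarrow>
        0 \<le> m (i', j') \<and> m (i', j') < int (the_enat (rel_order a \<beta> i' j'))) \<and>
     nsmul (the_enat (rel_order a \<beta> i j)) (\<beta> i j) = (\<Sum>(i', j') | m (i', j') \<noteq> 0. zsmul (m (i', j')) (\<beta> i' j'))"

definition value_coeff ::
  "('n::linorder \<Rightarrow> 'o::wellorder) \<Rightarrow> ('n \<Rightarrow> 'o \<Rightarrow> 'g::linordered_ab_group_add) \<Rightarrow> 'n \<Rightarrow> 'o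
     \<Rightarrow> 'n \<times> 'o \<Rightarrow> int" where
  "value_coeff a \<beta> i j = (THE m. value_repr a \<beta> i j m)"

definition value_supp ::
  "('n::linorder \<Rightarrow> 'o::wellorder) \<Rightarrow> ('n \<Rightarrow> 'o \<Rightarrow> 'g::linordered_ab_group_add) \<Rightarrow> 'n \<Rightarrow> 'o
     \<Rightarrow> ('n \<times> 'o) set" where
  "value_supp a \<beta> i j = {q \<in> prec a i j. 0 < value_coeff a \<beta> i j q}"

definition value_sequence ::
  "('n::{finite,linorder} \<Rightarrow> 'o::wellorder) \<Rightarrow> ('n \<Rightarrow> 'o \<Rightarrow> 'g::linordered_ab_group_add) \<Rightarrow> bool"
  where
  "value_sequence a \<beta> \<longleftrightarrow>
     a (Min UNIV) = ofirst \<and>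
     (\<forall>i. \<forall>j\<le>a i. 0 < \<beta> i j) \<and>
     (\<forall>i. \<forall>j<a i. rel_order a \<beta> i j \<noteq> \<infinity> \<and>
        nsmul (the_enat (rel_order a \<beta> i j)) (\<beta> i j) < \<beta> i (osuc j)) \<and>
     (\<forall>i. \<forall>j\<le>a i. olimit j \<longrightarrow> (\<forall>j'<j. \<beta> i j' < \<beta> i j)) \<and>
     (\<forall>i. \<forall>j\<le>a i. rel_order a \<beta> i j \<noteq> \<infinity> \<longrightarrow> (\<forall>q\<in>prec a i j. 0 \<le> value_coeff a \<beta> i j q))"


section \<open>Sequences of key polynomials\<close>

definition adic_limit_at ::
  "('o::wellorder \<Rightarrow> ('n::finite, 'k) mfps) \<Rightarrow> 'o \<Rightarrow> ('n, 'k) mfps \<Rightarrow> bool" where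
  "adic_limit_at u j f \<longleftrightarrow> (\<forall>N. \<exists>j0<j. \<forall>j'. j0 \<le> j' \<and> j' < j \<longrightarrow> adic_close N (u j') f)"

text \<open>
  \<open>\<alpha>\<close> and \<open>U\<close> are what the inductive construction produces from the sequence of values \<open>(a, \<beta>)\<close>
  and the constants \<open>\<theta>\<close>. Only the \<open>U i j\<close> with \<open>j \<le> \<alpha> i\<close> are meaningful, and among these
  \<open>\<beta>_{i,j} = \<infinity>\<close> is encoded by \<open>U i j = 0\<close> (the group element \<open>\<beta> i j\<close> is then disregarded).
  Hence a monomial occurring in the recursion has to be a monomial in key polynomials that have
  been constructed and have a finite value: this is the second conjunct of the successor clause.
\<close>

definition SKP ::
  "('n::{finite,linorder} \<Rightarrow> 'o::wellorder) \<Rightarrow> ('n \<Rightarrow> 'o \<Rightarrow> 'g::linordered_ab_group_add)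
     \<Rightarrow> ('n \<Rightarrow> 'o \<Rightarrow> 'k::field) \<Rightarrow> ('n \<Rightarrow> 'o) \<Rightarrow> ('n \<Rightarrow> 'o \<Rightarrow> ('n, 'k) mfps) \<Rightarrow> bool" where
  "SKP a \<beta> \<theta> \<alpha> U \<longleftrightarrow>
     value_sequence a \<beta> \<and>
     (\<forall>i. \<forall>j<a i. \<theta> i j \<noteq> 0) \<and>
     (\<forall>i. \<alpha> i \<le> a i) \<and>
     (\<forall>i. U i ofirst = mvar i) \<and>
     (\<forall>i. \<forall>j<\<alpha> i.
        (\<forall>(i', j')\<in>value_supp a \<beta> i j. j' \<le> \<alpha> i' \<and> U i' j' \<noteq> 0) \<and>
        U i (osuc j) = U i j ^ the_enat (rel_order a \<beta> i j)
          - mconst (\<theta> i j) * (\<Prod>(i', j')\<in>value_supp a \<beta> i j. U i' j' ^ nat (value_coeff a \<beta> i j (i', j')))) \<and>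
     (\<forall>i. \<forall>j\<le>\<alpha> i. olimit j \<longrightarrow> adic_limit_at (U i) j (U i j)) \<and>
     (\<forall>i. \<forall>j<\<alpha> i. olimit j \<longrightarrow> U i j \<noteq> 0) \<and>
     (\<forall>i. \<alpha> i < a i \<longrightarrow> olimit (\<alpha> i) \<and> U i (\<alpha> i) = 0)"

definition acceptable ::
  "('n::linorder \<Rightarrow> 'o::wellorder) \<Rightarrow> ('n \<Rightarrow> 'o \<Rightarrow> 'g::linordered_ab_group_add)
     \<Rightarrow> ('n \<Rightarrow> 'o) \<Rightarrow> ('n \<Rightarrow> 'o) \<Rightarrow> bool" where
  "acceptable a \<beta> \<alpha> \<alpha>' \<longleftrightarrow>
     (\<forall>i. \<alpha>' i \<le> \<alpha> i) \<and>
     (\<forall>i. \<forall>j<\<alpha>' i. \<forall>(i', j')\<in>value_supp a \<beta> i j. i' < i \<longrightarrow> j' \<le> \<alpha>' i')"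


section \<open>Adic expansions and the associated map\<close>

definition adic_index ::
  "('n::{finite,linorder} \<Rightarrow> 'o::wellorder) \<Rightarrow> ('n \<Rightarrow> 'o \<Rightarrow> 'g::linordered_ab_group_add)
     \<Rightarrow> ('n \<Rightarrow> 'o \<Rightarrow> ('n, 'k::field) mfps) \<Rightarrow> ('n \<Rightarrow> 'o) \<Rightarrow> ('n \<times> 'o \<Rightarrow> nat) \<Rightarrow> bool" where
  "adic_index a \<beta> U \<alpha>' I \<longleftrightarrow>
     finite {q. I q \<noteq> 0} \<and>
     (\<forall>i j. I (i, j) \<noteq> 0 \<longrightarrow> j \<le> \<alpha>' i \<and> U i j \<noteq> 0) \<and>
     (\<forall>i. \<forall>j<\<alpha>' i. enat (I (i, j)) < rel_order a \<beta> i j)"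

definition key_monomial ::
  "('n \<Rightarrow> 'o \<Rightarrow> ('n::finite, 'k::field) mfps) \<Rightarrow> ('n \<times> 'o \<Rightarrow> nat) \<Rightarrow> ('n, 'k) mfps" where
  "key_monomial U I = (\<Prod>(i, j) | I (i, j) \<noteq> 0. U i j ^ I (i, j))"

definition monomial_value ::
  "('n \<Rightarrow> 'o \<Rightarrow> 'g::linordered_ab_group_add) \<Rightarrow> ('n \<times> 'o \<Rightarrow> nat) \<Rightarrow> 'g" where
  "monomial_value \<beta> I = (\<Sum>(i, j) | I (i, j) \<noteq> 0. nsmul (I (i, j)) (\<beta> i j))"

definition is_adic_expansion ::
  "('n::{finite,linorder} \<Rightarrow> 'o::wellorder) \<Rightarrow> ('n \<Rightarrow> 'o \<Rightarrow> 'g::linordered_ab_group_add)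
     \<Rightarrow> ('n \<Rightarrow> 'o \<Rightarrow> ('n, 'k::field) mfps) \<Rightarrow> ('n \<Rightarrow> 'o)
     \<Rightarrow> (('n \<times> 'o \<Rightarrow> nat) \<Rightarrow> 'k) \<Rightarrow> ('n, 'k) mfps \<Rightarrow> bool" where
  "is_adic_expansion a \<beta> U \<alpha>' c f \<longleftrightarrow>
     (\<forall>I. c I \<noteq> 0 \<longrightarrow> adic_index a \<beta> U \<alpha>' I) \<and>
     has_adic_sum (\<lambda>I. mconst (c I) * key_monomial U I) f"

definition adic_expansion ::
  "('n::{finite,linorder} \<Rightarrow> 'o::wellorder) \<Rightarrow> ('n \<Rightarrow> 'o \<Rightarrow> 'g::linordered_ab_group_add)
     \<Rightarrow> ('n \<Rightarrow> 'o \<Rightarrow> ('n, 'k::field) mfps) \<Rightarrow> ('n \<Rightarrow> 'o)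
     \<Rightarrow> ('n, 'k) mfps \<Rightarrow> ('n \<times> 'o \<Rightarrow> nat) \<Rightarrow> 'k" where
  "adic_expansion a \<beta> U \<alpha>' f = (THE c. is_adic_expansion a \<beta> U \<alpha>' c f)"

text \<open>The minimum is over a possibly infinite set, hence \<^const>\<open>Least\<close> rather than
  \<^const>\<open>Min\<close>. The value at \<open>f = 0\<close> is irrelevant.\<close>

definition nu ::
  "('n::{finite,linorder} \<Rightarrow> 'o::wellorder) \<Rightarrow> ('n \<Rightarrow> 'o \<Rightarrow> 'g::linordered_ab_group_add)
     \<Rightarrow> ('n \<Rightarrow> 'o \<Rightarrow> ('n, 'k::field) mfps) \<Rightarrow> ('n \<Rightarrow> 'o) \<Rightarrow> ('n, 'k) mfps \<Rightarrow> 'g" where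
  "nu a \<beta> U \<alpha>' f =
     (LEAST v. \<exists>I. adic_expansion a \<beta> U \<alpha>' f I \<noteq> 0 \<and> v = monomial_value \<beta> I)"


section \<open>Valuations of the fraction field\<close>

text \<open>Valuations are maps on the nonzero elements of the field; the value at 0 is disregarded.\<close>

definition field_valuation :: "('f::field \<Rightarrow> 'g::linordered_ab_group_add) \<Rightarrow> bool" where
  "field_valuation v \<longleftrightarrow>
     (\<forall>x y. x \<noteq> 0 \<longrightarrow> y \<noteq> 0 \<longrightarrow> v (x * y) = v x + v y) \<and>
     (\<forall>x y. x \<noteq> 0 \<longrightarrow> y \<noteq> 0 \<longrightarrow> x + y \<noteq> 0 \<longrightarrow> min (v x) (v y) \<le> v (x + y))"

definition k_valuation ::
  "(('n::finite, 'k::field) mfps fract \<Rightarrow> 'g::linordered_ab_group_add) \<Rightarrow> bool" where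
  "k_valuation v \<longleftrightarrow> field_valuation v \<and> (\<forall>c. c \<noteq> 0 \<longrightarrow> v (Fract (mconst c) 1) = 0)"

end

(*
  The expansion exists and is unique because each U_{i,j} has X_i^{d_{i,j}} as least monomial for the
  lexicographic order with X_0 most significant; d_{i,j} is the product of the n_{i,j'} with j' < j. If
  infinitely many of these exceed 1, the U_{i,j'} tend to 0 adically, so U_{i,j} = 0. In either case the
  normal exponents of the i-th variable are the mixed radix digits of a degree, and the normal
  monomials are indexed by all multidegrees.

  Rewriting a power U_{i,j}^{n_{i,j}} as U_{i,j+1} + theta U^m, any monomial in the key polynomials
  has an expansion into normal monomials of at least its value. This is an induction on
  multidegrees, with X_d most significant: U_{i,j+1} keeps the multidegree and raises the value, U^m
  keeps the value and lowers the multidegree; passages to limit ordinals use that the elements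
  of value at least gamma are adically closed. Monotonicity of nu in the vector alpha' is a special case.

  For multiplicativity the values beta are refined lexicographically by independent rational
  perturbations of the last key polynomial of each variable. The refined values of normal monomials are
  pairwise distinct, the product of two normal monomials is a constant times a normal monomial plus
  terms of higher value, and so initial terms multiply.
*)

theory Submission
  imports Defs "HOL-Library.Multiset" "HOL-Library.Poly_Mapping"
    "HOL-Library.Product_Lexorder" "HOL-Library.Product_Plus"
begin

section \<open>Adic order and leading exponents\<close>

text \<open>The two lexicographic orders rest on one estimate: the factors of \<open>U^m\<close> in
  the variable X_i alone form a mixed radix number, of value below \<beta>_{i,j} and of degree below
  d_{i,j}. As \<open>U^m\<close> has value n_{i,j} \<beta>_{i,j}, it must contain an earlier
  variable, so with X_0 most significant it comes after the leading power of X_i. With X_d most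
  significant it comes before, having smaller degree in X_i and no later variable.

  The exponent of the last key polynomial of a variable is unbounded in a normal monomial, even when
  its relative order is finite. Distinct normal monomials may then share a value, and initial forms
  could cancel in a product. Perturbing the last key polynomials removes such ties, but the
  relations n_{i,j} w_{i,j} = w(U^m) must survive, which forces all other perturbations and makes
  division by n_{i,j} necessary.

  Values are not well-ordered, and supports may be infinite. Minima exist because the value of a
  normal monomial is monotone in its multidegree, so that Dickson's lemma excludes decreasing
  sequences.\<close>

lemma adic_close_refl [simp]: "adic_close N f f"
  by (simp add: adic_close_def)

lemma adic_close_mono: "adic_close N f g \<Longrightarrow> M \<le> N \<Longrightarrow> adic_close M f g"
  by (simp add: adic_close_def)

lemma adic_close_diff:
  fixes f g :: "('n::finite, 'k::comm_ring_1) mfps"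
  shows "adic_close N f f' \<Longrightarrow> adic_close N g g' \<Longrightarrow> adic_close N (f - g) (f' - g')"
  by (simp add: adic_close_def)

lemma adic_close_mult:
  fixes f g :: "('n::finite, 'k::comm_ring_1) mfps"
  assumes "adic_close N f f'" "adic_close N g g'"
  shows "adic_close N (f * g) (f' * g')"
  unfolding adic_close_def
proof (intro allI impI)
  fix e :: "'n \<Rightarrow> nat" assume e: "(\<Sum>i\<in>UNIV. e i) < N"
  have "mcoeff f a * mcoeff g b = mcoeff f' a * mcoeff g' b" if "a + b = e" for a b
  proof -
    from that have "(\<Sum>i\<in>UNIV. e i) = (\<Sum>i\<in>UNIV. a i) + (\<Sum>i\<in>UNIV. b i)"
      by (auto simp: sum.distrib)
    with e assms show ?thesis
      by (simp add: adic_close_def)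
  qed
  then show "mcoeff (f * g) e = mcoeff (f' * g') e"
    unfolding mcoeff_mult by (auto intro!: sum.cong)
qed

lemma adic_close_all_iff: "(\<forall>N. adic_close N f g) \<longleftrightarrow> f = g"
  by (auto simp: adic_close_def mfps_eq_iff)

text \<open>Membership in the \<open>N\<close>-th power of the maximal ideal. A predicate, unlike an
  order function, needs no infinite value at 0.\<close>

definition ordge :: "nat \<Rightarrow> ('n::finite, 'k::comm_ring_1) mfps \<Rightarrow> bool" where
  "ordge N f \<longleftrightarrow> adic_close N f 0"

lemma ordge_zero [simp]: "ordge 0 f"
  by (simp add: ordge_def adic_close_def)

lemma ordge_mono: "ordge N f \<Longrightarrow> M \<le> N \<Longrightarrow> ordge M f"
  unfolding ordge_def by (rule adic_close_mono)

lemma ordge_diff: "ordge N f \<Longrightarrow> ordge N g \<Longrightarrow> ordge N (f - g)"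
  by (simp add: ordge_def adic_close_def)

lemma ordge_close: "ordge N f \<Longrightarrow> adic_close N f g \<Longrightarrow> ordge N g"
  by (simp add: ordge_def adic_close_def)

lemma ordge_all: "(\<And>N. ordge N f) \<Longrightarrow> f = 0"
  unfolding ordge_def using adic_close_all_iff by blast

lemma ordge_mult:
  fixes f g :: "('n::finite, 'k::comm_ring_1) mfps"
  assumes "ordge M f" "ordge N g"
  shows "ordge (M + N) (f * g)"
  unfolding ordge_def adic_close_def
proof (intro allI impI)
  fix e :: "'n \<Rightarrow> nat" assume e: "(\<Sum>i\<in>UNIV. e i) < M + N"
  have "mcoeff f a * mcoeff g b = 0" if "a + b = e" for a b
  proof -
    from that have "(\<Sum>i\<in>UNIV. e i) = (\<Sum>i\<in>UNIV. a i) + (\<Sum>i\<in>UNIV. b i)"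
      by (auto simp: sum.distrib)
    with e have "(\<Sum>i\<in>UNIV. a i) < M \<or> (\<Sum>i\<in>UNIV. b i) < N" by linarith
    with assms show ?thesis
      by (auto simp: ordge_def adic_close_def)
  qed
  then show "mcoeff (f * g) e = mcoeff 0 e"
    unfolding mcoeff_mult by (auto intro!: sum.neutral)
qed

lemma ordge_mult_left: "ordge N f \<Longrightarrow> ordge N (g * f)"
  using ordge_mult [of 0 g N f] by simp

lemma ordge_power:
  assumes "ordge M f" shows "ordge (r * M) (f ^ r)"
  by (induction r) (auto intro: ordge_mult assms)

lemma ordge_prod_mset:
  assumes "\<forall>q\<in>#J. ordge (r q) (u q)"
  shows "ordge (\<Sum>q\<in>#J. r q) (\<Prod>q\<in>#J. u q)"
  using assms by (induction J) (auto intro: ordge_mult)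

lemma mcoeff_mconst_mult [simp]:
  fixes f :: "('n::finite, 'k::comm_ring_1) mfps"
  shows "mcoeff (mconst c * f) e = c * mcoeff f e"
proof -
  have "mcoeff (mconst c * f) e = (\<Sum>x\<in>{(0, e)}. mcoeff (mconst c :: ('n, 'k) mfps) (fst x) * mcoeff f (snd x))"
    unfolding mcoeff_mult case_prod_unfold
    by (rule sum.mono_neutral_right) (auto simp: finite_exponent_splits' mconst_def)
  then show ?thesis by (simp add: mconst_def)
qed

lemma mcoeff_sum: "mcoeff (\<Sum>x\<in>A. f x) e = (\<Sum>x\<in>A. mcoeff (f x :: ('n::finite, 'k::comm_ring_1) mfps) e)"
  by (induction A rule: infinite_finite_induct) auto

lemma mconst_1 [simp]: "mconst 1 = (1 :: ('n::finite, 'k::comm_ring_1) mfps)"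
  by (rule mfps_eqI) (simp add: mconst_def)

lemma mconst_0 [simp]: "mconst 0 = (0 :: ('n::finite, 'k::comm_ring_1) mfps)"
  by (rule mfps_eqI) (simp add: mconst_def)

lemma mconst_mult: "mconst (c * d) = mconst c * (mconst d :: ('n::finite, 'k::comm_ring_1) mfps)"
  by (rule mfps_eqI) (simp, simp add: mconst_def)

text \<open>The list fixes the significance of the variables. It is a parameter because two opposite
  orders occur: \<open>L0\<close> for leading exponents and \<open>L1\<close> for
  reductions.\<close>

fun lexless :: "'n list \<Rightarrow> ('n \<Rightarrow> nat) \<Rightarrow> ('n \<Rightarrow> nat) \<Rightarrow> bool" where
  "lexless [] a b \<longleftrightarrow> False"
| "lexless (x # xs) a b \<longleftrightarrow> a x < b x \<or> a x = b x \<and> lexless xs a b"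

lemma lexless_irrefl [simp]: "\<not> lexless L a a"
  by (induction L) auto

lemma lexless_trans: "lexless L a b \<Longrightarrow> lexless L b c \<Longrightarrow> lexless L a c"
  by (induction L) auto

lemma lexless_add_right [simp]: "lexless L (a + c) (b + c) \<longleftrightarrow> lexless L a b"
  by (induction L) auto

lemma lexless_add_left [simp]: "lexless L (c + a) (c + b) \<longleftrightarrow> lexless L a b"
  by (induction L) auto

lemma wfp_lexless: "wfp (lexless L)"
proof (induction L)
  case Nil
  have "lexless [] = (\<lambda>a b :: 'a \<Rightarrow> nat. False)" by (simp add: fun_eq_iff)
  then show ?case by (simp add: wfp_def)
next
  case (Cons x xs)
  have "{(a, b). lexless (x # xs) a b} \<subseteq>
      inv_image (less_than <*lex*> {(a, b). lexless xs a b}) (\<lambda>a. (a x, a))"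
    by auto
  moreover have "wf (inv_image (less_than <*lex*> {(a, b). lexless xs a b}) (\<lambda>a. (a x, a)))"
    using Cons by (auto simp: wfp_def)
  ultimately show ?case
    unfolding wfp_def by (rule wf_subset [rotated])
qed

lemma lexless_first_diff:
  assumes "sorted_wrt (<) L" "i \<in> set L" "a i < b i" "\<forall>l<i. a l = b l"
  shows "lexless L a b"
  using assms by (induction L) auto

lemma lexless_last_diff:
  fixes L :: "'n::linorder list"
  assumes "sorted_wrt (>) L" "i \<in> set L" "a i < b i" "\<forall>l>i. a l = b l"
  shows "lexless L a b"
  using assms by (induction L) auto

text \<open>The least monomial is taken because a power series need not have a greatest one.
  Coefficient 1 keeps the recursion for expansion coefficients free of division.\<close>

definition leads :: "'n list \<Rightarrow> ('n \<Rightarrow> nat) \<Rightarrow> ('n::finite, 'k::comm_ring_1) mfps \<Rightarrow> bool" where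
  "leads L e f \<longleftrightarrow> mcoeff f e = 1 \<and> (\<forall>e'. mcoeff f e' \<noteq> 0 \<longrightarrow> e' = e \<or> lexless L e e')"

lemma leads_nonzero: "leads L e f \<Longrightarrow> f \<noteq> 0"
  by (auto simp: leads_def)

lemma leads_1: "leads L 0 1"
  by (auto simp: leads_def split: if_splits)

lemma leads_mult:
  fixes f g :: "('n::finite, 'k::comm_ring_1) mfps"
  assumes f: "leads L a f" and g: "leads L b g"
  shows "leads L (a + b) (f * g)"
proof -
  \<comment> \<open>By translation invariance of \<open>lexless\<close>, unless both exponents are
    leading their sum lies strictly beyond \<open>a + b\<close>, so nothing cancels there.\<close>
  have key: "a' = a \<and> b' = b \<or> lexless L (a + b) (a' + b')"
    if "mcoeff f a' \<noteq> 0" "mcoeff g b' \<noteq> 0" for a' b'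
  proof -
    have "a' = a \<or> lexless L a a'" "b' = b \<or> lexless L b b'"
      using f g that by (auto simp: leads_def)
    then show ?thesis
      using lexless_trans [of L "a + b" "a' + b" "a' + b'"] by auto
  qed
  have "mcoeff (f * g) (a + b) = (\<Sum>x\<in>{(a, b)}. mcoeff f (fst x) * mcoeff g (snd x))"
    unfolding mcoeff_mult case_prod_unfold
  proof (rule sum.mono_neutral_right)
    show "\<forall>i\<in>{p. fst p + snd p = a + b} - {(a, b)}. mcoeff f (fst i) * mcoeff g (snd i) = 0"
    proof (rule ballI, rule ccontr)
      fix p assume p: "p \<in> {p. fst p + snd p = a + b} - {(a, b)}"
        and "mcoeff f (fst p) * mcoeff g (snd p) \<noteq> 0"
      then have "mcoeff f (fst p) \<noteq> 0" "mcoeff g (snd p) \<noteq> 0" by auto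
      from key [OF this] p show False by (cases p) auto
    qed
  qed (auto simp: finite_exponent_splits')
  moreover have "e' = a + b \<or> lexless L (a + b) e'" if "mcoeff (f * g) e' \<noteq> 0" for e'
  proof -
    from that obtain p where "p \<in> {(a, b). a + b = e'}" "(\<lambda>(a, b). mcoeff f a * mcoeff g b) p \<noteq> 0"
      unfolding mcoeff_mult by (meson sum.not_neutral_contains_not_neutral)
    then obtain x y where "x + y = e'" "mcoeff f x * mcoeff g y \<noteq> 0" by auto
    then show ?thesis using key [of x y] by (metis mult_not_zero)
  qed
  ultimately show ?thesis using f g by (simp add: leads_def)
qed

lemma leads_prod_mset:
  assumes "\<forall>q\<in>#J. leads L (e q) (u q)"
  shows "leads L (\<Sum>q\<in>#J. e q) (\<Prod>q\<in>#J. u q)"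
  using assms by (induction J) (auto intro: leads_mult leads_1)

lemma leads_power: "leads L e f \<Longrightarrow> leads L (\<lambda>i. r * e i) (f ^ r)"
proof (induction r)
  case 0
  have "(\<lambda>i. 0 * e i) = 0" by (simp add: fun_eq_iff)
  then show ?case by (simp add: leads_1)
next
  case (Suc r)
  have "(\<lambda>i. Suc r * e i) = e + (\<lambda>i. r * e i)" by (simp add: fun_eq_iff)
  then show ?case using leads_mult [OF Suc.prems Suc.IH [OF Suc.prems]] by simp
qed

lemma leads_diff:
  assumes "leads L e f" "leads L e' g" "lexless L e e'"
  shows "leads L e (f - mconst c * g)"
  unfolding leads_def
proof (intro conjI allI impI)
  have "mcoeff g e = 0"
    using assms(2,3) lexless_trans lexless_irrefl unfolding leads_def by metis
  then show "mcoeff (f - mconst c * g) e = 1"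
    using assms(1) by (simp add: leads_def)
  fix x assume "mcoeff (f - mconst c * g) x \<noteq> 0"
  then have "mcoeff f x \<noteq> 0 \<or> mcoeff g x \<noteq> 0" by auto
  then show "x = e \<or> lexless L e x"
    using assms lexless_trans unfolding leads_def by metis
qed

lemma leads_mvar: "leads L (\<lambda>l. if l = i then 1 else 0) (mvar i)"
  by (auto simp: leads_def mvar_def split: if_splits)

lemma ordge_mvar: "ordge 1 (mvar (i :: 'n::finite))"
proof -
  have "(\<Sum>l\<in>UNIV. if l = i then Suc 0 else 0) = Suc 0" by (simp add: sum.delta)
  then show ?thesis
    unfolding ordge_def adic_close_def mvar_def by auto
qed

section \<open>Triangular bases\<close>

text \<open>The coefficients of an expansion are determined by recursion along the (well-founded)
  lexicographic order of the leading exponents.\<close>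

locale triangular_basis =
  fixes L :: "'n::finite list"
    and S :: "'i set"
    and P :: "'i \<Rightarrow> ('n, 'k::field) mfps"
    and deg :: "'i \<Rightarrow> 'n \<Rightarrow> nat"
  assumes deg_bij: "bij_betw deg S UNIV"
    and leads_P: "x \<in> S \<Longrightarrow> leads L (deg x) (P x)"
    and finite_low: "finite {x \<in> S. \<not> ordge N (P x)}"
begin

text \<open>The basis elements seen by the coefficient at \<open>e\<close>. By
  \<open>finite_low\<close> there are finitely many, which turns an adic sum into finite equations,
  one for each exponent.\<close>

definition contrib :: "('n \<Rightarrow> nat) \<Rightarrow> 'i set" where
  "contrib e = {x \<in> S. mcoeff (P x) e \<noteq> 0}"

lemma finite_contrib [simp]: "finite (contrib e)"
  by (rule finite_subset [OF _ finite_low [of "Suc (\<Sum>i\<in>UNIV. e i)"]])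
     (auto simp: contrib_def ordge_def adic_close_def)

lemma contrib_less: "x \<in> contrib e \<Longrightarrow> deg x \<noteq> e \<Longrightarrow> lexless L (deg x) e"
  using leads_P by (auto simp: contrib_def leads_def)

lemma deg_inj: "x \<in> S \<Longrightarrow> y \<in> S \<Longrightarrow> deg x = deg y \<Longrightarrow> x = y"
  using deg_bij by (auto simp: bij_betw_def inj_on_def)

lemma contrib_deg: "x \<in> S \<Longrightarrow> x \<in> contrib (deg x)"
  using leads_P by (auto simp: contrib_def leads_def)

lemma mcoeff_P_deg: "x \<in> S \<Longrightarrow> mcoeff (P x) (deg x) = 1"
  using leads_P by (auto simp: leads_def)

definition expands :: "('i \<Rightarrow> 'k) \<Rightarrow> ('n, 'k) mfps \<Rightarrow> bool" where
  "expands c f \<longleftrightarrow> (\<forall>x. c x \<noteq> 0 \<longrightarrow> x \<in> S) \<and> has_adic_sum (\<lambda>x. mconst (c x) * P x) f"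

lemma has_adic_sumD:
  assumes "has_adic_sum t f"
  obtains F where "finite F" "\<And>F'. finite F' \<Longrightarrow> F \<subseteq> F' \<Longrightarrow> adic_close N (\<Sum>x\<in>F'. t x) f"
proof -
  have "\<exists>F. finite F \<and> (\<forall>F'. finite F' \<and> F \<subseteq> F' \<longrightarrow> adic_close N (\<Sum>x\<in>F'. t x) f)"
    using assms unfolding has_adic_sum_def by (rule spec)
  then show ?thesis using that by (elim exE conjE) simp
qed

text \<open>For each exponent, any finite index set containing \<open>contrib e\<close> already
  gives the final coefficient; conversely the elements of order below \<open>N\<close> form a finite
  set that serves as threshold in the adic sum.\<close>

lemma expands_iff:
  "expands c f \<longleftrightarrow> (\<forall>x. c x \<noteq> 0 \<longrightarrow> x \<in> S) \<and>
     (\<forall>e. mcoeff f e = (\<Sum>x\<in>contrib e. c x * mcoeff (P x) e))"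
proof (cases "\<forall>x. c x \<noteq> 0 \<longrightarrow> x \<in> S")
  case c: True
  have eq: "mcoeff (\<Sum>x\<in>F. mconst (c x) * P x) e = (\<Sum>x\<in>contrib e. c x * mcoeff (P x) e)"
    if "finite F" "contrib e \<subseteq> F" for F e
    unfolding mcoeff_sum mcoeff_mconst_mult
    by (rule sum.mono_neutral_right) (use that c in \<open>auto simp: contrib_def\<close>)
  have "has_adic_sum (\<lambda>x. mconst (c x) * P x) f \<longleftrightarrow>
     (\<forall>e. mcoeff f e = (\<Sum>x\<in>contrib e. c x * mcoeff (P x) e))" (is "?l \<longleftrightarrow> ?r")
  proof
    assume l: ?l
    show ?r
    proof
      fix e :: "'n \<Rightarrow> nat"
      obtain F where F: "finite F"
        "\<And>F'. finite F' \<Longrightarrow> F \<subseteq> F' \<Longrightarrow>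
           adic_close (Suc (\<Sum>i\<in>UNIV. e i)) (\<Sum>x\<in>F'. mconst (c x) * P x) f"
        by (rule has_adic_sumD [OF l, where N = "Suc (\<Sum>i\<in>UNIV. e i)"]) (rule that)
      have "adic_close (Suc (\<Sum>i\<in>UNIV. e i)) (\<Sum>x\<in>F \<union> contrib e. mconst (c x) * P x) f"
        by (rule F(2)) (use F(1) in auto)
      then have "mcoeff f e = mcoeff (\<Sum>x\<in>F \<union> contrib e. mconst (c x) * P x) e"
        unfolding adic_close_def by (metis lessI)
      then show "mcoeff f e = (\<Sum>x\<in>contrib e. c x * mcoeff (P x) e)"
        using eq [of "F \<union> contrib e" e] F(1) by simp
    qed
  next
    assume r: ?r
    show ?l
      unfolding has_adic_sum_def
    proof
      fix N
      show "\<exists>F. finite F \<and> (\<forall>F'. finite F' \<and> F \<subseteq> F' \<longrightarrow>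
          adic_close N (\<Sum>x\<in>F'. mconst (c x) * P x) f)"
      proof (intro exI [of _ "{x \<in> S. \<not> ordge N (P x)}"] conjI allI impI finite_low)
        fix F' assume F': "finite F' \<and> {x \<in> S. \<not> ordge N (P x)} \<subseteq> F'"
        show "adic_close N (\<Sum>x\<in>F'. mconst (c x) * P x) f"
          unfolding adic_close_def
        proof (intro allI impI)
          fix e :: "'n \<Rightarrow> nat" assume "sum e UNIV < N"
          then have "contrib e \<subseteq> F'"
            using F' by (auto simp: contrib_def ordge_def adic_close_def)
          with F' show "mcoeff (\<Sum>x\<in>F'. mconst (c x) * P x) e = mcoeff f e"
            by (simp add: eq r)
        qed
      qed
    qed
  qed
  then show ?thesis by (simp add: expands_def)
qed (auto simp: expands_def)

lemma expands_rec:
  assumes "expands c f" "x \<in> S"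
  shows "c x = mcoeff f (deg x) - (\<Sum>y\<in>contrib (deg x) - {x}. c y * mcoeff (P y) (deg x))"
proof -
  have "mcoeff f (deg x) = (\<Sum>y\<in>contrib (deg x). c y * mcoeff (P y) (deg x))"
    using assms(1) by (simp add: expands_iff)
  also have "\<dots> = c x + (\<Sum>y\<in>contrib (deg x) - {x}. c y * mcoeff (P y) (deg x))"
    by (subst sum.remove [OF finite_contrib contrib_deg [OF assms(2)]])
       (simp add: mcoeff_P_deg [OF assms(2)])
  finally show ?thesis by simp
qed

text \<open>Every other contributor to the coefficient at \<open>deg x\<close> has strictly smaller
  degree, by injectivity of \<open>deg\<close>. This matches the recursion
  \<open>expands_rec\<close>.\<close>

lemma contrib_induct [consumes 1, case_names less]:
  assumes "x \<in> S"
    and "\<And>x. x \<in> S \<Longrightarrow> (\<And>y. y \<in> contrib (deg x) - {x} \<Longrightarrow> Q y) \<Longrightarrow> Q x"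
  shows "Q x"
  using assms(1)
proof (induction "deg x" arbitrary: x rule: wfp_induct_rule [OF wfp_lexless [of L]])
  case less: 1
  show ?case
  proof (rule assms(2) [OF less.prems])
    fix y assume y: "y \<in> contrib (deg x) - {x}"
    then have "y \<in> S" by (auto simp: contrib_def)
    with y less.prems have "deg y \<noteq> deg x" using deg_inj by blast
    with y contrib_less \<open>y \<in> S\<close> less.hyps show "Q y" by blast
  qed
qed

lemma expands_ex: "\<exists>c. expands c f"
proof -
  \<comment> \<open>The recursion runs over exponents, where the well-founded order lives; the
    bijection \<open>deg\<close> carries the result back to indices.\<close>
  define c' where "c' = wfrec {(a, b). lexless L a b} (\<lambda>g t. mcoeff f t -
      (\<Sum>y\<in>{y \<in> contrib t. deg y \<noteq> t}. g (deg y) * mcoeff (P y) t))"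
  have c': "c' t = mcoeff f t - (\<Sum>y\<in>{y \<in> contrib t. deg y \<noteq> t}. c' (deg y) * mcoeff (P y) t)" for t
  proof -
    have "wf {(a, b). lexless L a b}" using wfp_lexless by (simp add: wfp_def)
    note rec = wfrec [OF this, of "\<lambda>g t. mcoeff f t -
      (\<Sum>y\<in>{y \<in> contrib t. deg y \<noteq> t}. g (deg y) * mcoeff (P y) t)" t]
    have "(\<Sum>y\<in>{y \<in> contrib t. deg y \<noteq> t}. cut c' {(a, b). lexless L a b} t (deg y) * mcoeff (P y) t) =
        (\<Sum>y\<in>{y \<in> contrib t. deg y \<noteq> t}. c' (deg y) * mcoeff (P y) t)"
      by (rule sum.cong) (auto simp: cut_apply contrib_less)
    then show ?thesis
      using rec unfolding c'_def [symmetric] by simp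
  qed
  define c where "c x = (if x \<in> S then c' (deg x) else 0)" for x
  have "expands c f"
    unfolding expands_iff
  proof (intro conjI allI impI)
    show "x \<in> S" if "c x \<noteq> 0" for x using that by (simp add: c_def split: if_splits)
    fix e
    obtain x where x: "x \<in> S" "deg x = e"
      using deg_bij by (metis UNIV_I bij_betw_def imageE)
    have "(\<Sum>y\<in>contrib e. c y * mcoeff (P y) e) =
        c x + (\<Sum>y\<in>contrib e - {x}. c y * mcoeff (P y) e)"
      using x by (subst sum.remove [OF finite_contrib, of x]) (auto simp: mcoeff_P_deg contrib_deg)
    also have "contrib e - {x} = {y \<in> contrib e. deg y \<noteq> e}"
      using x deg_inj by (auto simp: contrib_def)
    also have "(\<Sum>y\<in>{y \<in> contrib e. deg y \<noteq> e}. c y * mcoeff (P y) e) =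
        (\<Sum>y\<in>{y \<in> contrib e. deg y \<noteq> e}. c' (deg y) * mcoeff (P y) e)"
      by (rule sum.cong) (auto simp: c_def contrib_def)
    also have "c x + \<dots> = mcoeff f e"
      using c' [of e] x by (simp add: c_def)
    finally show "mcoeff f e = (\<Sum>x\<in>contrib e. c x * mcoeff (P x) e)" by simp
  qed
  then show ?thesis by blast
qed

lemma expands_unique:
  assumes "expands c f" "expands c' f"
  shows "c = c'"
proof
  fix x
  show "c x = c' x"
  proof (cases "x \<in> S")
    case True
    then show ?thesis
    proof (induction rule: contrib_induct)
      case (less x)
      have "(\<Sum>y\<in>contrib (deg x) - {x}. c y * mcoeff (P y) (deg x)) =
          (\<Sum>y\<in>contrib (deg x) - {x}. c' y * mcoeff (P y) (deg x))"
        using less(2) by (intro sum.cong) auto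
      then show ?case
        using expands_rec [OF assms(1) less(1)] expands_rec [OF assms(2) less(1)] by simp
    qed
  next
    case False
    then show ?thesis using assms by (metis expands_def)
  qed
qed

definition cf :: "('n, 'k) mfps \<Rightarrow> 'i \<Rightarrow> 'k" where
  "cf f = (THE c. expands c f)"

lemma expands_cf: "expands (cf f) f"
  unfolding cf_def using expands_ex expands_unique by (metis theI)

lemma cf_eqI: "expands c f \<Longrightarrow> cf f = c"
  using expands_unique expands_cf by blast

lemma cf_in_S: "cf f x \<noteq> 0 \<Longrightarrow> x \<in> S"
  using expands_cf unfolding expands_def by blast

lemma cf_add: "cf (f + g) x = cf f x + cf g x"
proof -
  have "expands (\<lambda>x. cf f x + cf g x) (f + g)"
    using expands_cf [of f] expands_cf [of g]
    by (simp add: expands_iff distrib_right sum.distrib) (metis add_0)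
  then show ?thesis by (simp add: cf_eqI)
qed

lemma cf_smult: "cf (mconst a * f) x = a * cf f x"
proof -
  have "expands (\<lambda>x. a * cf f x) (mconst a * f)"
    using expands_cf [of f]
    by (auto simp: expands_iff sum_distrib_left mult.assoc)
  then show ?thesis by (simp add: cf_eqI)
qed

lemma cf_0 [simp]: "cf 0 x = 0"
  using cf_smult [of 0 0 x] by simp

lemma cf_diff: "cf (f - g) x = cf f x - cf g x"
  using cf_add [of "f - g" g x] by simp

lemma cf_P: "x \<in> S \<Longrightarrow> cf (P x) y = (if y = x then 1 else 0)"
proof -
  assume x: "x \<in> S"
  have "mcoeff (P x) e = (\<Sum>y\<in>contrib e. (if y = x then 1 else 0) * mcoeff (P y) e)" for e
  proof -
    have "(\<Sum>y\<in>contrib e. (if y = x then 1 else 0) * mcoeff (P y) e) =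
        (\<Sum>y\<in>contrib e. if y = x then mcoeff (P x) e else 0)"
      by (rule sum.cong) auto
    also have "\<dots> = (if x \<in> contrib e then mcoeff (P x) e else 0)" by simp
    finally show ?thesis using x by (simp add: contrib_def)
  qed
  then have "expands (\<lambda>y. if y = x then 1 else 0) (P x)"
    using x by (auto simp: expands_iff)
  then show ?thesis by (simp add: cf_eqI)
qed

lemma cf_eq_0_iff: "(\<forall>x. cf f x = 0) \<longleftrightarrow> f = 0"
  using expands_cf [of f] cf_0 by (auto simp: expands_iff intro: mfps_eqI)

text \<open>Unfolding \<open>expands_rec\<close> shows that one expansion coefficient depends on
  finitely many coefficients of the series.\<close>

lemma cf_continuous: "x \<in> S \<Longrightarrow> \<exists>N. \<forall>f g. adic_close N f g \<longrightarrow> cf f x = cf g x"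
proof (induction rule: contrib_induct)
  case (less x)
  then obtain M where M: "\<And>y f g. y \<in> contrib (deg x) - {x} \<Longrightarrow> adic_close (M y) f g \<Longrightarrow> cf f y = cf g y"
    by metis
  \<comment> \<open>The first summand makes the coefficients at \<open>deg x\<close> agree; the sum
    of the \<open>M y\<close> is a convenient bound for their maximum.\<close>
  define N where "N = Suc (\<Sum>i\<in>UNIV. deg x i) + (\<Sum>y\<in>contrib (deg x) - {x}. M y)"
  show ?case
  proof (intro exI [of _ N] allI impI)
    fix f g :: "('n, 'k) mfps" assume fg: "adic_close N f g"
    have "cf f y = cf g y" if "y \<in> contrib (deg x) - {x}" for y
    proof -
      have "M y \<le> (\<Sum>y\<in>contrib (deg x) - {x}. M y)"
        using that by (intro member_le_sum) auto
      then show ?thesis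
        using fg that by (intro M) (auto simp: N_def intro: adic_close_mono)
    qed
    then have "(\<Sum>y\<in>contrib (deg x) - {x}. cf f y * mcoeff (P y) (deg x)) =
        (\<Sum>y\<in>contrib (deg x) - {x}. cf g y * mcoeff (P y) (deg x))"
      by (intro sum.cong) auto
    moreover have "mcoeff f (deg x) = mcoeff g (deg x)"
      using fg by (auto simp: adic_close_def N_def)
    ultimately show "cf f x = cf g x"
      using expands_rec [OF expands_cf less(1), of f] expands_rec [OF expands_cf less(1), of g] by simp
  qed
qed

definition supported :: "'i set \<Rightarrow> ('n, 'k) mfps set" where
  "supported A = {f. \<forall>x. cf f x \<noteq> 0 \<longrightarrow> x \<in> A}"

lemma supported_mono: "f \<in> supported A \<Longrightarrow> (\<And>x. x \<in> S \<Longrightarrow> x \<in> A \<Longrightarrow> x \<in> B) \<Longrightarrow> f \<in> supported B"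
  using cf_in_S by (auto simp: supported_def)

lemma supported_0 [simp]: "0 \<in> supported A"
  by (simp add: supported_def)

lemma supported_add: "f \<in> supported A \<Longrightarrow> g \<in> supported A \<Longrightarrow> f + g \<in> supported A"
  by (simp add: supported_def cf_add) (metis add_0)

lemma supported_smult: "f \<in> supported A \<Longrightarrow> mconst c * f \<in> supported A"
  by (auto simp: supported_def cf_smult)

lemma supported_sum: "(\<And>x. x \<in> F \<Longrightarrow> g x \<in> supported A) \<Longrightarrow> (\<Sum>x\<in>F. g x) \<in> supported A"
  by (induction F rule: infinite_finite_induct) (auto intro: supported_add)

lemma supported_P: "x \<in> S \<Longrightarrow> x \<in> A \<Longrightarrow> P x \<in> supported A"
  by (auto simp: supported_def cf_P)

text \<open>Follows from continuity of the single coefficients. Estimates proved for key polynomials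
  pass to their limits in this way.\<close>

lemma supported_closed:
  assumes "\<And>N. \<exists>g\<in>supported A. adic_close N g f"
  shows "f \<in> supported A"
  unfolding supported_def
proof (intro CollectI allI impI)
  fix x assume x: "cf f x \<noteq> 0"
  obtain N where N: "\<And>f g. adic_close N f g \<Longrightarrow> cf f x = cf g x"
    using cf_continuous [OF cf_in_S [OF x]] by blast
  obtain g where "g \<in> supported A" "adic_close N g f"
    using assms by blast
  with N x show "x \<in> A" by (force simp: supported_def)
qed

lemma supported_approx:
  assumes "f \<in> supported A"
  shows "\<exists>F. finite F \<and> F \<subseteq> A \<inter> S \<and> adic_close N (\<Sum>x\<in>F. mconst (cf f x) * P x) f"
proof -
  have "has_adic_sum (\<lambda>x. mconst (cf f x) * P x) f"
    using expands_cf [of f] by (simp add: expands_def)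
  then obtain F where F: "finite F"
    "\<And>F'. finite F' \<Longrightarrow> F \<subseteq> F' \<Longrightarrow> adic_close N (\<Sum>x\<in>F'. mconst (cf f x) * P x) f"
    by (rule has_adic_sumD [where N = N]) (rule that)
  have "adic_close N (\<Sum>x\<in>F. mconst (cf f x) * P x) f"
    by (rule F(2)) (use F(1) in auto)
  moreover have "(\<Sum>x\<in>F. mconst (cf f x) * P x) = (\<Sum>x\<in>F \<inter> {x. cf f x \<noteq> 0}. mconst (cf f x) * P x)"
    by (rule sum.mono_neutral_right) (use F in auto)
  ultimately show ?thesis using F(1) assms cf_in_S
    by (intro exI [of _ "F \<inter> {x. cf f x \<noteq> 0}"]) (auto simp: supported_def)
qed

text \<open>Finite partial sums are dense, so bilinearity reduces the claim to products of two basis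
  elements.\<close>

lemma supported_mult:
  assumes f: "f \<in> supported A" and g: "g \<in> supported B"
    and AB: "\<And>x y. x \<in> S \<Longrightarrow> y \<in> S \<Longrightarrow> x \<in> A \<Longrightarrow> y \<in> B \<Longrightarrow> P x * P y \<in> supported C"
  shows "f * g \<in> supported C"
proof (rule supported_closed)
  fix N
  obtain F where F: "finite F" "F \<subseteq> A \<inter> S" "adic_close N (\<Sum>x\<in>F. mconst (cf f x) * P x) f"
    using supported_approx [OF f] by blast
  obtain G where G: "finite G" "G \<subseteq> B \<inter> S" "adic_close N (\<Sum>x\<in>G. mconst (cf g x) * P x) g"
    using supported_approx [OF g] by blast
  have "(\<Sum>x\<in>F. mconst (cf f x) * P x) * (\<Sum>x\<in>G. mconst (cf g x) * P x) =
      (\<Sum>x\<in>F. \<Sum>y\<in>G. mconst (cf f x) * (mconst (cf g y) * (P x * P y)))"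
    by (simp add: sum_product algebra_simps)
  also have "\<dots> \<in> supported C"
    using F(2) G(2) by (intro supported_sum supported_smult AB) auto
  finally show "\<exists>h\<in>supported C. adic_close N h (f * g)"
    using adic_close_mult [OF F(3) G(3)] by blast
qed

end

section \<open>Valuations from monomial values\<close>

text \<open>Distinct values give a nonzero series exactly one initial term, and
  \<open>P_mult\<close> says that the product of two initial terms again has one, of the expected
  value. \<open>v_min\<close> is assumed because supports may be infinite and \<open>'h\<close> is
  not assumed to be well-ordered.\<close>

locale basis_valuation = triangular_basis L S P deg
  for L :: "'n::finite list" and S :: "'i set" and P :: "'i \<Rightarrow> ('n, 'k::field) mfps" and deg +
  fixes v :: "'i \<Rightarrow> 'h::linordered_ab_group_add"
  assumes v_inj: "inj_on v S"
    and v_min: "A \<subseteq> S \<Longrightarrow> A \<noteq> {} \<Longrightarrow> \<exists>x\<in>A. \<forall>y\<in>A. v x \<le> v y"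
    and P_mult: "x \<in> S \<Longrightarrow> y \<in> S \<Longrightarrow>
      \<exists>z\<in>S. \<exists>c. c \<noteq> 0 \<and> v z = v x + v y \<and> P x * P y - mconst c * P z \<in> supported {u. v z < v u}"
begin

definition initial :: "('n, 'k) mfps \<Rightarrow> 'i \<Rightarrow> bool" where
  "initial f x \<longleftrightarrow> x \<in> S \<and> cf f x \<noteq> 0 \<and> (\<forall>y. cf f y \<noteq> 0 \<longrightarrow> v x \<le> v y)"

lemma initial_ex: "f \<noteq> 0 \<Longrightarrow> \<exists>x. initial f x"
  using v_min [of "{x. cf f x \<noteq> 0}"] cf_in_S cf_eq_0_iff [of f] by (fastforce simp: initial_def)

lemma initial_decomp:
  assumes "initial f x"
  shows "f - mconst (cf f x) * P x \<in> supported {u. v x < v u}"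
  unfolding supported_def
proof (intro CollectI allI impI)
  fix y assume y: "cf (f - mconst (cf f x) * P x) y \<noteq> 0"
  have x: "x \<in> S" using assms by (simp add: initial_def)
  have "y \<noteq> x" "cf f y \<noteq> 0"
    using y x by (auto simp: cf_diff cf_smult cf_P split: if_splits)
  then show "v x < v y"
    using assms v_inj cf_in_S [of f y] x
    by (metis initial_def inj_onD order_le_imp_less_or_eq)
qed

lemma initialI:
  assumes "c \<noteq> 0" "z \<in> S" "f - mconst c * P z \<in> supported {u. v z < v u}"
  shows "initial f z"
proof -
  have cf: "cf f y = cf (f - mconst c * P z) y + (if y = z then c else 0)" for y
    using assms(2) by (simp add: cf_diff cf_smult cf_P)
  have "cf (f - mconst c * P z) z = 0"
    using assms(3) by (auto simp: supported_def)
  moreover have "v z \<le> v y" if "cf f y \<noteq> 0" for y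
    using that cf [of y] assms(3) by (auto simp: supported_def split: if_splits intro: less_imp_le)
  ultimately show ?thesis
    using assms(1,2) cf [of z] by (simp add: initial_def)
qed

lemma P_mult_supported:
  assumes "x \<in> S" "y \<in> S"
  shows "P x * P y \<in> supported {u. v x + v y \<le> v u}"
proof -
  obtain z c where z: "z \<in> S" "v z = v x + v y" "P x * P y - mconst c * P z \<in> supported {u. v z < v u}"
    using P_mult [OF assms] by blast
  have "P x * P y = (P x * P y - mconst c * P z) + mconst c * P z" by simp
  also have "\<dots> \<in> supported {u. v x + v y \<le> v u}"
  proof (rule supported_add)
    show "P x * P y - mconst c * P z \<in> supported {u. v x + v y \<le> v u}"
      using z(2) by (intro supported_mono [OF z(3)]) auto
    show "mconst c * P z \<in> supported {u. v x + v y \<le> v u}"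
      using z(1,2) by (intro supported_smult supported_P) auto
  qed
  finally show ?thesis .
qed

lemma initial_mult:
  assumes f: "initial f x" and g: "initial g y"
  shows "\<exists>z. initial (f * g) z \<and> v z = v x + v y"
proof -
  have xy: "x \<in> S" "y \<in> S" "cf f x \<noteq> 0" "cf g y \<noteq> 0"
    using f g by (auto simp: initial_def)
  define f' where "f' = f - mconst (cf f x) * P x"
  define g' where "g' = g - mconst (cf g y) * P y"
  have f': "f' \<in> supported {u. v x < v u}" and g': "g' \<in> supported {u. v y < v u}"
    unfolding f'_def g'_def by (rule initial_decomp, fact)+
  obtain z c where z: "z \<in> S" "c \<noteq> 0" "v z = v x + v y"
      "P x * P y - mconst c * P z \<in> supported {u. v z < v u}"
    using P_mult [OF xy(1,2)] by blast
  define c' where "c' = cf f x * cf g y * c"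
  have g_sup: "g \<in> supported {u. v y \<le> v u}"
    using g by (auto simp: initial_def supported_def)
  \<comment> \<open>In each summand one initial term has been removed: that of
    \<open>P x * P y\<close>, of \<open>f\<close>, and of \<open>g\<close>. Hence all three lie
    strictly above \<open>v z\<close>.\<close>
  have "f * g - mconst c' * P z =
      mconst (cf f x * cf g y) * (P x * P y - mconst c * P z) + f' * g + mconst (cf f x) * (P x * g')"
    unfolding f'_def g'_def c'_def mconst_mult by (simp add: algebra_simps)
  also have "\<dots> \<in> supported {u. v z < v u}"
  proof (intro supported_add supported_smult z(4))
    show "f' * g \<in> supported {u. v z < v u}"
    proof (rule supported_mult [OF f' g_sup])
      fix s t assume s: "s \<in> S" "t \<in> S" "s \<in> {u. v x < v u}" "t \<in> {u. v y \<le> v u}"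
      then have "v z < v s + v t" using z(3) by (auto intro: add_less_le_mono)
      then show "P s * P t \<in> supported {u. v z < v u}"
        by (intro supported_mono [OF P_mult_supported [OF s(1,2)]]) auto
    qed
    show "P x * g' \<in> supported {u. v z < v u}"
    proof (rule supported_mult [OF supported_P [OF xy(1), of "{x}"] g'])
      fix s t assume s: "s \<in> S" "t \<in> S" "s \<in> {x}" "t \<in> {u. v y < v u}"
      then have "v z < v s + v t" using z(3) by auto
      then show "P s * P t \<in> supported {u. v z < v u}"
        by (intro supported_mono [OF P_mult_supported [OF s(1,2)]]) auto
    qed simp
  qed
  finally have "initial (f * g) z"
    by (intro initialI [of c']) (use z xy in \<open>auto simp: c'_def\<close>)
  with z(3) show ?thesis by blast
qed

lemma initial_add:
  assumes "initial f x" "initial g y" "initial (f + g) z"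
  shows "min (v x) (v y) \<le> v z"
proof -
  have "cf f z \<noteq> 0 \<or> cf g z \<noteq> 0"
    using assms(3) by (auto simp: initial_def cf_add)
  then show ?thesis
    using assms(1,2) by (auto simp: initial_def min_le_iff_disj)
qed

lemma initial_P: "x \<in> S \<Longrightarrow> initial (P x) x"
  by (auto simp: initial_def cf_P split: if_splits)

lemma initial_smult: "c \<noteq> 0 \<Longrightarrow> initial f x \<Longrightarrow> initial (mconst c * f) x"
  by (auto simp: initial_def cf_smult)

end

text \<open>A multiplicative map on a domain extends to its field of fractions; well-definedness is
  multiplicativity applied to the cross products.\<close>

lemma fract_extension:
  fixes m :: "'a::idom \<Rightarrow> 'g::linordered_ab_group_add"
  assumes mult: "\<And>f g. f \<noteq> 0 \<Longrightarrow> g \<noteq> 0 \<Longrightarrow> m (f * g) = m f + m g"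
    and add: "\<And>f g. f \<noteq> 0 \<Longrightarrow> g \<noteq> 0 \<Longrightarrow> f + g \<noteq> 0 \<Longrightarrow> min (m f) (m g) \<le> m (f + g)"
  shows "\<exists>v :: 'a fract \<Rightarrow> 'g. field_valuation v \<and>
     (\<forall>f g. f \<noteq> 0 \<longrightarrow> g \<noteq> 0 \<longrightarrow> v (Fract f g) = m f - m g)"
proof -
  \<comment> \<open>At 0 no such representation exists and the value is arbitrary, as
    \<open>field_valuation\<close> permits.\<close>
  define v where "v q = (SOME x. \<exists>f g. f \<noteq> 0 \<and> g \<noteq> 0 \<and> q = Fract f g \<and> x = m f - m g)" for q
  have v: "v (Fract f g) = m f - m g" if fg: "f \<noteq> 0" "g \<noteq> 0" for f g
  proof -
    have "\<exists>x f' g'. f' \<noteq> 0 \<and> g' \<noteq> 0 \<and> Fract f g = Fract f' g' \<and> x = m f' - m g'"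
      using fg by blast
    from someI_ex [OF this] obtain f' g' where *: "f' \<noteq> 0" "g' \<noteq> 0" "Fract f g = Fract f' g'"
      "v (Fract f g) = m f' - m g'"
      unfolding v_def by blast
    then have "f * g' = f' * g"
      using fg by (simp add: eq_fract)
    then have "m f + m g' = m f' + m g"
      using mult fg * by metis
    then show ?thesis
      unfolding *(4) by (simp add: algebra_simps)
  qed
  have rep: "\<exists>f g. f \<noteq> 0 \<and> g \<noteq> 0 \<and> x = Fract f g" if "x \<noteq> 0" for x :: "'a fract"
    using that by (cases x rule: Fract_cases) (metis Zero_fract_def fract_collapse(1))
  have "field_valuation v"
    unfolding field_valuation_def
  proof (intro conjI allI impI)
    fix x y :: "'a fract" assume "x \<noteq> 0" "y \<noteq> 0"
    then obtain f g f' g' where x: "x = Fract f g" "f \<noteq> 0" "g \<noteq> 0"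
      and y: "y = Fract f' g'" "f' \<noteq> 0" "g' \<noteq> 0"
      using rep by metis
    show "v (x * y) = v x + v y"
      using x y by (simp add: v mult)
    assume "x + y \<noteq> 0"
    then have nz: "f * g' + f' * g \<noteq> 0"
      using x y by (auto simp: Zero_fract_def eq_fract)
    have "min (m (f * g')) (m (f' * g)) \<le> m (f * g' + f' * g)"
      using add [OF _ _ nz] x y by simp
    then have "min (m (f * g')) (m (f' * g)) - m (g * g') \<le> m (f * g' + f' * g) - m (g * g')"
      by (rule diff_right_mono)
    moreover have "v (x + y) = m (f * g' + f' * g) - m (g * g')"
      using x y nz by (simp add: v)
    moreover have "v x = m (f * g') - m (g * g')" "v y = m (f' * g) - m (g * g')"
      using x y by (simp_all add: v mult)
    ultimately show "min (v x) (v y) \<le> v (x + y)"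
      by (simp only: min_diff_distrib_left)
  qed
  with v show ?thesis by blast
qed

section \<open>Multiples and ordinal indices\<close>

lemma nsmul_0 [simp]: "nsmul 0 x = 0"
  by (simp add: nsmul_def)

lemma nsmul_Suc [simp]: "nsmul (Suc r) x = x + nsmul r x"
  by (simp add: nsmul_def add.commute)

lemma nsmul_add: "nsmul (r + s) x = nsmul r x + nsmul s x"
  by (induction r) (auto simp: add.assoc)

lemma nsmul_zero_right [simp]: "nsmul r 0 = 0"
  by (induction r) auto

lemma nsmul_mult: "nsmul (r * s) x = nsmul r (nsmul s x)"
  by (induction r) (auto simp: nsmul_add)

lemma nsmul_nonneg: "0 \<le> x \<Longrightarrow> 0 \<le> nsmul r (x :: 'g::linordered_ab_group_add)"
  by (induction r) auto

lemma nsmul_mono: "x \<le> y \<Longrightarrow> nsmul r x \<le> nsmul r (y :: 'g::linordered_ab_group_add)"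
  by (induction r) (auto intro: add_mono)

lemma nsmul_mono_left:
  "r \<le> s \<Longrightarrow> 0 \<le> x \<Longrightarrow> nsmul r x \<le> nsmul s (x :: 'g::linordered_ab_group_add)"
  using nsmul_add [of r "s - r" x] nsmul_nonneg [of x "s - r"] by simp

lemma nsmul_ge: "1 \<le> r \<Longrightarrow> 0 \<le> x \<Longrightarrow> x \<le> nsmul r (x :: 'g::linordered_ab_group_add)"
  using nsmul_mono_left [of 1 r x] by simp

lemma sum_mset_replicate: "\<Sum>\<^sub># (replicate_mset r x) = nsmul r x"
  by (induction r) auto

lemma sum_mset_image_replicate: "(\<Sum>q\<in>#replicate_mset r p. w q) = nsmul r (w p)"
  by (simp add: sum_mset_replicate)

text \<open>Reduces the laws of integer multiples to those of \<open>nsmul\<close>, without case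
  distinctions on signs.\<close>

lemma zsmul_diff: "zsmul (int r - int s) x = nsmul r x - nsmul s x"
proof (cases "s \<le> r")
  case True
  then obtain k where "r = s + k" using le_Suc_ex by blast
  then show ?thesis by (simp add: zsmul_def nsmul_add)
next
  case False
  then obtain k where "s = r + Suc k"
    by (metis less_imp_Suc_add not_le add_Suc_right)
  moreover from this have "nat (- (int r - int s)) = Suc k" by simp
  ultimately show ?thesis
    unfolding zsmul_def by (simp add: nsmul_add algebra_simps del: of_nat_Suc)
qed

lemma int_diff_cases': obtains r s where "z = int r - int s"
  by (metis int_diff_cases)

lemma zsmul_of_nat [simp]: "zsmul (int r) x = nsmul r x"
  by (simp add: zsmul_def)

lemma zsmul_0 [simp]: "zsmul 0 x = 0"
  by (simp add: zsmul_def)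

lemma zsmul_1 [simp]: "zsmul 1 x = x"
  using zsmul_of_nat [of 1 x] by (simp del: zsmul_of_nat)

lemma zsmul_add: "zsmul (y + z) x = zsmul y x + zsmul z x"
proof -
  obtain r s where y: "y = int r - int s" by (rule int_diff_cases')
  obtain r' s' where z: "z = int r' - int s'" by (rule int_diff_cases')
  have "y + z = int (r + r') - int (s + s')" using y z by simp
  then have "zsmul (y + z) x = nsmul (r + r') x - nsmul (s + s') x" by (simp only: zsmul_diff)
  also have "\<dots> = zsmul y x + zsmul z x"
    unfolding y z by (simp add: zsmul_diff nsmul_add algebra_simps)
  finally show ?thesis .
qed

lemma zsmul_minus: "zsmul (- z) x = - zsmul z x"
  using zsmul_add [of z "- z" x] by (simp add: eq_neg_iff_add_eq_0 add.commute)

lemma zsmul_minus_left: "zsmul (y - z) x = zsmul y x - zsmul z x"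
  using zsmul_add [of y "- z" x] by (simp add: zsmul_minus)

lemma zsmul_mult_nat: "zsmul (z * int n) x = zsmul z (nsmul n x)"
proof -
  obtain r s where z: "z = int r - int s" by (rule int_diff_cases')
  have "z * int n = int (r * n) - int (s * n)" by (simp add: z algebra_simps)
  then show ?thesis by (simp only: zsmul_diff z nsmul_mult)
qed

lemma nsmul_group_closure: "x \<in> group_closure A \<Longrightarrow> nsmul r x \<in> group_closure A"
  by (induction r) (auto intro: group_closure_add)

lemma zsmul_group_closure: "x \<in> group_closure A \<Longrightarrow> zsmul z x \<in> group_closure A"
  by (auto simp: zsmul_def nsmul_group_closure)

lemma group_closure_mono: "A \<subseteq> B \<Longrightarrow> x \<in> group_closure A \<Longrightarrow> x \<in> group_closure B"
  by (rotate_tac, induction rule: group_closure.induct) (auto intro: group_closure.intros)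

lemma group_closure_sum:
  "(\<And>x. x \<in> F \<Longrightarrow> f x \<in> group_closure A) \<Longrightarrow> (\<Sum>x\<in>F. f x) \<in> group_closure A"
  by (induction F rule: infinite_finite_induct) (auto intro: group_closure_add)

section \<open>Successors, limits and well-founded induction on indices\<close>

lemma ofirst_le [simp]: "ofirst \<le> j"
  unfolding ofirst_def by (rule Least_le) simp

lemma osuc_greater: "j < k \<Longrightarrow> j < osuc j"
  unfolding osuc_def by (rule LeastI)

lemma osuc_le: "j < k \<Longrightarrow> osuc j \<le> k"
  unfolding osuc_def by (rule Least_le)

lemma less_osucD: "x < osuc j \<Longrightarrow> x \<le> j"
  using osuc_le [of j x] by force

lemma ordinal_cases:
  obtains (first) "j = ofirst" | (suc) x where "x < j" "j = osuc x" | (limit) "olimit j"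
proof (cases "j = ofirst \<or> olimit j")
  case False
  then obtain x where "x < j" "\<not> osuc x < j" by (auto simp: olimit_def)
  with osuc_le [of x j] that(2) show ?thesis by force
qed (use that in auto)

lemma olimit_osuc: "olimit j \<Longrightarrow> x < j \<Longrightarrow> osuc x < j"
  by (simp add: olimit_def)

lemma olimit_gt_first: "olimit j \<Longrightarrow> ofirst < j"
  unfolding olimit_def using ofirst_le [of j] by (auto simp: order_less_le)

lemma wfp_less_finite: "wfp ((<) :: 'n::{finite,linorder} \<Rightarrow> _)"
proof -
  have "card {..<i} < card {..<i'}" if "i < i'" for i i' :: 'n
    using that by (metis finite lessThan_strict_subset_iff psubset_card_mono)
  then have "{(x, y :: 'n). x < y} \<subseteq> measure (\<lambda>i. card {..<i})" by auto
  then show ?thesis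
    unfolding wfp_def by (rule wf_subset [OF wf_measure])
qed

text \<open>The type of variables is only finite and linearly ordered, so the pairs are not an
  instance of \<open>wellorder\<close>. Induction along this order follows the construction, since
  \<open>M i j\<close> involves only smaller pairs.\<close>

lemma wfp_index: "wfp ((<) :: 'n::{finite,linorder} \<times> 'o::wellorder \<Rightarrow> _)"
proof -
  have "{(x, y). x < y} \<subseteq> {(x, y :: 'n). x < y} <*lex*> {(x, y :: 'o). x < y}"
    by (auto simp: order_le_less)
  moreover have "wf ({(x, y :: 'n). x < y} <*lex*> {(x, y :: 'o). x < y})"
    using wfp_less_finite wf by (intro wf_lex_prod) (auto simp: wfp_def)
  ultimately show ?thesis
    unfolding wfp_def by (rule wf_subset [rotated])
qed

section \<open>Mixed radix sums\<close>

text \<open>The same comparison serves for values, with \<open>f j = \<beta>\<^sub>i\<^sub>j\<close>, and for degrees.\<close>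

lemma radix_bound:
  fixes f :: "'o::wellorder \<Rightarrow> 'h::linordered_ab_group_add"
  assumes "\<And>j k. j < k \<Longrightarrow> k \<le> J \<Longrightarrow> nsmul (n j) (f j) \<le> f k"
    and "\<And>j. j \<le> J \<Longrightarrow> 0 < f j"
    and "\<And>j. j \<in># K \<Longrightarrow> j < J \<and> count K j < n j"
  shows "(\<Sum>j\<in>#K. f j) < f J"
  using assms
proof (induction J arbitrary: K rule: less_induct)
  case (less J)
  show ?case
  proof (cases "K = {#}")
    case True
    then show ?thesis using less.prems(2) by simp
  next
    case False
    \<comment> \<open>The lower digits sum to less than \<open>f p\<close>; adding the digit at
      \<open>p\<close> stays below \<open>nsmul (n p) (f p)\<close>, which is at most
      \<open>f J\<close>.\<close>
    define p where "p = Max (set_mset K)"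
    have p: "p \<in># K" "\<And>j. j \<in># K \<Longrightarrow> j \<le> p"
      using False by (auto simp: p_def)
    then have pJ: "p < J" and cp: "count K p < n p" using less.prems(3) by auto
    define K' where "K' = filter_mset (\<lambda>j. j \<noteq> p) K"
    have K: "K = K' + replicate_mset (count K p) p"
      by (auto simp: K'_def multiset_eq_iff)
    have "(\<Sum>j\<in>#K'. f j) < f p"
    proof (rule less.IH [OF pJ])
      show "nsmul (n j) (f j) \<le> f k" if "j < k" "k \<le> p" for j k
        using that pJ by (intro less.prems(1)) auto
      show "0 < f j" if "j \<le> p" for j using that pJ by (intro less.prems(2)) auto
      fix j assume "j \<in># K'"
      then show "j < p \<and> count K' j < n j"
        using p(2) [of j] less.prems(3) [of j] by (auto simp: K'_def)
    qed
    moreover have "(\<Sum>j\<in>#K. f j) = (\<Sum>j\<in>#K'. f j) + nsmul (count K p) (f p)"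
      by (subst K) (simp add: sum_mset_replicate)
    moreover have "nsmul (Suc (count K p)) (f p) \<le> nsmul (n p) (f p)"
      using cp pJ less.prems(2) [of p] by (intro nsmul_mono_left) (auto intro: less_imp_le)
    moreover have "nsmul (n p) (f p) \<le> f J"
      using pJ by (intro less.prems(1)) auto
    ultimately show ?thesis
      by (simp del: sum_mset_replicate_mset) (meson add_strict_right_mono order_less_le_trans order_trans)
  qed
qed

text \<open>The position \<open>p\<close> is the highest one where the digits differ. The lower
  digits of \<open>A\<close> cannot make up one unit \<open>f p\<close>, and the lower digits of
  \<open>B\<close> contribute something nonnegative, so \<open>B\<close> needs no bound on its
  digits.\<close>

lemma radix_compare:
  fixes f :: "'o::wellorder \<Rightarrow> 'h::linordered_ab_group_add"
  assumes f: "\<And>j k. j < k \<Longrightarrow> k \<le> p \<Longrightarrow> nsmul (n j) (f j) \<le> f k"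
    and pos: "\<And>j. j \<le> p \<Longrightarrow> 0 < f j"
    and A: "\<And>j. j \<in># A \<Longrightarrow> j < p \<Longrightarrow> count A j < n j"
    and eq: "\<And>j. p < j \<Longrightarrow> count A j = count B j"
    and less: "count A p < count B p"
  shows "(\<Sum>j\<in>#A. f j) < (\<Sum>j\<in>#B. f j)"
proof -
  define H where "H = filter_mset (\<lambda>j. p < j) A"
  define A' where "A' = filter_mset (\<lambda>j. j < p) A"
  define B' where "B' = filter_mset (\<lambda>j. j < p) B"
  have A_eq: "A = H + replicate_mset (count A p) p + A'"
    by (auto simp: H_def A'_def multiset_eq_iff)
  have "B = H + replicate_mset (count B p) p + B'"
    using eq by (auto simp: H_def B'_def multiset_eq_iff)
  then have B_eq: "(\<Sum>j\<in>#B. f j) = (\<Sum>j\<in>#H. f j) + nsmul (count B p) (f p) + (\<Sum>j\<in>#B'. f j)"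
    by (metis sum_mset.union image_mset_union sum_mset_image_replicate)
  have "(\<Sum>j\<in>#A'. f j) < f p"
    by (rule radix_bound [where n = n]) (use f pos A in \<open>auto simp: A'_def\<close>)
  then have "nsmul (count A p) (f p) + (\<Sum>j\<in>#A'. f j) < nsmul (Suc (count A p)) (f p)"
    by (simp add: add.commute)
  also have "\<dots> \<le> nsmul (count B p) (f p)"
    using less pos [of p] by (intro nsmul_mono_left) auto
  also have "\<dots> \<le> nsmul (count B p) (f p) + (\<Sum>j\<in>#B'. f j)"
  proof -
    have "\<And>K. (\<forall>j\<in>#K. j \<le> p) \<Longrightarrow> 0 \<le> (\<Sum>j\<in>#K. f j)"
    proof -
      fix K :: "'o multiset" assume "\<forall>j\<in>#K. j \<le> p"
      then show "0 \<le> (\<Sum>j\<in>#K. f j)"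
        by (induction K) (auto intro!: less_imp_le add_pos_nonneg pos)
    qed
    from this [of B'] show ?thesis by (force simp: B'_def)
  qed
  finally have "nsmul (count A p) (f p) + (\<Sum>j\<in>#A'. f j) <
      nsmul (count B p) (f p) + (\<Sum>j\<in>#B'. f j)" .
  moreover have "(\<Sum>j\<in>#A. f j) = (\<Sum>j\<in>#H. f j) + nsmul (count A p) (f p) + (\<Sum>j\<in>#A'. f j)"
    using A_eq by (metis sum_mset.union image_mset_union sum_mset_image_replicate)
  ultimately show ?thesis using B_eq by (simp add: add.assoc)
qed

text \<open>Monomials in key polynomials are kept as multisets of index pairs, so that products
  become unions and values and degrees become sums. \<open>part i\<close> extracts the digits
  belonging to the \<open>i\<close>-th variable.\<close>

definition part :: "'n \<Rightarrow> ('n \<times> 'o) multiset \<Rightarrow> 'o multiset" where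
  "part i K = image_mset snd (filter_mset (\<lambda>q. fst q = i) K)"

lemma part_simps [simp]:
  "part i {#} = {#}"
  "part i (A + B) = part i A + part i B"
  "part i (add_mset q A) = (if fst q = i then add_mset (snd q) (part i A) else part i A)"
  by (auto simp: part_def)

lemma part_replicate [simp]:
  "part i (replicate_mset r q) = (if fst q = i then replicate_mset r (snd q) else {#})"
  by (induction r) auto

lemma count_part [simp]: "count (part i K) j = count K (i, j)"
  by (induction K) auto

lemma sum_parts:
  fixes w :: "'n::finite \<times> 'o \<Rightarrow> 'h::comm_monoid_add"
  shows "(\<Sum>q\<in>#K. w q) = (\<Sum>i\<in>UNIV. \<Sum>j\<in>#part i K. w (i, j))"
proof (induction K)
  case (add q K)
  have "(\<Sum>i\<in>UNIV. \<Sum>j\<in>#part i (add_mset q K). w (i, j)) =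
      (\<Sum>i\<in>UNIV. (if i = fst q then w q else 0) + (\<Sum>j\<in>#part i K. w (i, j)))"
    by (rule sum.cong) auto
  also have "\<dots> = w q + (\<Sum>i\<in>UNIV. \<Sum>j\<in>#part i K. w (i, j))"
    by (simp add: sum.distrib)
  finally show ?case using add by simp
qed simp

lemma multiset_eq_parts: "(\<And>i. part i A = part i B) \<Longrightarrow> A = B"
  by (rule multiset_eqI) (metis count_part surj_pair)

text \<open>Keeps finiteness of relative orders in the form in which the hypotheses state it,
  instead of an existential statement.\<close>

declare not_infinity_eq [simp del]

section \<open>Representations in a sequence of values\<close>

lemma sum_mset_sum_image: "finite F \<Longrightarrow> (\<Sum>q\<in>#(\<Sum>p\<in>F. A p). w q) = (\<Sum>p\<in>F. \<Sum>q\<in>#A p. w q)"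
  by (induction F rule: finite_induct) auto

locale value_seq =
  fixes a :: "'n::{finite,linorder} \<Rightarrow> 'o::wellorder"
    and \<beta> :: "'n \<Rightarrow> 'o \<Rightarrow> 'g::linordered_ab_group_add"
  assumes value_sequence: "value_sequence a \<beta>"
begin

section \<open>Relative orders and normalized representations\<close>

definition B :: "'n \<times> 'o \<Rightarrow> 'g" where
  "B q = \<beta> (fst q) (snd q)"

definition N :: "'n \<times> 'o \<Rightarrow> enat" where
  "N q = rel_order a \<beta> (fst q) (snd q)"

definition n :: "'n \<Rightarrow> 'o \<Rightarrow> nat" where
  "n i j = the_enat (rel_order a \<beta> i j)"

definition below :: "'n \<times> 'o \<Rightarrow> ('n \<times> 'o) set" where
  "below q = {p. snd p \<le> a (fst p) \<and> p < q}"

definition G :: "'n \<times> 'o \<Rightarrow> 'g set" where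
  "G q = group_closure (B ` below q)"

lemma prec_eq: "prec a i j = below (i, j)"
  by (auto simp: prec_def below_def less_prod_def')

lemma B_image: "(\<lambda>(i', j'). \<beta> i' j') ` X = B ` X"
  by (simp add: B_def [abs_def] case_prod_unfold)

lemma below_mono: "p \<le> q \<Longrightarrow> below p \<subseteq> below q"
  by (auto simp: below_def)

lemma G_mono: "p \<le> q \<Longrightarrow> x \<in> G p \<Longrightarrow> x \<in> G q"
  unfolding G_def by (rule group_closure_mono [OF image_mono [OF below_mono]])

lemma B_in_G: "p \<in> below q \<Longrightarrow> B p \<in> G q"
  unfolding G_def by (rule group_closure.base) simp

lemma N_eq: "N q = Inf {enat r | r. 1 \<le> r \<and> nsmul r (B q) \<in> G q}"
  by (cases q) (simp add: N_def rel_order_def prec_eq B_image G_def B_def)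

lemma N_finite:
  assumes "N q \<noteq> \<infinity>"
  shows "1 \<le> the_enat (N q)" "nsmul (the_enat (N q)) (B q) \<in> G q"
proof -
  let ?A = "{enat r | r. 1 \<le> r \<and> nsmul r (B q) \<in> G q}"
  have "?A \<noteq> {}"
  proof
    assume "?A = {}"
    then have "N q = Inf {}" by (simp only: N_eq)
    then show False using assms by (simp add: top_enat_def)
  qed
  then have "N q \<in> ?A"
    unfolding N_eq Inf_enat_def by (simp only: if_False) (metis (mono_tags, lifting) LeastI ex_in_conv)
  then show "1 \<le> the_enat (N q)" "nsmul (the_enat (N q)) (B q) \<in> G q" by auto
qed

lemma N_le: "1 \<le> r \<Longrightarrow> nsmul r (B q) \<in> G q \<Longrightarrow> N q \<le> enat r"
  unfolding N_eq by (rule Inf_lower) auto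

lemma N_le_int:
  assumes "z \<noteq> 0" "zsmul z (B q) \<in> G q"
  shows "N q \<le> enat (nat \<bar>z\<bar>)"
proof -
  have "nsmul (nat \<bar>z\<bar>) (B q) \<in> G q"
    using assms(2) unfolding zsmul_def G_def by (auto split: if_splits)
  with assms(1) show ?thesis by (intro N_le) auto
qed

text \<open>Splits off the largest generator involved, leaving a remainder in the group of strictly
  earlier values. This is the form that allows well-founded induction on the index.\<close>

lemma G_decomp:
  assumes "x \<in> G q"
  shows "x = 0 \<or> (\<exists>p z y. p \<in> below q \<and> y \<in> G p \<and> x = zsmul z (B p) + y)"
  using assms unfolding G_def [of q]
proof (induction rule: group_closure.induct)
  case (base s)
  then consider "s = 0" | p where "p \<in> below q" "s = B p" by auto
  then show ?case
  proof cases
    case 2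
    then have "s = zsmul 1 (B p) + 0" "(0::'g) \<in> G p" by (simp_all add: G_def)
    with 2 show ?thesis by metis
  qed simp
next
  case (diff s t)
  show ?case
  proof (cases "t = 0 \<or> s = 0")
    case True
    then show ?thesis
    proof
      assume "s = 0"
      show ?thesis
      proof (cases "t = 0")
        case False
        then obtain p z y where "p \<in> below q" "y \<in> G p" "t = zsmul z (B p) + y"
          using diff.IH by blast
        then have "s - t = zsmul (- z) (B p) + (- y)" "- y \<in> G p"
          using \<open>s = 0\<close> by (simp_all add: zsmul_minus G_def)
        with \<open>p \<in> below q\<close> show ?thesis by metis
      qed (use \<open>s = 0\<close> in simp)
    qed (use diff.IH in simp)
  next
    case False
    then obtain p z y p' z' y' where
      s: "p \<in> below q" "y \<in> G p" "s = zsmul z (B p) + y" and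
      t: "p' \<in> below q" "y' \<in> G p'" "t = zsmul z' (B p') + y'"
      using diff.IH by metis
    \<comment> \<open>A decomposition with smaller top index lies entirely in the group belonging to
      the larger index and can be absorbed into its remainder.\<close>
    have GI: "zsmul u (B r) + v \<in> G r'" if "r < r'" "v \<in> G r" "r \<in> below q" for u v r r'
    proof -
      have "r \<in> below r'" using that by (auto simp: below_def)
      then show ?thesis
        using that G_mono [of r r' v] B_in_G [of r r']
        by (auto simp: G_def intro!: group_closure_add zsmul_group_closure)
    qed
    consider "p < p'" | "p' < p" | "p = p'" by fastforce
    then show ?thesis
    proof cases
      case 1
      then have "s - y' \<in> G p'"
        using GI [OF 1 s(2,1)] s(3) t(2) by (auto simp: G_def intro: group_closure.diff)
      moreover have "s - t = zsmul (- z') (B p') + (s - y')"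
        using t(3) by (simp add: zsmul_minus algebra_simps)
      ultimately show ?thesis using t(1) by metis
    next
      case 2
      then have "y - t \<in> G p"
        using GI [OF 2 t(2,1)] s(2) t(3) by (auto simp: G_def intro: group_closure.diff)
      moreover have "s - t = zsmul z (B p) + (y - t)"
        using s(3) by simp
      ultimately show ?thesis using s(1) by metis
    next
      case 3
      then have "y - y' \<in> G p"
        using s(2) t(2) by (auto simp: G_def intro: group_closure.diff)
      moreover have "s - t = zsmul (z - z') (B p) + (y - y')"
        using s(3) t(3) 3 by (simp add: zsmul_minus_left)
      ultimately show ?thesis using s(1) by metis
    qed
  qed
qed

definition normalized :: "'n \<times> 'o \<Rightarrow> ('n \<times> 'o \<Rightarrow> int) \<Rightarrow> bool" where
  "normalized q m \<longleftrightarrow> finite {p. m p \<noteq> 0} \<and> {p. m p \<noteq> 0} \<subseteq> below q \<and>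
     (\<forall>p\<in>below q. N p \<noteq> \<infinity> \<longrightarrow> 0 \<le> m p \<and> m p < int (the_enat (N p)))"

lemma value_repr_iff:
  "value_repr a \<beta> i j m \<longleftrightarrow> normalized (i, j) m \<and>
     nsmul (n i j) (\<beta> i j) = (\<Sum>p | m p \<noteq> 0. zsmul (m p) (B p))"
  unfolding value_repr_def normalized_def prec_eq
  by (auto simp: N_def n_def B_def case_prod_unfold)

text \<open>Divide the top coefficient by the relative order: the quotient part lies in
  \<open>G p\<close> and joins the remainder, to which induction applies.\<close>

lemma normalized_ex:
  "x \<in> G q \<Longrightarrow> \<exists>m. normalized q m \<and> x = (\<Sum>p | m p \<noteq> 0. zsmul (m p) (B p))"
proof (induction q arbitrary: x rule: wfp_induct_rule [OF wfp_index])
  case (1 q)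
  have pos: "0 < int (the_enat (N p))" if "N p \<noteq> \<infinity>" for p
    using N_finite(1) [OF that] by simp
  from G_decomp [OF "1.prems"] show ?case
  proof (elim disjE exE conjE)
    assume "x = 0"
    then show ?thesis
      by (intro exI [of _ "\<lambda>_. 0"]) (simp add: normalized_def, use N_finite(1) in force)
  next
    fix p z y assume p: "p \<in> below q" "y \<in> G p" "x = zsmul z (B p) + y"
    then have pq: "p < q" by (simp add: below_def)
    have "\<exists>z' y'. y' \<in> G p \<and> x = zsmul z' (B p) + y' \<and>
        (N p \<noteq> \<infinity> \<longrightarrow> 0 \<le> z' \<and> z' < int (the_enat (N p)))"
    proof (cases "N p = \<infinity>")
      case False
      define k where "k = the_enat (N p)"
      have k: "1 \<le> k" "nsmul k (B p) \<in> G p"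
        using N_finite [OF False] by (auto simp: k_def)
      have "z = (z div int k) * int k + z mod int k" by simp
      then have "zsmul z (B p) = zsmul (z div int k) (nsmul k (B p)) + zsmul (z mod int k) (B p)"
        using zsmul_mult_nat zsmul_add by metis
      then have "x = zsmul (z mod int k) (B p) + (zsmul (z div int k) (nsmul k (B p)) + y)"
        using p(3) by (simp add: algebra_simps)
      moreover have "zsmul (z div int k) (nsmul k (B p)) + y \<in> G p"
        using k(2) p(2) by (auto simp: G_def intro!: group_closure_add zsmul_group_closure)
      ultimately show ?thesis
        using k(1) unfolding k_def [symmetric]
        by (intro exI [of _ "z mod int k"] exI [of _ "zsmul (z div int k) (nsmul k (B p)) + y"]) simp
    qed (use p in blast)
    then obtain z' y' where z': "y' \<in> G p" "x = zsmul z' (B p) + y'"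
      "N p \<noteq> \<infinity> \<Longrightarrow> 0 \<le> z' \<and> z' < int (the_enat (N p))" by blast
    obtain m where m: "normalized p m" "y' = (\<Sum>r | m r \<noteq> 0. zsmul (m r) (B r))"
      using "1.IH" [OF pq z'(1)] by blast
    have mp: "m p = 0" and m0: "m r \<noteq> 0 \<Longrightarrow> r \<in> below p" for r
      using m(1) by (auto simp: normalized_def below_def)
    define m' where "m' = m(p := z')"
    have fin: "finite {r. m r \<noteq> 0}" using m(1) by (simp add: normalized_def)
    have fin': "finite {r. m' r \<noteq> 0}"
      by (rule finite_subset [of _ "insert p {r. m r \<noteq> 0}"]) (auto simp: m'_def fin)
    have "normalized q m'"
      unfolding normalized_def
    proof (intro conjI fin' ballI impI)
      show "{r. m' r \<noteq> 0} \<subseteq> below q"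
        using m0 p(1) pq by (force simp: m'_def below_def split: if_splits)
      fix r assume r: "r \<in> below q" "N r \<noteq> \<infinity>"
      have "0 \<le> m' r \<and> m' r < int (the_enat (N r))"
      proof (cases "r = p")
        case False
        show ?thesis
        proof (cases "r \<in> below p")
          case True
          then show ?thesis using m(1) r False by (simp add: normalized_def m'_def)
        next
          case F: False
          then have "m r = 0" using m0 by blast
          then show ?thesis using False pos r by (simp add: m'_def)
        qed
      qed (use z'(3) r in \<open>simp add: m'_def\<close>)
      then show "0 \<le> m' r" "m' r < int (the_enat (N r))" by auto
    qed
    moreover have "(\<Sum>r | m' r \<noteq> 0. zsmul (m' r) (B r)) =
        (\<Sum>r\<in>insert p {r. m r \<noteq> 0}. zsmul (m' r) (B r))"
      using fin mp by (intro sum.mono_neutral_left) (auto simp: m'_def)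
    moreover have "\<dots> = zsmul z' (B p) + (\<Sum>r | m r \<noteq> 0. zsmul (m' r) (B r))"
      using fin mp by (subst sum.insert) (auto simp: m'_def)
    moreover have "(\<Sum>r | m r \<noteq> 0. zsmul (m' r) (B r)) = (\<Sum>r | m r \<noteq> 0. zsmul (m r) (B r))"
      using mp by (intro sum.cong) (auto simp: m'_def)
    ultimately show ?thesis
      using z'(2) m(2) by (intro exI [of _ m']) simp
  qed
qed

text \<open>Solving the relation for its top term puts \<open>zsmul (z p) (B p)\<close> into
  \<open>G p\<close>. This serves both for uniqueness of representations and for separating normal
  monomials by value.\<close>

lemma top_coefficient:
  assumes fin: "finite {r. z r \<noteq> 0}"
    and dom: "\<And>r. z r \<noteq> 0 \<Longrightarrow> snd r \<le> a (fst r) \<and> r \<le> p"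
    and "z p \<noteq> 0" and sum: "(\<Sum>r | z r \<noteq> 0. zsmul (z r) (B r)) = 0"
  shows "N p \<le> enat (nat \<bar>z p\<bar>)"
proof (rule N_le_int [OF assms(3)])
  have "(\<Sum>r | z r \<noteq> 0. zsmul (z r) (B r)) =
      zsmul (z p) (B p) + (\<Sum>r\<in>{r. z r \<noteq> 0} - {p}. zsmul (z r) (B r))"
    using fin assms(3) by (intro sum.remove) auto
  moreover have "(\<Sum>r\<in>{r. z r \<noteq> 0} - {p}. zsmul (z r) (B r)) \<in> G p"
    unfolding G_def
  proof (rule group_closure_sum)
    fix r assume "r \<in> {r. z r \<noteq> 0} - {p}"
    then have "r \<in> below p" using dom [of r] by (auto simp: below_def)
    then show "zsmul (z r) (B r) \<in> group_closure (B ` below p)"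
      using B_in_G [of r p] by (intro zsmul_group_closure) (simp add: G_def)
  qed
  moreover have "zsmul (z p) (B p) = 0 - (\<Sum>r\<in>{r. z r \<noteq> 0} - {p}. zsmul (z r) (B r))"
    using calculation(1) unfolding sum by (simp add: eq_neg_iff_add_eq_0)
  ultimately show "zsmul (z p) (B p) \<in> G p"
    unfolding G_def by (simp only: group_closure.diff zero_in_group_closure)
qed

text \<open>At the largest index where they differ, \<open>top_coefficient\<close> forces the
  relative order to be finite and at most the absolute difference, while both coefficients lie
  between 0 and that order.\<close>

lemma normalized_unique:
  assumes m: "normalized q m" and m': "normalized q m'"
    and eq: "(\<Sum>p | m p \<noteq> 0. zsmul (m p) (B p)) = (\<Sum>p | m' p \<noteq> 0. zsmul (m' p) (B p))"
  shows "m = m'"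
proof (rule ccontr)
  assume ne: "m \<noteq> m'"
  define z where "z r = m r - m' r" for r
  have fin: "finite {p. m p \<noteq> 0}" "finite {p. m' p \<noteq> 0}"
    using m m' by (auto simp: normalized_def)
  have sub: "{r. z r \<noteq> 0} \<subseteq> {p. m p \<noteq> 0} \<union> {p. m' p \<noteq> 0}"
    by (auto simp: z_def)
  have finz: "finite {r. z r \<noteq> 0}"
    using sub fin by (metis finite_Un finite_subset)
  have nez: "{r. z r \<noteq> 0} \<noteq> {}" using ne by (auto simp: z_def fun_eq_iff)
  define p where "p = Max {r. z r \<noteq> 0}"
  have p: "z p \<noteq> 0" "\<And>r. z r \<noteq> 0 \<Longrightarrow> r \<le> p"
    using Max_in [OF finz nez] finz by (auto simp: p_def)
  have dom: "r \<in> below q" if "z r \<noteq> 0" for r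
    using that sub m m' by (auto simp: normalized_def)
  let ?T = "{p. m p \<noteq> 0} \<union> {p. m' p \<noteq> 0}"
  have "(\<Sum>r | z r \<noteq> 0. zsmul (z r) (B r)) = (\<Sum>r\<in>?T. zsmul (z r) (B r))"
    using fin sub by (intro sum.mono_neutral_left) auto
  also have "\<dots> = (\<Sum>r\<in>?T. zsmul (m r) (B r)) - (\<Sum>r\<in>?T. zsmul (m' r) (B r))"
    by (simp add: z_def zsmul_minus_left sum_subtractf)
  also have "(\<Sum>r\<in>?T. zsmul (m r) (B r)) = (\<Sum>r | m r \<noteq> 0. zsmul (m r) (B r))"
    using fin by (intro sum.mono_neutral_right) auto
  also have "(\<Sum>r\<in>?T. zsmul (m' r) (B r)) = (\<Sum>r | m' r \<noteq> 0. zsmul (m' r) (B r))"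
    using fin by (intro sum.mono_neutral_right) auto
  finally have "(\<Sum>r | z r \<noteq> 0. zsmul (z r) (B r)) = 0" using eq by simp
  then have le: "N p \<le> enat (nat \<bar>z p\<bar>)"
    by (intro top_coefficient finz) (use p dom in \<open>auto simp: below_def\<close>)
  then obtain k where k: "N p = enat k" by (cases "N p") auto
  have "0 \<le> m p \<and> m p < int k" "0 \<le> m' p \<and> m' p < int k"
    using m m' dom [OF p(1)] k by (auto simp: normalized_def)
  then have "\<bar>z p\<bar> < int k" by (auto simp: z_def)
  with le k show False by simp
qed

lemma value_coeff_repr:
  assumes "rel_order a \<beta> i j \<noteq> \<infinity>"
  shows "value_repr a \<beta> i j (value_coeff a \<beta> i j)"
proof -
  have "nsmul (n i j) (\<beta> i j) \<in> G (i, j)"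
    using N_finite(2) [of "(i, j)"] assms by (simp add: N_def n_def B_def)
  from normalized_ex [OF this] obtain m where
    "normalized (i, j) m \<and> nsmul (n i j) (\<beta> i j) = (\<Sum>p | m p \<noteq> 0. zsmul (m p) (B p))"
    by (elim exE) (rule that)
  then have m: "value_repr a \<beta> i j m" by (simp only: value_repr_iff)
  show ?thesis
    unfolding value_coeff_def
  proof (rule theI [where P = "value_repr a \<beta> i j", OF m])
    fix m' assume "value_repr a \<beta> i j m'"
    with m show "m' = m"
      unfolding value_repr_iff by (elim conjE) (rule normalized_unique, assumption+, simp)
  qed
qed

section \<open>The monomial \<open>U^m\<close> of the recursion as a multiset\<close>

definition M :: "'n \<Rightarrow> 'o \<Rightarrow> ('n \<times> 'o) multiset" where
  "M i j = (\<Sum>q\<in>value_supp a \<beta> i j. replicate_mset (nat (value_coeff a \<beta> i j q)) q)"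

lemma n_finite: "j < a i \<Longrightarrow> rel_order a \<beta> i j = enat (n i j)"
  using value_sequence by (cases "rel_order a \<beta> i j") (auto simp: value_sequence_def n_def)

lemma N_enat: "j < a i \<Longrightarrow> N (i, j) = enat (n i j)"
  by (simp add: N_def n_finite)

lemma n_pos: "j < a i \<Longrightarrow> 1 \<le> n i j"
  using N_finite(1) [of "(i, j)"] by (simp add: N_enat)

lemma \<beta>_pos: "j \<le> a i \<Longrightarrow> 0 < \<beta> i j"
  using value_sequence by (auto simp: value_sequence_def)

context
  fixes i j
  assumes j: "j < a i"
begin

lemma coeff_repr: "normalized (i, j) (value_coeff a \<beta> i j)"
  "nsmul (n i j) (\<beta> i j) = (\<Sum>p | value_coeff a \<beta> i j p \<noteq> 0. zsmul (value_coeff a \<beta> i j p) (B p))"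
  using value_coeff_repr [of i j] n_finite [OF j] by (auto simp: value_repr_iff)

lemma coeff_nonneg: "0 \<le> value_coeff a \<beta> i j q"
proof (cases "q \<in> prec a i j")
  case True
  then show ?thesis
    using value_sequence j n_finite [OF j] by (force simp: value_sequence_def)
next
  case False
  then have "value_coeff a \<beta> i j q = 0"
    using coeff_repr(1) by (auto simp: normalized_def prec_eq)
  then show ?thesis by simp
qed

lemma value_supp_eq: "value_supp a \<beta> i j = {q. value_coeff a \<beta> i j q \<noteq> 0}"
proof -
  have "q \<in> below (i, j)" if "value_coeff a \<beta> i j q \<noteq> 0" for q
    using that coeff_repr(1) by (auto simp: normalized_def)
  moreover have "0 < value_coeff a \<beta> i j q" if "value_coeff a \<beta> i j q \<noteq> 0" for q
    using that coeff_nonneg [of q] by simp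
  ultimately show ?thesis
    unfolding value_supp_def prec_eq by auto
qed

lemma finite_value_supp: "finite (value_supp a \<beta> i j)"
  using coeff_repr(1) by (simp add: value_supp_eq normalized_def)

lemma count_M: "count (M i j) q = nat (value_coeff a \<beta> i j q)"
proof -
  have "count (M i j) q = (\<Sum>p\<in>value_supp a \<beta> i j. if q = p then nat (value_coeff a \<beta> i j p) else 0)"
    by (simp add: M_def count_sum)
  also have "\<dots> = nat (value_coeff a \<beta> i j q)"
    using finite_value_supp by (auto simp: value_supp_eq)
  finally show ?thesis .
qed

lemma set_M: "set_mset (M i j) = value_supp a \<beta> i j"
proof -
  have "q \<in># M i j \<longleftrightarrow> value_coeff a \<beta> i j q \<noteq> 0" for q
    using coeff_nonneg [of q] by (auto simp: count_M simp flip: count_greater_zero_iff)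
  then show ?thesis by (auto simp: value_supp_eq)
qed

lemma M_below: "q \<in># M i j \<Longrightarrow> snd q \<le> a (fst q) \<and> q < (i, j)"
  using coeff_repr(1) by (auto simp: set_M value_supp_eq normalized_def below_def)

lemma count_M_less:
  assumes "q \<in># M i j" "N q \<noteq> \<infinity>"
  shows "count (M i j) q < the_enat (N q)"
proof -
  have "q \<in> below (i, j)" using M_below [OF assms(1)] by (simp add: below_def)
  then have "value_coeff a \<beta> i j q < int (the_enat (N q))"
    using coeff_repr(1) assms(2) by (auto simp: normalized_def)
  then show ?thesis using coeff_nonneg [of q] by (simp add: count_M)
qed

lemma sum_value_supp:
  "(\<Sum>q\<in>#M i j. w q) = (\<Sum>q\<in>value_supp a \<beta> i j. nsmul (nat (value_coeff a \<beta> i j q)) (w q))"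
  unfolding M_def by (simp add: sum_mset_sum_image [OF finite_value_supp] sum_mset_replicate)

lemma sum_M: "(\<Sum>q\<in>#M i j. B q) = nsmul (n i j) (\<beta> i j)"
proof -
  have *: "nsmul (nat (value_coeff a \<beta> i j q)) x = zsmul (value_coeff a \<beta> i j q) x" for q x
    using coeff_nonneg [of q] by (simp add: zsmul_def)
  show ?thesis
    unfolding sum_value_supp coeff_repr(2) value_supp_eq * ..
qed

lemma prod_M:
  "(\<Prod>(i', j')\<in>value_supp a \<beta> i j. u i' j' ^ nat (value_coeff a \<beta> i j (i', j'))) =
    (\<Prod>q\<in>#M i j. u (fst q) (snd q) :: 'c::comm_monoid_mult)"
  by (simp add: image_prod_mset_multiplicity set_M count_M case_prod_unfold)

end

lemma \<beta>_step: "j < a i \<Longrightarrow> nsmul (n i j) (\<beta> i j) < \<beta> i (osuc j)"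
  using value_sequence by (auto simp: value_sequence_def n_def)

text \<open>Successors multiply further by \<open>n \<ge> 1\<close>. At a limit the axiom only gives
  an increase of values, which suffices since \<open>osuc j\<close> still lies below the
  limit.\<close>

lemma \<beta>_mono:
  "j < k \<Longrightarrow> k \<le> a i \<Longrightarrow> nsmul (n i j) (\<beta> i j) < \<beta> i k"
proof (induction k rule: less_induct)
  case (less k)
  show ?case
  proof (cases k rule: ordinal_cases)
    case first
    then show ?thesis using less.prems(1) by (metis leD ofirst_le)
  next
    case (suc x)
    have "x < a i" using suc less.prems by auto
    have "j \<le> x" using less.prems(1) suc by (auto intro: less_osucD)
    then consider "j = x" | "j < x" by fastforce
    then show ?thesis
    proof cases
      case 1
      then show ?thesis using \<beta>_step \<open>x < a i\<close> suc by blast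
    next
      case 2
      have "nsmul (n i j) (\<beta> i j) < \<beta> i x"
        using 2 suc \<open>x < a i\<close> by (intro less.IH) auto
      also have "\<dots> \<le> nsmul (n i x) (\<beta> i x)"
        using n_pos [OF \<open>x < a i\<close>] \<beta>_pos [of x i] \<open>x < a i\<close> by (intro nsmul_ge) (auto intro: less_imp_le)
      also have "\<dots> < \<beta> i k" using \<beta>_step \<open>x < a i\<close> suc by blast
      finally show ?thesis .
    qed
  next
    case limit
    have "j < a i" using less.prems by auto
    have "osuc j < k" using limit less.prems(1) by (rule olimit_osuc)
    then have "\<beta> i (osuc j) < \<beta> i k"
      using value_sequence limit less.prems(2) by (auto simp: value_sequence_def)
    then show ?thesis using \<beta>_step [OF \<open>j < a i\<close>] by simp
  qed
qed

lemma \<beta>_strict_mono: "j < k \<Longrightarrow> k \<le> a i \<Longrightarrow> \<beta> i j < \<beta> i k"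
  using \<beta>_mono [of j k i] nsmul_ge [OF n_pos [of j i] less_imp_le [OF \<beta>_pos [of j i]]] by force

text \<open>With factors from the variable \<open>i\<close> only, the mixed radix bound would give a
  value below \<open>\<beta> i j\<close>, contradicting \<open>sum_M\<close>. The earlier variable
  found here drives both the leading exponents and the convergence of key polynomials.\<close>

lemma M_lower:
  assumes j: "j < a i"
  shows "\<exists>q\<in>#M i j. fst q < i"
proof (rule ccontr)
  assume "\<not> ?thesis"
  then have M: "fst q = i \<and> snd q < j" if "q \<in># M i j" for q
    using that M_below [OF j that] by (auto simp: less_prod_def')
  then have "filter_mset (\<lambda>q. fst q = i) (M i j) = M i j"
    by (auto simp: filter_mset_eq_conv)
  moreover have "\<Sum>\<^sub># (image_mset (\<lambda>q. B q) (M i j)) = (\<Sum>q\<in>#M i j. \<beta> i (snd q))"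
    using M by (intro arg_cong [of _ _ sum_mset] image_mset_cong) (auto simp: B_def)
  ultimately have "(\<Sum>q\<in>#M i j. B q) = (\<Sum>k\<in>#part i (M i j). \<beta> i k)"
    by (simp add: part_def multiset.map_comp comp_def)
  also have "\<dots> < \<beta> i j"
  proof (rule radix_bound [where n = "n i"])
    show "nsmul (n i k) (\<beta> i k) \<le> \<beta> i l" if "k < l" "l \<le> j" for k l
      using \<beta>_mono [of k l i] that j by force
    show "0 < \<beta> i k" if "k \<le> j" for k using that j by (intro \<beta>_pos) auto
    fix k assume "k \<in># part i (M i j)"
    then have *: "(i, k) \<in># M i j" by (simp flip: count_greater_zero_iff)
    then have "k < j" using M [OF *] by simp
    with j count_M_less [OF j *] show "k < j \<and> count (part i (M i j)) k < n i k"
      by (simp add: N_enat)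
  qed
  also have "\<dots> \<le> nsmul (n i j) (\<beta> i j)"
    using n_pos [OF j] \<beta>_pos [of j i] j by (intro nsmul_ge) (auto intro: less_imp_le)
  finally show False using sum_M [OF j] by simp
qed

end

section \<open>Structure of key polynomials\<close>

lemma not_less_ofirst [simp]: "\<not> j < ofirst"
  by (simp add: not_less)

lemma sum_mset_apply: "(\<Sum>q\<in>#J. e q) l = (\<Sum>q\<in>#J. e q l)"
  by (induction J) auto

locale skp =
  fixes a :: "'n::{finite,linorder} \<Rightarrow> 'o::wellorder"
    and \<beta> :: "'n \<Rightarrow> 'o \<Rightarrow> 'g::linordered_ab_group_add"
    and \<theta> :: "'n \<Rightarrow> 'o \<Rightarrow> 'k::field"
    and \<alpha> :: "'n \<Rightarrow> 'o"
    and U :: "'n \<Rightarrow> 'o \<Rightarrow> ('n, 'k) mfps"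
  assumes SKP: "SKP a \<beta> \<theta> \<alpha> U"
begin

sublocale value_seq a \<beta>
  using SKP by unfold_locales (simp add: SKP_def)

definition UU :: "'n \<times> 'o \<Rightarrow> ('n, 'k) mfps" where
  "UU q = U (fst q) (snd q)"

definition mon :: "('n \<times> 'o) multiset \<Rightarrow> ('n, 'k) mfps" where
  "mon J = (\<Prod>q\<in>#J. UU q)"

lemma mon_simps [simp]:
  "mon {#} = 1" "mon (add_mset q J) = UU q * mon J" "mon (J + K) = mon J * mon K"
  "mon (replicate_mset r q) = UU q ^ r"
  by (simp_all add: mon_def)

lemma \<alpha>_le: "\<alpha> i \<le> a i"
  and U_first: "U i ofirst = mvar i"
  and U_limit: "olimit j \<Longrightarrow> j \<le> \<alpha> i \<Longrightarrow> adic_limit_at (U i) j (U i j)"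
  and U_limit_nonzero: "olimit j \<Longrightarrow> j < \<alpha> i \<Longrightarrow> U i j \<noteq> 0"
  using SKP by (auto simp: SKP_def)

lemma less_a: "j < \<alpha> i \<Longrightarrow> j < a i"
  using \<alpha>_le [of i] by simp

lemma \<theta>_nonzero: "j < \<alpha> i \<Longrightarrow> \<theta> i j \<noteq> 0"
  using SKP less_a by (auto simp: SKP_def)

lemma U_suc:
  assumes "j < \<alpha> i"
  shows "U i (osuc j) = U i j ^ n i j - mconst (\<theta> i j) * mon (M i j)"
proof -
  have "U i (osuc j) = U i j ^ the_enat (rel_order a \<beta> i j)
          - mconst (\<theta> i j) * (\<Prod>(i', j')\<in>value_supp a \<beta> i j. U i' j' ^ nat (value_coeff a \<beta> i j (i', j')))"
    using SKP assms by (auto simp: SKP_def)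
  then show ?thesis
    by (simp add: prod_M [OF less_a [OF assms]] n_def mon_def UU_def)
qed

lemma U_supp:
  assumes "j < \<alpha> i" "q \<in># M i j"
  shows "snd q \<le> \<alpha> (fst q)" "UU q \<noteq> 0"
proof -
  have "\<forall>(i', j')\<in>value_supp a \<beta> i j. j' \<le> \<alpha> i' \<and> U i' j' \<noteq> 0"
    using SKP assms(1) by (auto simp: SKP_def)
  then show "snd q \<le> \<alpha> (fst q)" "UU q \<noteq> 0"
    using assms by (auto simp: set_M [OF less_a] UU_def)
qed

lemma limit_adic_close:
  assumes "olimit j" "j \<le> \<alpha> i" "k < j"
  obtains k' where "k \<le> k'" "k' < j" "adic_close T (U i k') (U i j)"
proof -
  obtain j0 where "j0 < j" "\<forall>j'. j0 \<le> j' \<and> j' < j \<longrightarrow> adic_close T (U i j') (U i j)"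
    using U_limit [OF assms(1,2)] unfolding adic_limit_at_def by blast
  then show ?thesis
    using assms(3) by (intro that [of "max j0 k"]) auto
qed

text \<open>\<open>M_lower\<close> guarantees that the subtracted monomial has a factor, and
  \<open>n_pos\<close> that the power is not constant. Orders then bound the number of factors of a
  monomial.\<close>

lemma U_ordge_1: "j \<le> \<alpha> i \<Longrightarrow> ordge 1 (U i j)"
proof -
  have "snd q \<le> \<alpha> (fst q) \<Longrightarrow> ordge 1 (UU q)" for q
  proof (induction q rule: wfp_induct_rule [OF wfp_index])
    case (1 q)
    obtain i j where q: "q = (i, j)" by (cases q)
    show ?case
    proof (cases j rule: ordinal_cases)
      case first
      then show ?thesis by (simp add: UU_def q U_first ordge_mvar del: One_nat_def)
    next
      case (suc x)
      then have x: "x < \<alpha> i" using "1.prems" by (auto simp: q)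
      have xq: "(i, x) < q" using suc by (simp add: q)
      have "ordge (n i x * 1) (U i x ^ n i x)"
        using "1.IH" [OF xq] x by (intro ordge_power) (auto simp: UU_def)
      moreover obtain p where p: "p \<in># M i x"
        using M_lower [OF less_a [OF x]] by blast
      have "p < q"
        using M_below [OF less_a [OF x] p] xq by auto
      then have "ordge 1 (UU p)"
        using "1.IH" U_supp [OF x p] by auto
      then have "ordge 1 (mon (M i x))"
        using p by (metis insert_DiffM mon_simps(2) mult.commute ordge_mult_left)
      ultimately show ?thesis
        using n_pos [OF less_a [OF x]] unfolding q UU_def snd_conv fst_conv suc(2) U_suc [OF x]
        by (intro ordge_diff ordge_mult_left) (auto intro: ordge_mono)
    next
      case limit
      from limit_adic_close [OF limit, of i ofirst 1] "1.prems" olimit_gt_first [OF limit]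
      obtain k where k: "k < j" "adic_close 1 (U i k) (U i j)" by (auto simp: q)
      have "ordge 1 (UU (i, k))"
        using k(1) "1.prems" by (intro "1.IH") (auto simp: q)
      with k(2) show ?thesis
        unfolding UU_def q by (auto intro: ordge_close)
    qed
  qed
  from this [of "(i, j)"] show "j \<le> \<alpha> i \<Longrightarrow> ordge 1 (U i j)" by (simp add: UU_def)
qed

lemma mon_ordge_size:
  assumes "\<And>q. q \<in># J \<Longrightarrow> snd q \<le> \<alpha> (fst q)"
  shows "ordge (size J) (mon J)"
  using ordge_prod_mset [of J "\<lambda>_. 1" UU] U_ordge_1 assms by (auto simp: mon_def UU_def)

lemma mon_ordge_factor: "q \<in># J \<Longrightarrow> ordge T (UU q) \<Longrightarrow> ordge T (mon J)"
  by (metis insert_DiffM mon_simps(2) mult.commute ordge_mult_left)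

text \<open>Finiteness of the product of the \<open>n i k\<close>. For constructed key polynomials
  it turns out to be equivalent to \<open>U i j\<close> being nonzero
  (\<open>U_nonzero_iff\<close>).\<close>

definition dfin :: "'n \<Rightarrow> 'o \<Rightarrow> bool" where
  "dfin i j \<longleftrightarrow> finite {k. k < j \<and> 2 \<le> n i k}"

text \<open>The degree of \<open>U i j\<close> in the \<open>i\<close>-th variable; only meaningful if \<open>dfin i j\<close>.\<close>

definition d :: "'n \<Rightarrow> 'o \<Rightarrow> nat" where
  "d i j = (\<Prod>k | k < j \<and> 2 \<le> n i k. n i k)"

lemma dfin_first [simp]: "dfin i ofirst"
  by (simp add: dfin_def)

lemma d_first [simp]: "d i ofirst = 1"
  by (simp add: d_def)

lemma dfin_mono: "dfin i k \<Longrightarrow> j \<le> k \<Longrightarrow> dfin i j"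
  unfolding dfin_def by (erule rev_finite_subset) auto

lemma suc_set:
  assumes "j < k"
  shows "{l. l < osuc j \<and> 2 \<le> n i l} =
    (if 2 \<le> n i j then insert j {l. l < j \<and> 2 \<le> n i l} else {l. l < j \<and> 2 \<le> n i l})"
  using osuc_greater [OF assms] less_osucD [of _ j] by (auto simp: order_le_less)

lemma dfin_suc: "j < k \<Longrightarrow> dfin i j \<Longrightarrow> dfin i (osuc j)"
  unfolding dfin_def by (simp add: suc_set)

lemma d_suc:
  assumes "j < a i" "dfin i j"
  shows "d i (osuc j) = n i j * d i j"
  using assms(2) n_pos [OF assms(1)] unfolding d_def dfin_def suc_set [OF assms(1)] by auto

lemma d_pos: "0 < d i j"
  unfolding d_def by (auto intro!: prod_pos)

lemma d_const_set:
  assumes "j \<le> k" "\<And>l. j \<le> l \<Longrightarrow> l < k \<Longrightarrow> n i l < 2"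
  shows "{l. l < j \<and> 2 \<le> n i l} = {l. l < k \<and> 2 \<le> n i l}"
  using assms by (auto simp: not_le) (meson leD not_le)

lemma d_const:
  assumes "j \<le> k" "\<And>l. j \<le> l \<Longrightarrow> l < k \<Longrightarrow> n i l < 2"
  shows "d i j = d i k" "dfin i j \<longleftrightarrow> dfin i k"
  using d_const_set [OF assms] unfolding d_def dfin_def by auto

lemma d_mult_dvd:
  assumes "j < k" "k \<le> a i" "dfin i k"
  shows "n i j * d i j dvd d i k"
proof (cases "2 \<le> n i j")
  case True
  have "n i j * d i j = (\<Prod>l\<in>insert j {l. l < j \<and> 2 \<le> n i l}. n i l)"
    using dfin_mono [OF assms(3), of j] assms(1) unfolding d_def dfin_def by (subst prod.insert) auto
  also have "\<dots> dvd d i k"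
    unfolding d_def
    by (rule prod_dvd_prod_subset) (use assms True in \<open>auto simp: dfin_def\<close>)
  finally show ?thesis .
next
  case False
  then have "n i j = 1" using n_pos [of j i] assms(1,2) by (simp add: less_le_trans)
  moreover have "d i j dvd d i k"
    unfolding d_def by (rule prod_dvd_prod_subset) (use assms in \<open>auto simp: dfin_def\<close>)
  ultimately show ?thesis by simp
qed

lemma d_mult_le: "j < k \<Longrightarrow> k \<le> a i \<Longrightarrow> dfin i k \<Longrightarrow> n i j * d i j \<le> d i k"
  using d_mult_dvd d_pos by (auto intro: dvd_imp_le)

lemma d_dvd: "j \<le> k \<Longrightarrow> k \<le> a i \<Longrightarrow> dfin i k \<Longrightarrow> d i j dvd d i k"
  using d_mult_dvd [of j k i] by (cases "j = k") (auto intro: dvd_trans [of _ "n i j * d i j"])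

lemma d_limit_const:
  assumes "olimit k" "dfin i k" "j < k"
  obtains l where "j \<le> l" "l < k" "\<And>m. l \<le> m \<Longrightarrow> m \<le> k \<Longrightarrow> d i m = d i k"
proof -
  \<comment> \<open>Past the last \<open>n i l \<ge> 2\<close> below \<open>k\<close> the degree no
    longer changes. Inserting \<open>j\<close> makes the set nonempty and forces
    \<open>j \<le> l\<close>.\<close>
  let ?F = "insert j {l. l < k \<and> 2 \<le> n i l}"
  define l where "l = osuc (Max ?F)"
  have F: "finite ?F" using assms(2) by (simp add: dfin_def)
  have "Max ?F \<in> ?F" by (rule Max_in [OF F]) auto
  then have Mk: "Max ?F < k" using assms(3) by auto
  have lk: "l < k" unfolding l_def by (rule olimit_osuc [OF assms(1) Mk])
  have gr: "x < l" if "x \<in> ?F" for x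
    unfolding l_def using osuc_greater [OF Mk] Max_ge [OF F that] by (rule order_le_less_trans [rotated])
  have const: "d i m = d i k" if "l \<le> m" "m \<le> k" for m
  proof (rule d_const(1) [OF that(2)])
    fix x assume "m \<le> x" "x < k"
    then have "\<not> x < l" using that by auto
    then have "x \<notin> ?F" using gr by blast
    with \<open>x < k\<close> show "n i x < 2" by auto
  qed
  show ?thesis
  proof (rule that [OF _ lk const])
    show "j \<le> l" using gr [of j] by simp
  qed
qed

text \<open>Below a limit with infinitely many \<open>n i k \<ge> 2\<close> the orders tend to infinity: every monomial
  \<open>M i k\<close> has a factor from a smaller variable, so only finitely many of them have order at most
  \<open>L\<close> once the \<open>U i k\<close> themselves have order at least \<open>L\<close>.\<close>

lemma ordge_eventually:
  assumes IH: "\<And>i' T. i' < i \<Longrightarrow> finite {j. j < \<alpha> i' \<and> 2 \<le> n i' j \<and> \<not> ordge T (U i' j)}"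
    and s: "s \<le> \<alpha> i" "\<not> dfin i s" "\<And>j. j < s \<Longrightarrow> dfin i j" "olimit s"
  shows "\<exists>j0<s. \<forall>j. j0 \<le> j \<and> j < s \<longrightarrow> ordge L (U i j)"
proof (induction L)
  case 0
  then show ?case using olimit_gt_first [OF s(4)] by auto
next
  case (Suc L)
  then obtain j1 where j1: "j1 < s" "\<And>j. j1 \<le> j \<Longrightarrow> j < s \<Longrightarrow> ordge L (U i j)" by blast
  have less_\<alpha>: "j < \<alpha> i" and less_a': "j < a i" if "j < s" for j
    using that s(1) less_a by (auto intro: order_less_le_trans)
  define X where "X = {j. j1 \<le> j \<and> j < s \<and> \<not> ordge (Suc L) (mon (M i j))}"
  \<comment> \<open>The only indices possible in \<open>M i j\<close> with \<open>j\<close> in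
    \<open>X\<close>. Exponents there are positive and below \<open>n\<close>, so
    \<open>2 \<le> n\<close> except at a last index \<open>\<alpha> i'\<close>; low order of the
    monomial forces low order of its factors.\<close>
  define Q where "Q = (\<Union>i'\<in>{..<i}. {i'} \<times> insert (\<alpha> i') {j. j < \<alpha> i' \<and> 2 \<le> n i' j \<and> \<not> ordge (Suc L) (U i' j)})
      \<union> {i} \<times> {j. j < j1 \<and> 2 \<le> n i j}"
  have "finite Q"
    using IH s(3) [OF j1(1)] unfolding Q_def dfin_def by (intro finite_UnI finite_UN_I finite_cartesian_product) auto
  then have "finite (mset ` {xs. set xs \<subseteq> Q \<and> length xs \<le> L})"
    by (intro finite_imageI finite_lists_length_le)
  moreover have "M i ` X \<subseteq> mset ` {xs. set xs \<subseteq> Q \<and> length xs \<le> L}"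
  proof
    fix K assume "K \<in> M i ` X"
    then obtain j where j: "K = M i j" "j1 \<le> j" "j < s" "\<not> ordge (Suc L) (mon (M i j))"
      by (auto simp: X_def)
    note ja = less_a' [OF j(3)]
    have n2: "2 \<le> n (fst q) (snd q)" if q: "q \<in># M i j" "snd q < \<alpha> (fst q)" for q
    proof -
      have "count (M i j) q < n (fst q) (snd q)"
        using count_M_less [OF ja q(1)] N_enat [OF less_a [OF q(2)]] by simp
      moreover have "0 < count (M i j) q" using q(1) by simp
      ultimately show ?thesis by linarith
    qed
    have "set_mset (M i j) \<subseteq> Q"
    proof
      fix q assume q: "q \<in># M i j"
      note qb = M_below [OF ja q] and qs = U_supp [OF less_\<alpha> [OF j(3)] q]
      have nq: "\<not> ordge (Suc L) (UU q)" using mon_ordge_factor [OF q] j(4) by blast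
      consider "fst q < i" | "fst q = i" "snd q < j" using qb by (auto simp: less_prod_def')
      then show "q \<in> Q"
      proof cases
        case 1
        have "snd q = \<alpha> (fst q) \<or> snd q < \<alpha> (fst q)" using qs(1) by auto
        then show ?thesis using 1 n2 [OF q] nq by (cases q) (auto simp: Q_def UU_def)
      next
        case 2
        \<comment> \<open>Otherwise this factor has order at least \<open>L\<close>, and the factor
          from an earlier variable raises the order of the monomial to \<open>L + 1\<close>.\<close>
        have "snd q < j1"
        proof (rule ccontr)
          assume "\<not> snd q < j1"
          then have "ordge L (UU q)" using 2 j(3) j1(2) by (auto simp: UU_def)
          moreover obtain p where p: "p \<in># M i j" "fst p < i"
            using M_lower [OF ja] by blast
          have "ordge 1 (UU p)"
            using U_ordge_1 U_supp(1) [OF less_\<alpha> [OF j(3)] p(1)] by (simp add: UU_def)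
          moreover have "p \<noteq> q" using p 2 by auto
          then have "p \<in># M i j - {#q#}" using p(1) by (simp add: in_diff_count)
          ultimately have "ordge (L + 1) (UU q * mon (M i j - {#q#}))"
            using mon_ordge_factor by (intro ordge_mult) auto
          moreover have "UU q * mon (M i j - {#q#}) = mon (M i j)"
            using q by (metis insert_DiffM mon_simps(2))
          ultimately show False using j(4) by simp
        qed
        moreover have "snd q < \<alpha> (fst q)"
          using 2 less_\<alpha> [OF j(3)] by auto
        then have "2 \<le> n (fst q) (snd q)" by (rule n2 [OF q])
        ultimately show ?thesis using 2 by (cases q) (auto simp: Q_def)
      qed
    qed
    moreover have "size (M i j) \<le> L"
    proof (rule ccontr)
      assume "\<not> size (M i j) \<le> L"
      then have "ordge (Suc L) (mon (M i j))"
        using U_supp(1) [OF less_\<alpha> [OF j(3)]]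
        by (intro ordge_mono [OF mon_ordge_size]) auto
      with j(4) show False by simp
    qed
    moreover obtain xs where "mset xs = M i j" using ex_mset by blast
    ultimately show "K \<in> mset ` {xs. set xs \<subseteq> Q \<and> length xs \<le> L}"
      unfolding j(1) by (metis (mono_tags, lifting) image_eqI mem_Collect_eq set_mset_mset size_mset)
  qed
  ultimately have "finite (M i ` X)" by (rule finite_subset [rotated])
  \<comment> \<open>The value of \<open>M i j\<close> is \<open>nsmul (n i j) (\<beta> i j)\<close>,
    strictly increasing in \<open>j\<close>, so finitely many monomials mean finitely many
    \<open>j\<close>.\<close>
  moreover have "inj_on (M i) X"
  proof (rule inj_onI, rule ccontr)
    fix x y assume xy: "x \<in> X" "y \<in> X" "M i x = M i y" "x \<noteq> y"
    have lt: "nsmul (n i k) (\<beta> i k) < nsmul (n i l) (\<beta> i l)" if "k < l" "l < s" for k l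
    proof -
      have "nsmul (n i k) (\<beta> i k) < \<beta> i l"
        using that less_a' [of l] by (intro \<beta>_mono) auto
      also have "\<dots> \<le> nsmul (n i l) (\<beta> i l)"
        using n_pos \<beta>_pos [of l i] less_a' [OF that(2)] by (intro nsmul_ge) (auto intro: less_imp_le)
      finally show ?thesis .
    qed
    have "nsmul (n i x) (\<beta> i x) = nsmul (n i y) (\<beta> i y)"
      using xy sum_M less_a' unfolding X_def by (metis (mono_tags, lifting) mem_Collect_eq)
    with lt [of x y] lt [of y x] xy show False
      unfolding X_def by (cases x y rule: linorder_cases) auto
  qed
  ultimately have finX: "finite X" by (rule finite_imageD)
  define m where "m = Max (insert j1 X)"
  have "m \<in> insert j1 X" unfolding m_def using finX by (intro Max_in) auto
  then have ms: "m < s" using j1(1) by (auto simp: X_def)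
  have m_ge: "x \<le> m" if "x \<in> insert j1 X" for x
    unfolding m_def using finX that by (intro Max_ge) auto
  \<comment> \<open>Beyond all of \<open>X\<close> the subtracted monomials are harmless, and the
    power \<open>n i j3 \<ge> 2\<close> at least doubles the order. Below, \<open>max L 1\<close> is
    doubled, because for \<open>L = 0\<close> doubling \<open>L\<close> gains nothing. The order
    \<open>Suc L\<close> then persists.\<close>
  have "\<exists>j3. m < j3 \<and> j3 < s \<and> 2 \<le> n i j3"
  proof (rule ccontr)
    assume "\<not> ?thesis"
    then have "{k. k < s \<and> 2 \<le> n i k} \<subseteq> insert m {k. k < m \<and> 2 \<le> n i k}"
      by (auto simp: not_less order_le_less)
    with s(2) s(3) [OF ms] show False
      unfolding dfin_def by (metis finite.insertI finite_subset)
  qed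
  then obtain j3 where j3: "m < j3" "j3 < s" "2 \<le> n i j3" by blast
  have ord1: "ordge (max L 1) (U i j)" if "j1 \<le> j" "j < s" for j
    using j1(2) [OF that] U_ordge_1 [of j i] less_\<alpha> [OF that(2)] by (auto simp: max_def)
  have main: "ordge (Suc L) (U i j)" if "j3 < j" "j < s" for j
    using that
  proof (induction j rule: less_induct)
    case (less j)
    show ?case
    proof (cases j rule: ordinal_cases)
      case first
      then show ?thesis using less.prems(1) by (metis leD ofirst_le)
    next
      case (suc x)
      then have x: "x < s" "j3 \<le> x" using less.prems by (auto intro: less_osucD)
      have j1x: "j1 \<le> x" "m < x" using m_ge [of j1] j3(1) x by auto
      have "x \<notin> X" using m_ge [of x] j1x by auto
      then have "ordge (Suc L) (mon (M i x))" using j1x x by (simp add: X_def)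
      moreover have "ordge (Suc L) (U i x ^ n i x)"
      proof (cases "x = j3")
        case True
        have "ordge (n i x * max L 1) (U i x ^ n i x)"
          by (rule ordge_power [OF ord1]) (use j1x x in auto)
        moreover have "Suc L \<le> n i x * max L 1"
        proof -
          have "Suc L \<le> 2 * max L 1" by auto
          also have "\<dots> \<le> n i x * max L 1" using j3(3) True by (intro mult_le_mono1) simp
          finally show ?thesis .
        qed
        ultimately show ?thesis by (auto intro: ordge_mono)
      next
        case False
        then have "ordge (Suc L) (U i x)" using x suc by (intro less.IH) auto
        then have "ordge (n i x * Suc L) (U i x ^ n i x)" by (rule ordge_power)
        moreover have "Suc L \<le> n i x * Suc L" using n_pos [OF less_a' [OF x(1)]]
          using mult_le_mono1 [of 1 "n i x" "Suc L"] by simp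
        ultimately show ?thesis by (rule ordge_mono)
      qed
      ultimately show ?thesis
        unfolding suc(2) U_suc [OF less_\<alpha> [OF x(1)]] by (intro ordge_diff ordge_mult_left)
    next
      case limit
      have "j \<le> \<alpha> i" using less_\<alpha> [OF less.prems(2)] by simp
      moreover have "osuc j3 < j" using limit less.prems(1) by (rule olimit_osuc)
      ultimately obtain k where k: "osuc j3 \<le> k" "k < j" "adic_close (Suc L) (U i k) (U i j)"
        using limit_adic_close [OF limit] by metis
      have "ordge (Suc L) (U i k)"
        using k osuc_greater [OF j3(2)] less.prems by (intro less.IH) auto
      then show ?thesis using k(3) by (rule ordge_close)
    qed
  qed
  have "osuc j3 < s" using s(4) j3(2) by (rule olimit_osuc)
  with main osuc_greater [OF j3(2)] show ?case
    by (intro exI [of _ "osuc j3"]) auto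
qed

text \<open>The least index of infinite degree is a limit, since a successor adds at most one
  factor. The orders below it tend to infinity, so the limit is 0 and the construction stops
  there.\<close>

lemma least_infinite:
  assumes IH: "\<And>i' T. i' < i \<Longrightarrow> finite {j. j < \<alpha> i' \<and> 2 \<le> n i' j \<and> \<not> ordge T (U i' j)}"
    and "\<not> dfin i j" "j \<le> \<alpha> i"
  shows "j = \<alpha> i" "U i j = 0" "\<exists>j0<\<alpha> i. dfin i j0 \<and> (\<forall>j. j0 \<le> j \<and> j < \<alpha> i \<longrightarrow> ordge L (U i j))"
proof -
  define s where "s = (LEAST j. \<not> dfin i j)"
  have s: "\<not> dfin i s" "s \<le> j"
    unfolding s_def using assms(2) by (rule LeastI, rule Least_le)
  have lt: "dfin i k" if "k < s" for k
    using that not_less_Least unfolding s_def by blast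
  have "olimit s"
  proof (cases s rule: ordinal_cases)
    case first
    then show ?thesis using s by simp
  next
    case (suc x)
    then show ?thesis using dfin_suc [OF suc(1) lt [OF suc(1)]] s by simp
  qed
  have ev: "\<exists>j0<s. \<forall>j. j0 \<le> j \<and> j < s \<longrightarrow> ordge L (U i j)" for L
    using assms(3) s lt \<open>olimit s\<close> by (intro ordge_eventually [OF IH]) auto
  have "ordge T (U i s)" for T
  proof -
    obtain j0 where j0: "j0 < s" "\<And>j. j0 \<le> j \<Longrightarrow> j < s \<Longrightarrow> ordge T (U i j)" using ev by blast
    obtain k where "j0 \<le> k" "k < s" "adic_close T (U i k) (U i s)"
      using limit_adic_close [OF \<open>olimit s\<close> _ j0(1)] s assms(3) by (metis order_trans)
    with j0 show ?thesis by (blast intro: ordge_close)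
  qed
  then have U0: "U i s = 0" by (rule ordge_all)
  then have "s = \<alpha> i"
    using U_limit_nonzero [OF \<open>olimit s\<close>, of i] s(2) assms(3) by force
  then show "j = \<alpha> i" "U i j = 0" using s assms(3) U0 by auto
  show "\<exists>j0<\<alpha> i. dfin i j0 \<and> (\<forall>j. j0 \<le> j \<and> j < \<alpha> i \<longrightarrow> ordge L (U i j))"
    using ev [of L] lt \<open>s = \<alpha> i\<close> by blast
qed

text \<open>The earlier variables supply the hypothesis of \<open>ordge_eventually\<close>, hence
  the induction on \<open>i\<close>. If the degree at \<open>\<alpha> i\<close> is infinite, low
  orders occur only below an index of finite degree.\<close>

lemma finite_low_order: "finite {j. j < \<alpha> i \<and> 2 \<le> n i j \<and> \<not> ordge T (U i j)}"
proof (induction i arbitrary: T rule: wfp_induct_rule [OF wfp_less_finite])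
  case (1 i)
  show ?case
  proof (cases "dfin i (\<alpha> i)")
    case True
    then show ?thesis unfolding dfin_def by (rule rev_finite_subset) auto
  next
    case False
    obtain j0 where "j0 < \<alpha> i" "dfin i j0" "\<forall>j. j0 \<le> j \<and> j < \<alpha> i \<longrightarrow> ordge T (U i j)"
      using least_infinite(3) [OF "1.IH" False order_refl, where L = T] by blast
    then show ?thesis
      unfolding dfin_def by (elim rev_finite_subset) (auto simp: not_less [symmetric])
  qed
qed

lemma infinite_imp_zero: "j \<le> \<alpha> i \<Longrightarrow> \<not> dfin i j \<Longrightarrow> U i j = 0"
  using least_infinite(2) finite_low_order by blast

text \<open>\<open>L0\<close> has the smallest variable as most significant, so that monomials with
  an earlier variable come late; the reversed list \<open>L1\<close> makes the subtracted monomials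
  small.\<close>

definition L0 :: "'n list" where "L0 = sorted_list_of_set UNIV"

definition L1 :: "'n list" where "L1 = rev L0"

lemma set_L0 [simp]: "set L0 = UNIV" and set_L1 [simp]: "set L1 = UNIV"
  by (simp_all add: L0_def L1_def)

lemma sorted_L0: "sorted_wrt (<) L0" and sorted_L1: "sorted_wrt (>) L1"
  by (simp_all add: L0_def L1_def sorted_wrt_rev)

text \<open>The power of \<open>U i x\<close> leads with a pure power of \<open>X_i\<close>, whereas
  \<open>M i x\<close> contains an earlier variable and so starts later in \<open>L0\<close>. At
  limits the degree is eventually constant and each coefficient agrees with that of an approximating
  key polynomial.\<close>

lemma U_leads:
  "j \<le> \<alpha> i \<Longrightarrow> dfin i j \<Longrightarrow> leads L0 (\<lambda>l. if l = i then d i j else 0) (U i j)"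
proof -
  have "snd q \<le> \<alpha> (fst q) \<Longrightarrow> dfin (fst q) (snd q) \<Longrightarrow>
      leads L0 (\<lambda>l. if l = fst q then d (fst q) (snd q) else 0) (UU q)" for q
  proof (induction q rule: wfp_induct_rule [OF wfp_index])
    case (1 q)
    obtain i j where q: "q = (i, j)" by (cases q)
    have j: "j \<le> \<alpha> i" "dfin i j" using "1.prems" by (auto simp: q)
    have "leads L0 (\<lambda>l. if l = i then d i j else 0) (U i j)"
    proof (cases j rule: ordinal_cases)
      case first
      show ?thesis unfolding first using leads_mvar [of L0 i] by (simp add: U_first cong: if_cong)
    next
      case (suc x)
      then have x: "x < \<alpha> i" "dfin i x" using j dfin_mono [OF j(2), of x] by auto
      have xq: "(i, x) < q" using suc by (simp add: q)
      have "leads L0 (\<lambda>l. if l = i then d i x else 0) (U i x)"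
        using "1.IH" [OF xq] x by (simp add: UU_def cong: if_cong)
      from leads_power [OF this, of "n i x"]
      have 1: "leads L0 (\<lambda>l. if l = i then d i j else 0) (U i x ^ n i x)"
        by (simp add: suc d_suc [OF less_a [OF x(1)] x(2)] if_distrib cong: if_cong)
      define e where "e q l = (if l = fst q then d (fst q) (snd q) else 0)" for q :: "'n \<times> 'o" and l
      have 2: "leads L0 (\<Sum>p\<in>#M i x. e p) (mon (M i x))"
        unfolding mon_def
      proof (rule leads_prod_mset, rule ballI)
        fix p assume p: "p \<in># M i x"
        note ps = U_supp [OF x(1) p]
        have "p < q" using M_below [OF less_a [OF x(1)] p] xq by auto
        moreover have "dfin (fst p) (snd p)"
          using infinite_imp_zero [OF ps(1)] ps(2) by (auto simp: UU_def)
        ultimately show "leads L0 (e p) (UU p)"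
          unfolding e_def [abs_def] using "1.IH" ps by blast
      qed
      have 3: "lexless L0 (\<lambda>l. if l = i then d i j else 0) (\<Sum>p\<in>#M i x. e p)"
      proof -
        let ?S = "fst ` set_mset (M i x)"
        obtain p where p: "p \<in># M i x" "fst p < i"
          using M_lower [OF less_a [OF x(1)]] by blast
        define l where "l = Min ?S"
        have l: "l \<in> ?S" "\<And>l'. l' \<in> ?S \<Longrightarrow> l \<le> l'"
          using p unfolding l_def by (auto intro!: Min_in)
        have "l < i" using l(2) [of "fst p"] p by auto
        show ?thesis
        proof (rule lexless_first_diff [OF sorted_L0])
          obtain r where r: "r \<in># M i x" "fst r = l" using l(1) by auto
          have "0 < e r l" using r d_pos by (simp add: e_def)
          then have "0 < (\<Sum>p\<in>#M i x. e p l)" using r(1) mset_add [of r "M i x"] by force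
          then show "(if l = i then d i j else 0) < (\<Sum>p\<in>#M i x. e p) l"
            using \<open>l < i\<close> by (simp add: sum_mset_apply less_imp_neq)
          show "\<forall>l'<l. (if l' = i then d i j else 0) = (\<Sum>p\<in>#M i x. e p) l'"
          proof (intro allI impI)
            fix l' assume "l' < l"
            then have "e p l' = 0" if "p \<in># M i x" for p
              using that l(2) [of "fst p"] by (auto simp: e_def)
            then show "(if l' = i then d i j else 0) = (\<Sum>p\<in>#M i x. e p) l'"
              using \<open>l' < l\<close> \<open>l < i\<close> by (auto simp: sum_mset_apply)
          qed
        qed simp
      qed
      show ?thesis
        using leads_diff [OF 1 2 3] by (simp add: suc U_suc [OF x(1)])
    next
      case limit
      obtain l where l: "l < j" "\<And>m. l \<le> m \<Longrightarrow> m \<le> j \<Longrightarrow> d i m = d i j"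
        using d_limit_const [OF limit j(2) olimit_gt_first [OF limit]] by metis
      have app: "\<exists>f. leads L0 (\<lambda>l. if l = i then d i j else 0) f \<and> adic_close T f (U i j)" for T
      proof -
        obtain k where k: "l \<le> k" "k < j" "adic_close T (U i k) (U i j)"
          using limit_adic_close [OF limit j(1) l(1)] by metis
        have "leads L0 (\<lambda>l. if l = i then d i k else 0) (U i k)"
          using "1.IH" [of "(i, k)"] k j dfin_mono [OF j(2), of k] by (simp add: q UU_def cong: if_cong)
        moreover have eq: "d i k = d i j" using k by (intro l(2)) auto
        ultimately have "leads L0 (\<lambda>l. if l = i then d i j else 0) (U i k)"
          by (simp only: eq)
        then show ?thesis using k(3) by (intro exI conjI)
      qed
      have approx: "\<exists>f. leads L0 (\<lambda>l. if l = i then d i j else 0) f \<and> mcoeff (U i j) e' = mcoeff f e'" for e'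
        using app [of "Suc (sum e' UNIV)"] by (force simp: adic_close_def)
      show ?thesis
        unfolding leads_def
      proof (intro conjI allI impI)
        show "mcoeff (U i j) (\<lambda>l. if l = i then d i j else 0) = 1"
          using approx unfolding leads_def by metis
        fix e' assume "mcoeff (U i j) e' \<noteq> 0"
        then show "e' = (\<lambda>l. if l = i then d i j else 0) \<or>
            lexless L0 (\<lambda>l. if l = i then d i j else 0) e'"
          using approx [of e'] unfolding leads_def by metis
      qed
    qed
    then show ?case by (simp add: q UU_def cong: if_cong)
  qed
  from this [of "(i, j)"] show "j \<le> \<alpha> i \<Longrightarrow> dfin i j \<Longrightarrow>
      leads L0 (\<lambda>l. if l = i then d i j else 0) (U i j)" by (simp add: UU_def cong: if_cong)
qed

lemma U_nonzero_iff: "j \<le> \<alpha> i \<Longrightarrow> U i j \<noteq> 0 \<longleftrightarrow> dfin i j"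
  using U_leads leads_nonzero infinite_imp_zero by blast

end

section \<open>Normal monomials\<close>

text \<open>Degrees are compared as integers because the radix lemmas are stated for ordered
  groups.\<close>

lemma nsmul_int: "nsmul r (x :: int) = int r * x"
  by (induction r) (auto simp: algebra_simps)

lemma sum_mset_count:
  assumes "finite F" "set_mset J \<subseteq> F"
  shows "(\<Sum>q\<in>#J. w q) = (\<Sum>q\<in>F. nsmul (count J q) (w q))"
  using assms(2)
proof (induction J)
  case (add x J)
  have "(\<Sum>q\<in>F. nsmul (count (add_mset x J) q) (w q)) =
      (\<Sum>q\<in>F. (if q = x then w x else 0) + nsmul (count J q) (w q))"
    by (rule sum.cong) auto
  also have "\<dots> = w x + (\<Sum>q\<in>F. nsmul (count J q) (w q))"
    using add.prems assms(1) by (simp add: sum.distrib)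
  finally show ?case using add by simp
qed simp

lemma filter_mset_replicate:
  "filter_mset P (replicate_mset r q) = (if P q then replicate_mset r q else {#})"
  by (induction r) auto

lemma finite_bounded_multisets: "finite Q \<Longrightarrow> finite {J. set_mset J \<subseteq> Q \<and> size J \<le> l}"
proof -
  assume "finite Q"
  then have "finite (mset ` {xs. set xs \<subseteq> Q \<and> length xs \<le> l})"
    by (intro finite_imageI finite_lists_length_le)
  moreover have "{J. set_mset J \<subseteq> Q \<and> size J \<le> l} \<subseteq> mset ` {xs. set xs \<subseteq> Q \<and> length xs \<le> l}"
  proof
    fix J assume "J \<in> {J. set_mset J \<subseteq> Q \<and> size J \<le> l}"
    moreover obtain xs where "mset xs = J" using ex_mset by blast
    ultimately show "J \<in> mset ` {xs. set xs \<subseteq> Q \<and> length xs \<le> l}"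
      by (intro image_eqI [of _ _ xs]) auto
  qed
  ultimately show ?thesis by (rule finite_subset [rotated])
qed

locale acceptable_skp = skp a \<beta> \<theta> \<alpha> U
  for a :: "'n::{finite,linorder} \<Rightarrow> 'o::wellorder"
    and \<beta> :: "'n \<Rightarrow> 'o \<Rightarrow> 'g::linordered_ab_group_add"
    and \<theta> :: "'n \<Rightarrow> 'o \<Rightarrow> 'k::field"
    and \<alpha> :: "'n \<Rightarrow> 'o"
    and U :: "'n \<Rightarrow> 'o \<Rightarrow> ('n, 'k) mfps" +
  fixes \<alpha>' :: "'n \<Rightarrow> 'o"
  assumes acceptable: "acceptable a \<beta> \<alpha> \<alpha>'"
begin

definition Ind :: "('n \<times> 'o) set" where
  "Ind = {q. snd q \<le> \<alpha>' (fst q) \<and> UU q \<noteq> 0}"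

text \<open>The exponent at the last index \<open>\<alpha>' i\<close> is unrestricted, even if its
  relative order is finite.\<close>

definition NF :: "('n \<times> 'o) multiset set" where
  "NF = {J. set_mset J \<subseteq> Ind \<and> (\<forall>i j. j < \<alpha>' i \<longrightarrow> count J (i, j) < n i j)}"

definition mdeg :: "('n \<times> 'o) multiset \<Rightarrow> 'n \<Rightarrow> nat" where
  "mdeg J l = (\<Sum>j\<in>#part l J. d l j)"

lemma \<alpha>'_le: "\<alpha>' i \<le> \<alpha> i"
  using acceptable by (simp add: acceptable_def)

lemma less_\<alpha>: "j < \<alpha>' i \<Longrightarrow> j < \<alpha> i"
  using \<alpha>'_le [of i] by simp

lemma less_a': "j < \<alpha>' i \<Longrightarrow> j < a i"
  using less_\<alpha> less_a by blast

lemma le_a': "j \<le> \<alpha>' i \<Longrightarrow> j \<le> a i"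
  using \<alpha>'_le \<alpha>_le by (meson order_trans)

text \<open>Infinite degree can occur only at \<open>\<alpha> i\<close>, so at most the last key
  polynomial of a variable is missing from \<open>Ind\<close>.\<close>

lemma dfin_less: "j < \<alpha>' i \<Longrightarrow> dfin i j"
  using least_infinite(1) [OF finite_low_order, of i j] less_\<alpha> [of j i] by fastforce

lemma Ind_iff: "(i, j) \<in> Ind \<longleftrightarrow> j \<le> \<alpha>' i \<and> dfin i j"
  using U_nonzero_iff [of j i] order_trans [OF _ \<alpha>'_le, of j i] by (auto simp: Ind_def UU_def)

lemma Ind_less: "j < \<alpha>' i \<Longrightarrow> (i, j) \<in> Ind"
  by (simp add: Ind_iff dfin_less)

lemma Ind_D: "q \<in> Ind \<Longrightarrow> snd q \<le> \<alpha>' (fst q)" "q \<in> Ind \<Longrightarrow> snd q \<le> a (fst q)"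
    "q \<in> Ind \<Longrightarrow> dfin (fst q) (snd q)"
  using Ind_iff [of "fst q" "snd q"] le_a' by auto

lemma M_Ind: "j < \<alpha>' i \<Longrightarrow> set_mset (M i j) \<subseteq> Ind"
proof
  fix q assume j: "j < \<alpha>' i" and q: "q \<in># M i j"
  have "fst q < i \<or> fst q = i \<and> snd q < j"
    using M_below [OF less_a' [OF j] q] by (auto simp: less_prod_def')
  moreover have "q \<in> value_supp a \<beta> i j" using q set_M [OF less_a' [OF j]] by simp
  ultimately have "snd q \<le> \<alpha>' (fst q)"
    using acceptable j unfolding acceptable_def by (cases q) fastforce
  then show "q \<in> Ind"
    using U_supp(2) [OF less_\<alpha> [OF j] q] by (simp add: Ind_def)
qed

lemma mdeg_empty [simp]: "mdeg {#} l = 0"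
  by (simp add: mdeg_def)

lemma mdeg_add [simp]: "mdeg (J + K) l = mdeg J l + mdeg K l"
  by (simp add: mdeg_def)

lemma mdeg_plus: "mdeg (J + K) = mdeg J + mdeg K"
  by (simp add: fun_eq_iff)

lemma mdeg_add_mset [simp]: "mdeg (add_mset q J) l = (if l = fst q then d l (snd q) else 0) + mdeg J l"
  by (simp add: mdeg_def)

lemma mdeg_replicate [simp]:
  "mdeg (replicate_mset r q) l = (if l = fst q then r * d l (snd q) else 0)"
  by (induction r) auto

lemma mdeg_radix:
  assumes "j \<le> a i" "dfin i j" "\<And>k. k \<in># part i K \<Longrightarrow> k < j \<and> count K (i, k) < n i k"
  shows "mdeg K i < d i j"
proof -
  have "(\<Sum>k\<in>#part i K. int (d i k)) < int (d i j)"
  proof (rule radix_bound [where n = "n i"])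
    fix k l assume "k < l" "l \<le> j"
    then have "n i k * d i k \<le> d i l"
      using assms(1,2) dfin_mono by (intro d_mult_le) auto
    then show "nsmul (n i k) (int (d i k)) \<le> int (d i l)"
      by (simp add: nsmul_int flip: of_nat_mult)
  qed (use assms d_pos in auto)
  moreover have "int (mdeg K i) = (\<Sum>k\<in>#part i K. int (d i k))"
    by (simp add: mdeg_def multiset.map_comp comp_def)
  ultimately show ?thesis by simp
qed

text \<open>The digits of \<open>M i j\<close> in the variable \<open>i\<close> are bounded by the
  \<open>n i k\<close>, hence have degree below \<open>d i j\<close>, and later variables do not
  occur.\<close>

lemma mdeg_M_less:
  assumes j: "j < \<alpha>' i"
  shows "lexless L1 (mdeg (K + M i j)) (mdeg (K + replicate_mset (n i j) (i, j)))"
  unfolding mdeg_plus lexless_add_left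
proof (rule lexless_last_diff [OF sorted_L1, of i])
  note ja = less_a' [OF j]
  have "mdeg (M i j) i < d i j"
  proof (rule mdeg_radix)
    fix k assume "k \<in># part i (M i j)"
    then have k: "(i, k) \<in># M i j" by (simp flip: count_greater_zero_iff)
    then have "k < j" using M_below [OF ja k] by simp
    then show "k < j \<and> count (M i j) (i, k) < n i k"
      using count_M_less [OF ja k] ja by (simp add: N_enat)
  qed (use ja dfin_less [OF j] in auto)
  also have "\<dots> \<le> n i j * d i j" using n_pos [OF ja] by simp
  finally show "mdeg (M i j) i < mdeg (replicate_mset (n i j) (i, j)) i" by simp
  show "\<forall>l>i. mdeg (M i j) l = mdeg (replicate_mset (n i j) (i, j)) l"
  proof (intro allI impI)
    fix l assume l: "i < l"
    have "(l, k) \<notin># M i j" for k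
      using M_below [OF ja, of "(l, k)"] l by auto
    then have "part l (M i j) = {#}"
      by (auto simp: multiset_eq_iff not_in_iff)
    then show "mdeg (M i j) l = mdeg (replicate_mset (n i j) (i, j)) l"
      using l by (auto simp: mdeg_def)
  qed
qed simp

text \<open>From one index to any later one both \<open>d i\<close> and \<open>\<beta> i\<close>
  grow at least by the factor \<open>n i j\<close>, so the highest differing digit decides degrees
  and values alike.\<close>

lemma NF_less:
  assumes A: "A \<in> NF" and B': "B' \<in> NF" and less: "count A (i, p) < count B' (i, p)"
    and eq: "\<And>j. p < j \<Longrightarrow> count A (i, j) = count B' (i, j)"
  shows "mdeg A i < mdeg B' i" "(\<Sum>j\<in>#part i A. \<beta> i j) < (\<Sum>j\<in>#part i B'. \<beta> i j)"
proof -
  have "(i, p) \<in># B'" using less by (simp flip: count_greater_zero_iff)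
  then have p: "p \<le> \<alpha>' i" "dfin i p" using B' by (auto simp: NF_def Ind_iff)
  have An: "count (part i A) j < n i j" if "j < p" for j
    using A p(1) that by (auto simp: NF_def)
  have "(\<Sum>k\<in>#part i A. int (d i k)) < (\<Sum>k\<in>#part i B'. int (d i k))"
  proof (rule radix_compare [where n = "n i" and p = p])
    fix k l assume "k < l" "l \<le> p"
    then have "n i k * d i k \<le> d i l"
      using p dfin_mono le_a' by (intro d_mult_le) auto
    then show "nsmul (n i k) (int (d i k)) \<le> int (d i l)"
      by (simp add: nsmul_int flip: of_nat_mult)
  qed (use An less eq d_pos in auto)
  moreover have "int (mdeg K i) = (\<Sum>k\<in>#part i K. int (d i k))" for K
    by (simp add: mdeg_def multiset.map_comp comp_def)
  ultimately show "mdeg A i < mdeg B' i" by (metis of_nat_less_iff)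
  show "(\<Sum>j\<in>#part i A. \<beta> i j) < (\<Sum>j\<in>#part i B'. \<beta> i j)"
  proof (rule radix_compare [where n = "n i" and p = p])
    fix k l assume "k < l" "l \<le> p"
    then show "nsmul (n i k) (\<beta> i k) \<le> \<beta> i l"
      using p le_a' [of l i] by (intro less_imp_le [OF \<beta>_mono]) auto
  next
    fix k assume "k \<le> p" then show "0 < \<beta> i k" using p le_a' by (intro \<beta>_pos) auto
  qed (use An less eq in auto)
qed

lemma NF_compare:
  assumes "A \<in> NF" "B' \<in> NF" "part i A \<noteq> part i B'"
  shows "mdeg A i < mdeg B' i \<and> (\<Sum>j\<in>#part i A. \<beta> i j) < (\<Sum>j\<in>#part i B'. \<beta> i j) \<or>
    mdeg B' i < mdeg A i \<and> (\<Sum>j\<in>#part i B'. \<beta> i j) < (\<Sum>j\<in>#part i A. \<beta> i j)"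
proof -
  define D where "D = {j. count A (i, j) \<noteq> count B' (i, j)}"
  have "D \<subseteq> set_mset (part i A) \<union> set_mset (part i B')"
    by (auto simp: D_def simp flip: count_greater_zero_iff)
  then have fin: "finite D" by (rule finite_subset) simp
  have ne: "D \<noteq> {}" using assms(3) by (auto simp: D_def multiset_eq_iff)
  define p where "p = Max D"
  have "p \<in> D" unfolding p_def by (rule Max_in [OF fin ne])
  have eq: "count A (i, j) = count B' (i, j)" if "p < j" for j
    using Max_ge [OF fin, of j] that by (auto simp: p_def D_def not_le [symmetric])
  show ?thesis
    using NF_less [OF assms(1,2) _ eq] NF_less [OF assms(2,1) _ eq [symmetric]] \<open>p \<in> D\<close>
    by (auto simp: D_def neq_iff)
qed

lemma mdeg_inj: "inj_on mdeg NF"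
proof (rule inj_onI)
  fix A B' assume "A \<in> NF" "B' \<in> NF" "mdeg A = mdeg B'"
  then show "A = B'"
    using NF_compare [of A B'] by (intro multiset_eq_parts) (metis less_irrefl)
qed

section \<open>Carrying to normal monomials\<close>

definition bad :: "'n \<times> 'o \<Rightarrow> bool" where
  "bad q \<longleftrightarrow> snd q < \<alpha>' (fst q) \<and> n (fst q) (snd q) = 1"

text \<open>Trading \<open>n i j\<close> factors for one lowers the size if
  \<open>n i j \<ge> 2\<close>. If \<open>n i j = 1\<close> the size stays, but a \<open>bad\<close>
  factor is exchanged for one that is not \<open>bad\<close>.\<close>

definition meas :: "('n \<times> 'o) multiset \<Rightarrow> nat" where
  "meas J = size J + size (filter_mset bad J)"

text \<open>Passing directly to the next \<open>g\<close> with \<open>n i g \<ge> 2\<close> makes the reduction terminate: there may be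
  infinitely many \<open>k\<close> with \<open>n i k = 1\<close> between \<open>j\<close> and \<open>g\<close>.\<close>

lemma reduction_step:
  assumes J: "set_mset J \<subseteq> Ind" "J \<notin> NF"
  obtains i j g K where "J = K + replicate_mset (n i j) (i, j)" "j < \<alpha>' i" "j < g" "(i, g) \<in> Ind"
    "d i g = n i j * d i j" "meas (add_mset (i, g) K) < meas J"
proof -
  obtain i j where j: "j < \<alpha>' i" "n i j \<le> count J (i, j)"
    using J by (auto simp: NF_def not_less)
  define K where "K = J - replicate_mset (n i j) (i, j)"
  have JK: "J = K + replicate_mset (n i j) (i, j)"
    using j(2) by (simp add: K_def count_le_replicate_mset_subset_eq)
  \<comment> \<open>Targets that are never \<open>bad\<close>. The indices skipped before the first
    such \<open>g\<close> have \<open>n i l = 1\<close> and leave the degree unchanged.\<close>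
  define Q where "Q g \<longleftrightarrow> osuc j \<le> g \<and> (g = \<alpha>' i \<or> 2 \<le> n i g)" for g
  define g where "g = (LEAST g. Q g)"
  have Q\<alpha>: "Q (\<alpha>' i)" using osuc_le [OF j(1)] by (simp add: Q_def)
  have Qg: "Q g" unfolding g_def by (rule LeastI [of Q, OF Q\<alpha>])
  have g_le: "g \<le> \<alpha>' i" unfolding g_def by (rule Least_le [of Q, OF Q\<alpha>])
  have jg: "j < g" using osuc_greater [OF j(1)] Qg by (auto simp: Q_def)
  have small: "n i l < 2" if "osuc j \<le> l" "l < g" for l
    using that not_less_Least [of l Q] by (auto simp: Q_def g_def)
  have dj: "dfin i j" using dfin_less j(1) by blast
  have "osuc j \<le> g" using Qg by (simp add: Q_def)
  then have dg: "d i g = n i j * d i j" "dfin i g"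
    using d_const [of "osuc j" g i] small d_suc [OF less_a' [OF j(1)] dj] dfin_suc [OF jg dj] by auto
  have "\<not> bad (i, g)" using Qg by (auto simp: bad_def Q_def)
  moreover have "bad (i, j) \<longleftrightarrow> n i j = 1" using j(1) by (simp add: bad_def)
  moreover have "1 \<le> n i j" using n_pos [OF less_a' [OF j(1)]] .
  ultimately have "meas (add_mset (i, g) K) < meas J"
    by (subst JK) (auto simp: meas_def filter_mset_replicate)
  then show ?thesis
    using JK j(1) jg g_le dg by (intro that [of K i j g]) (auto simp: Ind_iff)
qed

lemma ex_NF: "set_mset J \<subseteq> Ind \<Longrightarrow> \<exists>I\<in>NF. mdeg I = mdeg J"
proof (induction J rule: measure_induct_rule [of meas])
  case (less J)
  show ?case
  proof (cases "J \<in> NF")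
    case False
    obtain i j g K where s: "J = K + replicate_mset (n i j) (i, j)" "j < \<alpha>' i" "j < g" "(i, g) \<in> Ind"
      "d i g = n i j * d i j" "meas (add_mset (i, g) K) < meas J"
      using reduction_step [OF less.prems False] .
    have "set_mset (add_mset (i, g) K) \<subseteq> Ind" using less.prems s by auto
    from less.IH [OF s(6) this] obtain I where "I \<in> NF" "mdeg I = mdeg (add_mset (i, g) K)" by blast
    moreover have "mdeg (add_mset (i, g) K) = mdeg J"
      using s(5) by (auto simp: fun_eq_iff s(1))
    ultimately show ?thesis by auto
  qed blast
qed

lemma first_Ind: "(i, ofirst) \<in> Ind"
  by (simp add: Ind_iff)

lemma mdeg_surj: "\<exists>I\<in>NF. mdeg I = t"
proof -
  have "\<exists>J. set_mset J \<subseteq> Ind \<and> mdeg J = (\<lambda>l. if l \<in> S then t l else 0)" if "finite S" for S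
    using that
  proof (induction S)
    case empty
    show ?case by (rule exI [of _ "{#}"]) (auto simp: fun_eq_iff)
  next
    case (insert i S)
    then obtain J where "set_mset J \<subseteq> Ind" "mdeg J = (\<lambda>l. if l \<in> S then t l else 0)" by blast
    with insert.hyps show ?case
      \<comment> \<open>A power of \<open>X_i\<close> supplies the missing degree since
        \<open>d i ofirst = 1\<close>. It may fail to be normal, which \<open>ex_NF\<close> repairs
        afterwards.\<close>
      by (intro exI [of _ "J + replicate_mset (t i) (i, ofirst)"])
         (auto simp: fun_eq_iff first_Ind split: if_splits)
  qed
  from this [OF finite [of UNIV]] ex_NF show ?thesis by auto
qed

lemma mdeg_bij: "bij_betw mdeg NF UNIV"
proof -
  have "t \<in> mdeg ` NF" for t using mdeg_surj [of t] by blast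
  with mdeg_inj show ?thesis unfolding bij_betw_def by blast
qed

section \<open>Normal monomials as a triangular basis\<close>

lemma mon_leads: "set_mset J \<subseteq> Ind \<Longrightarrow> leads L0 (mdeg J) (mon J)"
proof (induction J)
  case empty
  have "mdeg {#} = 0" by (simp add: fun_eq_iff)
  then show ?case using leads_1 by (simp only: mon_simps)
next
  case (add q J)
  have "mdeg (add_mset q J) = (\<lambda>l. if l = fst q then d (fst q) (snd q) else 0) + mdeg J"
    by (auto simp: fun_eq_iff)
  moreover have "leads L0 (mdeg J) (mon J)" using add by simp
  moreover have "leads L0 (\<lambda>l. if l = fst q then d (fst q) (snd q) else 0) (UU q)"
    using add.prems Ind_D [of q] \<alpha>'_le [of "fst q"] unfolding UU_def by (intro U_leads) auto
  ultimately show ?case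
    by (simp only: mon_simps leads_mult)
qed

text \<open>Low order bounds the number of factors and the order of each. A factor before the last
  index has \<open>2 \<le> n\<close>, so \<open>finite_low_order\<close> leaves finitely many
  candidates.\<close>

lemma finite_NF_low: "finite {J \<in> NF. \<not> ordge T (mon J)}"
proof -
  define Q where "Q = (\<Union>i. {i} \<times> insert (\<alpha>' i) {j. j < \<alpha> i \<and> 2 \<le> n i j \<and> \<not> ordge T (U i j)})"
  have "finite Q" using finite_low_order by (auto simp: Q_def)
  then have "finite {J. set_mset J \<subseteq> Q \<and> size J \<le> T}" by (rule finite_bounded_multisets)
  moreover have "{J \<in> NF. \<not> ordge T (mon J)} \<subseteq> {J. set_mset J \<subseteq> Q \<and> size J \<le> T}"
  proof clarify
    fix J assume J: "J \<in> NF" "\<not> ordge T (mon J)"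
    have "set_mset J \<subseteq> Q"
    proof
      fix q assume q: "q \<in># J"
      then have "q \<in> Ind" using J(1) by (auto simp: NF_def)
      then have le: "snd q \<le> \<alpha>' (fst q)" by (rule Ind_D)
      show "q \<in> Q"
      proof (cases "snd q = \<alpha>' (fst q)")
        case True
        then show ?thesis by (cases q) (auto simp: Q_def)
      next
        case False
        then have lt: "snd q < \<alpha>' (fst q)" using le by simp
        then have "count J q < n (fst q) (snd q)"
          using J(1) by (cases q) (auto simp: NF_def)
        moreover have "0 < count J q" using q by simp
        ultimately have "2 \<le> n (fst q) (snd q)" by linarith
        then show ?thesis
          using mon_ordge_factor [OF q] J(2) less_\<alpha> [OF lt] by (cases q) (auto simp: Q_def UU_def)
      qed
    qed
    moreover have "size J \<le> T"
    proof (rule ccontr)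
      assume "\<not> size J \<le> T"
      moreover have "snd q \<le> \<alpha> (fst q)" if "q \<in># J" for q
        using that J(1) Ind_D(1) [of q] \<alpha>'_le [of "fst q"] by (auto simp: NF_def)
      ultimately have "ordge T (mon J)"
        by (intro ordge_mono [OF mon_ordge_size]) auto
      with J(2) show False by simp
    qed
    ultimately show "set_mset J \<subseteq> Q \<and> size J \<le> T" by simp
  qed
  ultimately show ?thesis by (rule finite_subset [rotated])
qed

text \<open>The passage between the exponent functions of the definitions and the multisets used in
  computations.\<close>

lemma adic_index_iff: "adic_index a \<beta> U \<alpha>' I \<longleftrightarrow> (\<exists>J\<in>NF. I = count J)"
proof
  assume I: "adic_index a \<beta> U \<alpha>' I"
  then have "finite {q. 0 < I q}" by (simp add: adic_index_def)
  then have c: "count (Abs_multiset I) = I" by (simp add: Abs_multiset_inverse)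
  have "set_mset (Abs_multiset I) \<subseteq> Ind"
  proof
    fix q assume "q \<in># Abs_multiset I"
    then have "I q \<noteq> 0" by (simp add: c flip: count_greater_zero_iff)
    then show "q \<in> Ind"
      using I by (cases q) (auto simp: adic_index_def Ind_def UU_def)
  qed
  moreover have "I (i, j) < n i j" if "j < \<alpha>' i" for i j
  proof -
    have "enat (I (i, j)) < rel_order a \<beta> i j" using I that by (simp add: adic_index_def)
    then show ?thesis by (simp add: n_finite [OF less_a' [OF that]])
  qed
  ultimately have "Abs_multiset I \<in> NF" by (simp add: NF_def c)
  with c show "\<exists>J\<in>NF. I = count J" by metis
next
  assume "\<exists>J\<in>NF. I = count J"
  then obtain J where J: "J \<in> NF" "I = count J" by blast
  have "j \<le> \<alpha>' i \<and> U i j \<noteq> 0" if "I (i, j) \<noteq> 0" for i j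
  proof -
    have "(i, j) \<in># J" using that J(2) by (simp flip: count_greater_zero_iff)
    then show ?thesis using J(1) by (auto simp: NF_def Ind_def UU_def)
  qed
  moreover have "finite {q. I q \<noteq> 0}" by (simp add: J(2))
  ultimately show "adic_index a \<beta> U \<alpha>' I"
    using J n_finite [OF less_a'] by (auto simp: adic_index_def NF_def)
qed

lemma support_count: "{(i, j). count J (i, j) \<noteq> 0} = set_mset J"
  by (auto simp flip: count_greater_zero_iff)

lemma key_monomial_count [simp]: "key_monomial U (count J) = mon J"
  unfolding key_monomial_def support_count
  by (simp add: mon_def image_prod_mset_multiplicity UU_def case_prod_unfold)

lemma monomial_value_count: "monomial_value \<beta> (count J) = (\<Sum>q\<in>#J. B q)"
  unfolding monomial_value_def support_count
  by (simp add: sum_mset_count [of "set_mset J"] B_def case_prod_unfold)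

sublocale triangular_basis L0 "{I. adic_index a \<beta> U \<alpha>' I}" "key_monomial U" "\<lambda>I. mdeg (Abs_multiset I)"
proof
  have eq: "{I. adic_index a \<beta> U \<alpha>' I} = count ` NF" by (auto simp: adic_index_iff)
  have "bij_betw (\<lambda>I. Abs_multiset I) (count ` NF) NF"
    by (rule bij_betwI [where g = count]) (auto simp: count_inverse)
  from bij_betw_trans [OF this mdeg_bij]
  show "bij_betw (\<lambda>I. mdeg (Abs_multiset I)) {I. adic_index a \<beta> U \<alpha>' I} UNIV"
    by (simp add: eq comp_def)
  show "leads L0 (mdeg (Abs_multiset I)) (key_monomial U I)" if "I \<in> {I. adic_index a \<beta> U \<alpha>' I}" for I
    using that mon_leads by (auto simp: adic_index_iff count_inverse NF_def)
  have "{x \<in> {I. adic_index a \<beta> U \<alpha>' I}. \<not> ordge T (key_monomial U x)} =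
      count ` {J \<in> NF. \<not> ordge T (mon J)}" for T
    by (auto simp: adic_index_iff)
  then show "finite {x \<in> {I. adic_index a \<beta> U \<alpha>' I}. \<not> ordge T (key_monomial U x)}" for T
    using finite_NF_low by simp
qed

lemma adic_expansion_eq: "adic_expansion a \<beta> U \<alpha>' f = cf f"
  unfolding adic_expansion_def is_adic_expansion_def cf_def expands_def by simp

end

section \<open>Values of arbitrary monomials\<close>

text \<open>Refined values live in a lexicographic product: the first component is the true value,
  the second is infinitesimal against it.\<close>

instance prod :: (linordered_ab_group_add, linordered_ab_group_add) linordered_ab_group_add
  by standard (auto simp: less_eq_prod_def)

lemma fst_less_imp_less: "fst x < fst y \<Longrightarrow> x < y"
  for x y :: "'a::linorder \<times> 'b::linorder"
  by (simp add: less_prod_def)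

lemma fst_nsmul [simp]: "fst (nsmul r x) = nsmul r (fst x)"
  by (induction r) auto

lemma fst_sum_mset: "fst (\<Sum>q\<in>#J. w q) = (\<Sum>q\<in>#J. fst (w q))"
  by (induction J) auto

text \<open>Dickson's lemma, by passing to subsequences that make one more coordinate nondecreasing
  at a time. It stands in for a well-ordering of values.\<close>

lemma dickson:
  fixes x :: "nat \<Rightarrow> 'n::finite \<Rightarrow> nat"
  shows "\<exists>i j. i < j \<and> (\<forall>l. x i l \<le> x j l)"
proof -
  have "\<exists>r :: nat \<Rightarrow> nat. strict_mono r \<and> (\<forall>l\<in>S. mono (\<lambda>k. x (r k) l))" if "finite S" for S :: "'n set"
    using that
  proof (induction S)
    case empty
    show ?case by (rule exI [of _ id]) (simp add: strict_mono_def)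
  next
    case (insert i S)
    then obtain r :: "nat \<Rightarrow> nat" where r: "strict_mono r" "\<And>l. l \<in> S \<Longrightarrow> mono (\<lambda>k. x (r k) l)" by blast
    obtain f :: "nat \<Rightarrow> nat" where f: "strict_mono f" "monoseq (\<lambda>k. x (r (f k)) i)"
      using seq_monosub [of "\<lambda>k. x (r k) i"] by blast
    \<comment> \<open>A nonincreasing sequence of naturals is constant from the place where its
      minimum is attained; the earlier terms are dropped.\<close>
    obtain k0 where k0: "mono (\<lambda>k. x (r (f (k + k0))) i)"
    proof (cases "\<forall>m. \<forall>k\<ge>m. x (r (f m)) i \<le> x (r (f k)) i")
      case True
      then show ?thesis by (intro that [of 0]) (simp add: mono_def)
    next
      case False
      then have dec: "\<forall>m. \<forall>k\<ge>m. x (r (f k)) i \<le> x (r (f m)) i"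
        using f(2) by (auto simp: monoseq_def)
      define v where "v = (LEAST v. \<exists>k. x (r (f k)) i = v)"
      have "\<exists>k. x (r (f k)) i = v" unfolding v_def by (rule LeastI_ex) blast
      then obtain k0 where k0: "x (r (f k0)) i = v" by blast
      have "v \<le> x (r (f k)) i" for k unfolding v_def by (rule Least_le) blast
      then have "x (r (f (k + k0))) i = v" for k
        using dec k0 by (metis le_add2 antisym)
      then show ?thesis by (intro that [of k0]) (simp add: mono_def)
    qed
    show ?case
    proof (intro exI [of _ "\<lambda>k. r (f (k + k0))"] conjI ballI)
      show "strict_mono (\<lambda>k. r (f (k + k0)))"
        using r(1) f(1) by (auto simp: strict_mono_def)
      fix l assume "l \<in> insert i S"
      then show "mono (\<lambda>k. x (r (f (k + k0))) l)"
      proof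
        assume "l \<in> S"
        from r(2) [OF this] show ?thesis
          using f(1) by (auto simp: mono_def strict_mono_less_eq)
      qed (use k0 in simp)
    qed
  qed
  from this [OF finite [of UNIV]] obtain r :: "nat \<Rightarrow> nat" where
    r: "strict_mono r" "\<And>l. mono (\<lambda>k. x (r k) l)" by auto
  have "r 0 < r 1" using r(1) by (simp add: strict_mono_def)
  moreover have "x (r 0) l \<le> x (r 1) l" for l using r(2) [of l] by (auto simp: mono_def)
  ultimately show ?thesis by blast
qed

text \<open>Only the first component and the relations of the recursion are prescribed. The second
  component is the freedom that later separates normal monomials.\<close>

locale valued_skp = acceptable_skp a \<beta> \<theta> \<alpha> U \<alpha>'
  for a :: "'n::{finite,linorder} \<Rightarrow> 'o::wellorder"
    and \<beta> :: "'n \<Rightarrow> 'o \<Rightarrow> 'g::linordered_ab_group_add"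
    and \<theta> :: "'n \<Rightarrow> 'o \<Rightarrow> 'k::field"
    and \<alpha> :: "'n \<Rightarrow> 'o"
    and U :: "'n \<Rightarrow> 'o \<Rightarrow> ('n, 'k) mfps"
    and \<alpha>' :: "'n \<Rightarrow> 'o" +
  fixes w :: "'n \<times> 'o \<Rightarrow> 'g \<times> 'r::linordered_ab_group_add"
  assumes fst_w: "fst (w q) = B q"
    and w_rel: "j < \<alpha>' i \<Longrightarrow> (\<Sum>q\<in>#M i j. w q) = nsmul (n i j) (w (i, j))"
begin

definition wt :: "('n \<times> 'o) multiset \<Rightarrow> 'g \<times> 'r" where
  "wt J = (\<Sum>q\<in>#J. w q)"

lemma wt_simps [simp]:
  "wt {#} = 0" "wt (add_mset q J) = w q + wt J" "wt (J + K) = wt J + wt K"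
  "wt (replicate_mset r q) = nsmul r (w q)"
  by (simp_all add: wt_def sum_mset_replicate)

lemma fst_wt: "fst (wt J) = (\<Sum>q\<in>#J. B q)"
  by (simp add: wt_def fst_sum_mset fst_w)

definition Fil :: "'g \<times> 'r \<Rightarrow> ('n, 'k) mfps set" where
  "Fil \<gamma> = supported {I. \<gamma> \<le> wt (Abs_multiset I)}"

lemma Fil_mono: "f \<in> Fil \<gamma> \<Longrightarrow> \<delta> \<le> \<gamma> \<Longrightarrow> f \<in> Fil \<delta>"
  unfolding Fil_def by (erule supported_mono) auto

lemma Fil_0 [simp]: "0 \<in> Fil \<gamma>"
  by (simp add: Fil_def)

lemma Fil_add: "f \<in> Fil \<gamma> \<Longrightarrow> g \<in> Fil \<gamma> \<Longrightarrow> f + g \<in> Fil \<gamma>"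
  unfolding Fil_def by (rule supported_add)

lemma Fil_smult: "f \<in> Fil \<gamma> \<Longrightarrow> mconst c * f \<in> Fil \<gamma>"
  unfolding Fil_def by (rule supported_smult)

lemma Fil_sum: "(\<And>x. x \<in> F \<Longrightarrow> g x \<in> Fil \<gamma>) \<Longrightarrow> (\<Sum>x\<in>F. g x) \<in> Fil \<gamma>"
  unfolding Fil_def by (rule supported_sum)

lemma Fil_closed: "(\<And>T. \<exists>g\<in>Fil \<gamma>. adic_close T g f) \<Longrightarrow> f \<in> Fil \<gamma>"
  unfolding Fil_def by (rule supported_closed)

lemma w_suc: "j < \<alpha>' i \<Longrightarrow> nsmul (n i j) (w (i, j)) < w (i, osuc j)"
  using \<beta>_step [OF less_a', of j i] by (intro fst_less_imp_less) (simp add: fst_w B_def)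

lemma d_quot: "j \<le> k \<Longrightarrow> k \<le> a i \<Longrightarrow> dfin i k \<Longrightarrow> \<exists>r. d i k = r * d i j"
  using d_dvd [of j k i] by (metis dvdE mult.commute)

text \<open>A successor multiplies the degree by exactly \<open>n i x\<close> and the value by more.
  At a limit the degree is already reached at some \<open>x < k\<close>, and values still increase
  from \<open>x\<close> to \<open>k\<close>.\<close>

lemma \<beta>_mult:
  "j < k \<Longrightarrow> k \<le> a i \<Longrightarrow> dfin i k \<Longrightarrow> d i k = r * d i j \<Longrightarrow> nsmul r (\<beta> i j) < \<beta> i k"
proof (induction k arbitrary: r rule: less_induct)
  case (less k)
  show ?case
  proof (cases k rule: ordinal_cases)
    case first
    then show ?thesis using less.prems(1) by simp
  next
    case (suc x)
    have x: "x < a i" "dfin i x" using suc less.prems dfin_mono [OF less.prems(3), of x] by auto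
    have jx: "j \<le> x" using less.prems(1) suc by (auto intro: less_osucD)
    obtain r0 where r0: "d i x = r0 * d i j"
      using d_quot [OF jx less_imp_le [OF x(1)] x(2)] by blast
    have "r * d i j = (n i x * r0) * d i j"
      using less.prems(4) d_suc [OF x] r0 by (auto simp: suc)
    then have r: "r = n i x * r0" using d_pos [of i j] by simp
    have "nsmul r0 (\<beta> i j) \<le> \<beta> i x"
    proof (cases "j = x")
      case True
      then have "r0 = 1" using r0 d_pos [of i j] by simp
      then show ?thesis using True by simp
    next
      case False
      then show ?thesis
        using jx x suc r0 by (intro less_imp_le [OF less.IH]) auto
    qed
    then have "nsmul r (\<beta> i j) \<le> nsmul (n i x) (\<beta> i x)"
      unfolding r nsmul_mult by (rule nsmul_mono)
    also have "\<dots> < \<beta> i k" using \<beta>_step [OF x(1)] suc by simp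
    finally show ?thesis .
  next
    case limit
    obtain l where l: "j \<le> l" "l < k" "\<And>m. l \<le> m \<Longrightarrow> m \<le> k \<Longrightarrow> d i m = d i k"
      using d_limit_const [OF limit less.prems(3,1)] by metis
    define x where "x = osuc l"
    have x: "l < x" "x < k"
      unfolding x_def using osuc_greater [OF l(2)] olimit_osuc [OF limit l(2)] by auto
    have "d i x = d i k" using x by (intro l(3)) auto
    then have "nsmul r (\<beta> i j) < \<beta> i x"
      using x l less.prems dfin_mono [OF less.prems(3), of x] by (intro less.IH) auto
    also have "\<dots> < \<beta> i k" using x less.prems by (intro \<beta>_strict_mono) auto
    finally show ?thesis .
  qed
qed

text \<open>For \<open>j < k\<close> the inequality is strict in the first component, so no choice
  of second components can reverse it.\<close>

lemma w_mult:
  assumes "j \<le> k" "(i, k) \<in> Ind" "d i k = r * d i j"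
  shows "nsmul r (w (i, j)) \<le> w (i, k)"
proof (cases "j = k")
  case True
  then have "r = 1" using assms(3) d_pos [of i k] by simp
  then show ?thesis using True by simp
next
  case False
  then have "nsmul r (\<beta> i j) < \<beta> i k"
    using assms Ind_D [OF assms(2)] by (intro \<beta>_mult) auto
  then show ?thesis
    by (intro less_imp_le fst_less_imp_less) (simp add: fst_w B_def)
qed

text \<open>The transfinite telescoping step: replacing \<open>U i j ^ r\<close> by \<open>U i j'\<close> of the same degree
  changes a monomial only by terms of smaller multidegree whose values are not smaller.\<close>

lemma replace_in_Fil:
  assumes IH: "\<And>J. set_mset J \<subseteq> Ind \<Longrightarrow> lexless L1 (mdeg J) t \<Longrightarrow> mon J \<in> Fil (wt J)"
  shows "(i, j') \<in> Ind \<Longrightarrow> j \<le> j' \<Longrightarrow> set_mset K \<subseteq> Ind \<Longrightarrow> d i j' = r * d i j \<Longrightarrow>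
    mdeg (K + replicate_mset r (i, j)) = t \<Longrightarrow>
    mon K * (UU (i, j) ^ r - UU (i, j')) \<in> Fil (wt K + nsmul r (w (i, j)))"
proof (induction j' arbitrary: K r rule: less_induct)
  case (less j')
  have j': "j' \<le> \<alpha>' i" "dfin i j'" using less.prems(1) by (auto simp: Ind_iff)
  show ?case
  proof (cases "j = j'")
    case True
    then have "r = 1" using less.prems(4) d_pos [of i j] by simp
    then show ?thesis using True by simp
  next
    case False
    then have jj': "j < j'" using less.prems(2) by simp
    then have jInd: "(i, j) \<in> Ind" using j'(1) by (intro Ind_less) auto
    show ?thesis
    proof (cases j' rule: ordinal_cases)
      case first
      then show ?thesis using jj' by simp
    next
      case (suc x)
      have x: "x < \<alpha>' i" using suc j' by auto
      then have xInd: "(i, x) \<in> Ind" by (rule Ind_less)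
      have jx: "j \<le> x" using jj' suc by (auto intro: less_osucD)
      define m where "m = n i x"
      obtain r0 where r0: "d i x = r0 * d i j"
        using d_quot [OF jx less_imp_le [OF less_a' [OF x]] dfin_less [OF x]] by blast
      have dj': "d i j' = m * d i x"
        using d_suc [OF less_a' [OF x] dfin_less [OF x]] by (simp add: suc m_def)
      have "r * d i j = (r0 * m) * d i j"
        using less.prems(4) dj' r0 by auto
      then have r: "r = r0 * m" using d_pos [of i j] by simp
      have wx: "nsmul r0 (w (i, j)) \<le> w (i, x)" by (rule w_mult [OF jx xInd r0])
      define A where "A = UU (i, j)"
      define Y where "Y = UU (i, x)"
      have Uj': "UU (i, j') = Y ^ m - mconst (\<theta> i x) * mon (M i x)"
        using U_suc [OF less_\<alpha> [OF x]] by (simp add: UU_def Y_def suc m_def)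
      have "mon K * (A ^ r - UU (i, j')) =
          mon K * ((A ^ r0) ^ m - Y ^ m) + mconst (\<theta> i x) * mon (K + M i x)"
        unfolding Uj' r power_mult by (simp add: algebra_simps)
      \<comment> \<open>The factorization leaves only replacements of \<open>j\<close> by the
        smaller index \<open>x\<close>, covered by the induction on \<open>j'\<close> once the
        cofactors join \<open>K\<close>. Only the term with \<open>M i x\<close> has smaller
        multidegree and needs \<open>IH\<close>.\<close>
      also have "(A ^ r0) ^ m - Y ^ m = (A ^ r0 - Y) * (\<Sum>p<m. Y ^ (m - Suc p) * (A ^ r0) ^ p)"
        by (rule power_diff_sumr2)
      also have "mon K * \<dots> =
          (\<Sum>p<m. mon (K + replicate_mset (m - Suc p) (i, x) + replicate_mset (r0 * p) (i, j)) * (A ^ r0 - Y))"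
        by (simp only: mon_simps power_mult sum_distrib_left A_def Y_def) (simp add: mult_ac)
      also have "\<dots> + mconst (\<theta> i x) * mon (K + M i x) \<in> Fil (wt K + nsmul r (w (i, j)))"
      proof (intro Fil_add Fil_sum Fil_smult)
        fix p assume "p \<in> {..<m}"
        then obtain s where s: "m = Suc p + s" by (auto dest: less_imp_Suc_add)
        define K' where "K' = K + replicate_mset s (i, x) + replicate_mset (r0 * p) (i, j)"
        have K'Ind: "set_mset K' \<subseteq> Ind"
          using less.prems(3) xInd jInd by (auto simp: K'_def split: if_splits)
        have "mdeg (K' + replicate_mset r0 (i, j)) = t"
        proof -
          have "s * (r0 * d i j) + r0 * p * d i j + r0 * d i j = r * d i j"
            by (simp add: r s algebra_simps)
          then have "mdeg (K' + replicate_mset r0 (i, j)) = mdeg (K + replicate_mset r (i, j))"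
            by (auto simp: fun_eq_iff K'_def r0)
          then show ?thesis using less.prems(5) by simp
        qed
        then have "mon K' * (A ^ r0 - Y) \<in> Fil (wt K' + nsmul r0 (w (i, j)))"
          unfolding A_def Y_def using suc xInd jx K'Ind r0 by (intro less.IH) auto
        moreover have "wt K + nsmul r (w (i, j)) \<le> wt K' + nsmul r0 (w (i, j))"
        proof -
          have "nsmul r (w (i, j)) = nsmul s (nsmul r0 (w (i, j))) + nsmul (r0 * p) (w (i, j)) + nsmul r0 (w (i, j))"
            by (simp add: r s algebra_simps flip: nsmul_add nsmul_mult)
          moreover have "nsmul s (nsmul r0 (w (i, j))) \<le> nsmul s (w (i, x))"
            using wx by (rule nsmul_mono)
          ultimately show ?thesis by (simp add: K'_def add.assoc)
        qed
        ultimately show "mon (K + replicate_mset (m - Suc p) (i, x) + replicate_mset (r0 * p) (i, j)) * (A ^ r0 - Y)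
            \<in> Fil (wt K + nsmul r (w (i, j)))"
          unfolding K'_def s by (auto intro: Fil_mono)
      next
        have "mdeg (K + replicate_mset (n i x) (i, x)) = mdeg (K + replicate_mset r (i, j))"
          by (auto simp: fun_eq_iff r0 r m_def)
        then have "lexless L1 (mdeg (K + M i x)) t"
          using mdeg_M_less [OF x, of K] less.prems(5) by simp
        then have "mon (K + M i x) \<in> Fil (wt (K + M i x))"
          using less.prems(3) M_Ind [OF x] by (intro IH) auto
        moreover have "wt (K + M i x) = wt K + nsmul m (w (i, x))"
          using w_rel [OF x] by (simp add: wt_def m_def)
        moreover have "nsmul r (w (i, j)) \<le> nsmul m (w (i, x))"
          unfolding r mult.commute [of r0] nsmul_mult using wx by (rule nsmul_mono)
        ultimately show "mon (K + M i x) \<in> Fil (wt K + nsmul r (w (i, j)))"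
          by (auto intro: Fil_mono)
      qed
      finally show ?thesis by (simp add: A_def)
    next
      case limit
      \<comment> \<open>From \<open>l\<close> on the degree equals \<open>d i j'\<close>, so the
        same exponent \<open>r\<close> serves for every approximating \<open>k\<close>.\<close>
      obtain l where l: "j \<le> l" "l < j'" "\<And>m. l \<le> m \<Longrightarrow> m \<le> j' \<Longrightarrow> d i m = d i j'"
        using d_limit_const [OF limit j'(2) jj'] by metis
      show ?thesis
      proof (rule Fil_closed)
        fix T
        obtain k where k: "l \<le> k" "k < j'" "adic_close T (U i k) (U i j')"
          using limit_adic_close [OF limit _ l(2), of i T] j'(1) \<alpha>'_le by (metis order_trans)
        have "mon K * (UU (i, j) ^ r - UU (i, k)) \<in> Fil (wt K + nsmul r (w (i, j)))"
        proof (rule less.IH)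
          show "(i, k) \<in> Ind" using k j' by (intro Ind_less) auto
          show "d i k = r * d i j" using l(3) [of k] k less.prems(4) by simp
        qed (use k l less.prems in auto)
        moreover have "adic_close T (mon K * (UU (i, j) ^ r - UU (i, k))) (mon K * (UU (i, j) ^ r - UU (i, j')))"
          using k(3) by (intro adic_close_mult adic_close_diff) (auto simp: UU_def)
        ultimately show "\<exists>g\<in>Fil (wt K + nsmul r (w (i, j))).
            adic_close T g (mon K * (UU (i, j) ^ r - UU (i, j')))" by blast
      qed
    qed
  qed
qed

text \<open>The outer induction handles the terms arising from \<open>M i j\<close>, of smaller
  multidegree. The jump to \<open>U i g\<close> keeps the multidegree, so an inner induction on
  \<open>meas\<close> is needed.\<close>

lemma mon_in_Fil: "set_mset J \<subseteq> Ind \<Longrightarrow> mon J \<in> Fil (wt J)"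
proof (induction "mdeg J" arbitrary: J rule: wfp_induct_rule [OF wfp_lexless [of L1]])
  case outer: (1 J)
  have "set_mset J' \<subseteq> Ind \<Longrightarrow> mdeg J' = mdeg J \<Longrightarrow> mon J' \<in> Fil (wt J')" for J'
  proof (induction J' rule: measure_induct_rule [of meas])
    case (less J')
    show ?case
    proof (cases "J' \<in> NF")
      case True
      then have "key_monomial U (count J') \<in> supported {I. wt J' \<le> wt (Abs_multiset I)}"
        by (intro supported_P) (auto simp: adic_index_iff count_inverse)
      then show ?thesis by (simp add: Fil_def)
    next
      case False
      obtain i j g K where s: "J' = K + replicate_mset (n i j) (i, j)" "j < \<alpha>' i" "j < g" "(i, g) \<in> Ind"
        "d i g = n i j * d i j" "meas (add_mset (i, g) K) < meas J'"
        using reduction_step [OF less.prems(1) False] .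
      have K: "set_mset K \<subseteq> Ind" using less.prems(1) s(1) by auto
      have IH: "mon J0 \<in> Fil (wt J0)" if "set_mset J0 \<subseteq> Ind" "lexless L1 (mdeg J0) (mdeg J)" for J0
        using outer.hyps that by blast
      have "mon K * (UU (i, j) ^ n i j - UU (i, g)) \<in> Fil (wt K + nsmul (n i j) (w (i, j)))"
        by (rule replace_in_Fil [where t = "mdeg J", OF IH s(4) less_imp_le [OF s(3)] K s(5)])
          (use less.prems(2) in \<open>simp_all only: s(1)\<close>)
      moreover have "mon (add_mset (i, g) K) \<in> Fil (wt (add_mset (i, g) K))"
      proof (rule less.IH [OF s(6)])
        show "set_mset (add_mset (i, g) K) \<subseteq> Ind" using K s(4) by auto
        have "mdeg (add_mset (i, g) K) = mdeg J'"
          using s(5) by (auto simp: fun_eq_iff s(1))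
        then show "mdeg (add_mset (i, g) K) = mdeg J" using less.prems(2) by simp
      qed
      then have "mon (add_mset (i, g) K) \<in> Fil (wt K + nsmul (n i j) (w (i, j)))"
        by (rule Fil_mono) (use w_mult [OF _ s(4,5)] s(3) in \<open>simp add: add.commute\<close>)
      ultimately have "mon K * (UU (i, j) ^ n i j - UU (i, g)) + mon (add_mset (i, g) K) \<in>
          Fil (wt K + nsmul (n i j) (w (i, j)))" by (rule Fil_add)
      moreover have "mon K * (UU (i, j) ^ n i j - UU (i, g)) + mon (add_mset (i, g) K) = mon J'"
        by (simp add: s(1) algebra_simps)
      ultimately show ?thesis by (simp add: s(1))
    qed
  qed
  from this [OF outer.prems refl] show ?case .
qed

text \<open>One successor step suffices here: the term with \<open>U i (osuc j)\<close> has strictly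
  larger weight and is settled by \<open>mon_in_Fil\<close>. Only the term with
  \<open>M i j\<close>, of equal weight and smaller multidegree, is pursued, and \<open>c\<close>
  collects the constants \<open>\<theta>\<close>.\<close>

lemma mon_initial:
  "set_mset J \<subseteq> Ind \<Longrightarrow> \<exists>I\<in>NF. \<exists>c. c \<noteq> 0 \<and> wt I = wt J \<and>
    mon J - mconst c * mon I \<in> supported {I. wt J < wt (Abs_multiset I)}"
proof (induction "mdeg J" arbitrary: J rule: wfp_induct_rule [OF wfp_lexless [of L1]])
  case (1 J)
  show ?case
  proof (cases "J \<in> NF")
    case True
    then show ?thesis by (intro bexI [of _ J] exI [of _ 1]) auto
  next
    case False
    obtain i j g K where s: "J = K + replicate_mset (n i j) (i, j)" "j < \<alpha>' i"
      using reduction_step [OF "1.prems" False] by metis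
    have K: "set_mset K \<subseteq> Ind" using "1.prems" s(1) by auto
    have oInd: "(i, osuc j) \<in> Ind"
      using osuc_le [OF s(2)] dfin_suc [OF s(2) dfin_less [OF s(2)]] by (simp add: Ind_iff)
    have wt_eq: "wt (K + M i j) = wt J"
      using w_rel [OF s(2)] by (simp add: wt_def s(1) sum_mset_replicate)
    have "lexless L1 (mdeg (K + M i j)) (mdeg J)"
      unfolding s(1) by (rule mdeg_M_less [OF s(2)])
    then obtain I c where I: "I \<in> NF" "c \<noteq> 0" "wt I = wt J"
      "mon (K + M i j) - mconst c * mon I \<in> supported {I. wt J < wt (Abs_multiset I)}"
      using "1.hyps" [of "K + M i j"] K M_Ind [OF s(2)] wt_eq by auto
    have U: "UU (i, j) ^ n i j = UU (i, osuc j) + mconst (\<theta> i j) * mon (M i j)"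
      using U_suc [OF less_\<alpha> [OF s(2)]] by (simp add: UU_def)
    have "mon J - mconst (\<theta> i j * c) * mon I =
        mon (add_mset (i, osuc j) K) + mconst (\<theta> i j) * (mon (K + M i j) - mconst c * mon I)"
      by (simp add: s(1) U mconst_mult algebra_simps)
    also have "\<dots> \<in> supported {I. wt J < wt (Abs_multiset I)}"
    proof (intro supported_add supported_smult I(4))
      have "mon (add_mset (i, osuc j) K) \<in> Fil (wt (add_mset (i, osuc j) K))"
        using K oInd by (intro mon_in_Fil) auto
      moreover have "wt J < wt (add_mset (i, osuc j) K)"
        using w_suc [OF s(2)] by (simp add: s(1) add.commute)
      ultimately show "mon (add_mset (i, osuc j) K) \<in> supported {I. wt J < wt (Abs_multiset I)}"
        unfolding Fil_def by (elim supported_mono) auto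
    qed
    finally show ?thesis
      using I \<theta>_nonzero [OF less_\<alpha> [OF s(2)]] by (intro bexI [of _ I] exI [of _ "\<theta> i j * c"]) auto
  qed
qed

text \<open>By \<open>NF_compare\<close>, differing parts compare by value as they do by degree, and
  do so already in the first component.\<close>

lemma wt_mono_mdeg:
  assumes "A \<in> NF" "B' \<in> NF" "\<And>l. mdeg A l \<le> mdeg B' l"
  shows "wt A \<le> wt B'"
  unfolding wt_def sum_parts
proof (rule sum_mono)
  fix i
  show "(\<Sum>j\<in>#part i A. w (i, j)) \<le> (\<Sum>j\<in>#part i B'. w (i, j))"
  proof (cases "part i A = part i B'")
    case False
    then have "(\<Sum>j\<in>#part i A. \<beta> i j) < (\<Sum>j\<in>#part i B'. \<beta> i j)"
      using NF_compare [OF assms(1,2) False] assms(3) [of i] by auto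
    then show ?thesis
      by (intro less_imp_le fst_less_imp_less) (simp add: fst_sum_mset fst_w B_def)
  qed simp
qed

text \<open>A strictly decreasing sequence of weights would contain, by \<open>dickson\<close>, two
  terms with increasing multidegrees, against \<open>wt_mono_mdeg\<close>.\<close>

lemma wt_min:
  assumes "A \<subseteq> NF" "A \<noteq> {}"
  shows "\<exists>x\<in>A. \<forall>y\<in>A. wt x \<le> wt y"
proof (rule ccontr)
  assume "\<not> ?thesis"
  then have "\<forall>x\<in>A. \<exists>y\<in>A. wt y < wt x" by (auto simp: not_le)
  then obtain f where f: "\<And>x. x \<in> A \<Longrightarrow> f x \<in> A \<and> wt (f x) < wt x" by metis
  obtain x0 where x0: "x0 \<in> A" using assms(2) by blast
  define s where "s k = (f ^^ k) x0" for k
  have sA: "s k \<in> A" for k by (induction k) (auto simp: s_def x0 f)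
  have dec: "wt (s (Suc k)) < wt (s k)" for k
    using f [OF sA [of k]] by (simp add: s_def)
  obtain i j where ij: "i < j" "\<And>l. mdeg (s i) l \<le> mdeg (s j) l"
    using dickson [of "\<lambda>k. mdeg (s k)"] by blast
  have "wt (s i) \<le> wt (s j)" using sA assms(1) ij(2) by (intro wt_mono_mdeg) auto
  moreover have "wt (s j) < wt (s i)"
  proof -
    have "wt (s (i + Suc k)) < wt (s i)" for k
    proof (induction k)
      case (Suc k)
      then show ?case using dec [of "i + Suc k"] by (simp del: wt_simps)
    qed (simp add: dec)
    with ij(1) show ?thesis by (metis less_imp_Suc_add add_Suc_right)
  qed
  ultimately show False by simp
qed

lemma basis_valuationI:
  assumes "inj_on wt NF"
  shows "basis_valuation L0 {I. adic_index a \<beta> U \<alpha>' I} (key_monomial U)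
    (\<lambda>I. mdeg (Abs_multiset I)) (\<lambda>I. wt (Abs_multiset I))"
proof
  have eq: "{I. adic_index a \<beta> U \<alpha>' I} = count ` NF" by (auto simp: adic_index_iff)
  show "inj_on (\<lambda>I. wt (Abs_multiset I)) {I. adic_index a \<beta> U \<alpha>' I}"
    using assms by (auto simp: eq inj_on_def count_inverse)
  show "\<exists>x\<in>A. \<forall>y\<in>A. wt (Abs_multiset x) \<le> wt (Abs_multiset y)"
    if "A \<subseteq> {I. adic_index a \<beta> U \<alpha>' I}" "A \<noteq> {}" for A
  proof -
    have "Abs_multiset ` A \<subseteq> NF" using that(1) by (auto simp: eq count_inverse dest!: subsetD)
    from wt_min [OF this] that(2) show ?thesis by auto
  qed
  fix x y assume "x \<in> {I. adic_index a \<beta> U \<alpha>' I}" "y \<in> {I. adic_index a \<beta> U \<alpha>' I}"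
  then obtain J K where JK: "J \<in> NF" "K \<in> NF" "x = count J" "y = count K" by (auto simp: eq)
  then have "set_mset (J + K) \<subseteq> Ind" by (auto simp: NF_def)
  from mon_initial [OF this] obtain I c where I: "I \<in> NF" "c \<noteq> 0" "wt I = wt (J + K)"
    "mon (J + K) - mconst c * mon I \<in> supported {I. wt (J + K) < wt (Abs_multiset I)}" by blast
  then show "\<exists>z\<in>{I. adic_index a \<beta> U \<alpha>' I}. \<exists>c. c \<noteq> 0 \<and>
      wt (Abs_multiset z) = wt (Abs_multiset x) + wt (Abs_multiset y) \<and>
      key_monomial U x * key_monomial U y - mconst c * key_monomial U z \<in>
        supported {u. wt (Abs_multiset z) < wt (Abs_multiset u)}"
    by (intro bexI [of _ "count I"] exI [of _ c]) (auto simp: JK eq count_inverse)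
qed

end

section \<open>Perturbed values\<close>

lemma nsmul_of_nat: "nsmul r (x :: 'a::ring_1) = of_nat r * x"
  by (induction r) (auto simp: algebra_simps)

lemma snd_nsmul [simp]: "snd (nsmul r x) = nsmul r (snd x)"
  by (induction r) auto

lemma snd_sum_mset: "snd (\<Sum>q\<in>#J. w q) = (\<Sum>q\<in>#J. snd (w q))"
  by (induction J) auto

lemma lookup_sum_mset: "Poly_Mapping.lookup (\<Sum>q\<in>#J. w q) l = (\<Sum>q\<in>#J. Poly_Mapping.lookup (w q) l)"
  by (induction J) (auto simp: lookup_add)

lemma lookup_nsmul: "Poly_Mapping.lookup (nsmul r p) l = nsmul r (Poly_Mapping.lookup p l)"
  by (induction r) (auto simp: lookup_add)

lemma lookup_scale: "Poly_Mapping.lookup (Poly_Mapping.map ((*) (c :: rat)) p) l = c * Poly_Mapping.lookup p l"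
  by (simp add: Poly_Mapping.map.rep_eq when_def)

context acceptable_skp
begin

text \<open>The values of normal monomials need not be distinct, since the last key polynomial of each
  variable may have finite relative order. Giving these last key polynomials additional independent
  infinitesimal values makes them distinct.\<close>

definition shift_step :: "('n \<times> 'o \<Rightarrow> 'n \<Rightarrow>\<^sub>0 rat) \<Rightarrow> 'n \<times> 'o \<Rightarrow> 'n \<Rightarrow>\<^sub>0 rat" where
  "shift_step g q =
    (if snd q < \<alpha>' (fst q)
     then Poly_Mapping.map ((*) (1 / of_nat (n (fst q) (snd q)))) (\<Sum>p\<in>#M (fst q) (snd q). g p)
     else Poly_Mapping.single (fst q) 1)"

definition shift :: "'n \<times> 'o \<Rightarrow> 'n \<Rightarrow>\<^sub>0 rat" where
  "shift = wfrec {(p, q). p < q} shift_step"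

lemma shift_rec: "shift q = shift_step shift q"
proof -
  have "wf {(p, q). p < (q :: 'n \<times> 'o)}" using wfp_index by (simp add: wfp_def)
  from wfrec [OF this, of shift_step q]
  have "shift q = shift_step (cut shift {(p, q). p < q} q) q"
    by (simp add: shift_def)
  also have "\<dots> = shift_step shift q"
  proof (cases "snd q < \<alpha>' (fst q)")
    case True
    have "(\<Sum>p\<in>#M (fst q) (snd q). cut shift {(p, q). p < q} q p) =
        (\<Sum>p\<in>#M (fst q) (snd q). shift p)"
      using M_below [OF less_a' [OF True]]
      by (intro arg_cong [of _ _ sum_mset] image_mset_cong) (auto simp: cut_apply)
    then show ?thesis by (simp only: shift_step_def)
  qed (simp add: shift_step_def)
  finally show ?thesis .
qed

text \<open>This required relation dictates the recursion for \<open>shift\<close> and explains the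
  rational coefficients: the sum over \<open>M i j\<close> has to be divided by
  \<open>n i j\<close>.\<close>

lemma nsmul_shift:
  assumes "j < \<alpha>' i"
  shows "nsmul (n i j) (shift (i, j)) = (\<Sum>p\<in>#M i j. shift p)"
proof (rule poly_mapping_eqI)
  fix l
  have "n i j \<noteq> 0" using n_pos [OF less_a' [OF assms]] by simp
  then show "Poly_Mapping.lookup (nsmul (n i j) (shift (i, j))) l = Poly_Mapping.lookup (\<Sum>p\<in>#M i j. shift p) l"
    using assms by (subst shift_rec)
      (simp add: shift_step_def lookup_nsmul lookup_scale nsmul_of_nat)
qed

lemma shift_last: "shift (i, \<alpha>' i) = Poly_Mapping.single i 1"
  by (subst shift_rec) (simp add: shift_step_def)

text \<open>Triangularity: coordinate \<open>l\<close> is invisible to all indices of the variable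
  \<open>l\<close> except the last, and to all earlier variables.\<close>

lemma shift_nonzero:
  "Poly_Mapping.lookup (shift q) l \<noteq> 0 \<Longrightarrow> snd q \<le> \<alpha>' (fst q) \<Longrightarrow> l < fst q \<or> l = fst q \<and> snd q = \<alpha>' (fst q)"
proof (induction q rule: wfp_induct_rule [OF wfp_index])
  case (1 q)
  show ?case
  proof (cases "snd q < \<alpha>' (fst q)")
    case True
    note qa = less_a' [OF True]
    have "(\<Sum>p\<in>#M (fst q) (snd q). Poly_Mapping.lookup (shift p) l) \<noteq> 0"
      using "1.prems"(1) True
      by (subst (asm) shift_rec) (auto simp: shift_step_def lookup_scale lookup_sum_mset)
    then obtain p where p: "p \<in># M (fst q) (snd q)" "Poly_Mapping.lookup (shift p) l \<noteq> 0"
      by (metis (no_types, lifting) image_mset_cong sum_mset.neutral_const)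
    have pq: "p < q" using M_below [OF qa p(1)] by simp
    have "p \<in> Ind" using M_Ind [OF True] p(1) by blast
    then have "l < fst p \<or> l = fst p \<and> snd p = \<alpha>' (fst p)"
      using "1.IH" [OF pq p(2)] Ind_D(1) by blast
    with pq True show ?thesis by (auto simp: less_prod_def')
  next
    case False
    then have q: "q = (fst q, \<alpha>' (fst q))" using "1.prems"(2) by (cases q) auto
    then have "shift q = Poly_Mapping.single (fst q) 1" by (metis shift_last)
    then show ?thesis using "1.prems"(1) q
      by (auto simp: lookup_single when_def split: if_splits)
  qed
qed

definition perturbed :: "'n \<times> 'o \<Rightarrow> 'g \<times> ('n \<Rightarrow>\<^sub>0 rat)" where
  "perturbed q = (B q, shift q)"

sublocale valued_skp a \<beta> \<theta> \<alpha> U \<alpha>' perturbed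
proof
  show "fst (perturbed q) = B q" for q by (simp add: perturbed_def)
  fix j i assume j: "j < \<alpha>' i"
  show "(\<Sum>q\<in>#M i j. perturbed q) = nsmul (n i j) (perturbed (i, j))"
    using sum_M [OF less_a' [OF j]] nsmul_shift [OF j]
    by (intro prod_eqI) (simp_all add: fst_sum_mset snd_sum_mset perturbed_def B_def)
qed

text \<open>Consider the largest index \<open>p\<close> where the exponents differ. If
  \<open>p\<close> is last in its variable, the coordinate \<open>fst p\<close> of the shift
  isolates it. Otherwise both exponents are below the relative order and
  \<open>top_coefficient\<close> gives a contradiction.\<close>

lemma wt_inj: "inj_on wt NF"
proof (rule inj_onI, rule ccontr)
  fix A C assume A: "A \<in> NF" and C: "C \<in> NF" and eq: "wt A = wt C" and ne: "A \<noteq> C"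
  let ?F = "set_mset A \<union> set_mset C"
  define D where "D = {q. count A q \<noteq> count C q}"
  have DF: "D \<subseteq> ?F" by (auto simp: D_def simp flip: count_greater_zero_iff)
  then have fin: "finite D" by (rule finite_subset) simp
  have neD: "D \<noteq> {}" using ne by (auto simp: D_def multiset_eq_iff)
  define p where "p = Max D"
  have p: "p \<in> D" unfolding p_def by (rule Max_in [OF fin neD])
  have le_p: "q \<le> p" if "q \<in> D" for q unfolding p_def by (rule Max_ge [OF fin that])
  have FInd: "?F \<subseteq> Ind" using A C by (auto simp: NF_def)
  have pInd: "p \<in> Ind" using p DF FInd by blast
  have eq1: "(\<Sum>q\<in>?F. nsmul (count A q) (B q)) = (\<Sum>q\<in>?F. nsmul (count C q) (B q))"
    using arg_cong [OF eq, of fst] by (simp add: fst_wt sum_mset_count [of ?F])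
  show False
  proof (cases "snd p = \<alpha>' (fst p)")
    case True
    let ?l = "\<lambda>q. Poly_Mapping.lookup (shift q) (fst p)"
    have "snd (wt J) = (\<Sum>q\<in>#J. shift q)" for J
      by (simp add: wt_def snd_sum_mset perturbed_def)
    then have "(\<Sum>q\<in>#A. ?l q) = (\<Sum>q\<in>#C. ?l q)"
      using arg_cong [OF eq, of snd] by (metis lookup_sum_mset)
    then have "(\<Sum>q\<in>?F. nsmul (count A q) (?l q)) = (\<Sum>q\<in>?F. nsmul (count C q) (?l q))"
      by (simp add: sum_mset_count [of ?F])
    moreover have "(\<Sum>q\<in>?F. nsmul (count J q) (?l q)) =
        nsmul (count J p) (?l p) + (\<Sum>q\<in>?F - {p}. nsmul (count J q) (?l q))" for J
      using p DF by (intro sum.remove) auto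
    moreover have "(\<Sum>q\<in>?F - {p}. nsmul (count A q) (?l q)) = (\<Sum>q\<in>?F - {p}. nsmul (count C q) (?l q))"
    proof (rule sum.cong [OF refl])
      fix q assume q: "q \<in> ?F - {p}"
      show "nsmul (count A q) (?l q) = nsmul (count C q) (?l q)"
      proof (cases "q \<in> D")
        case qD: True
        have "q < p" using le_p [OF qD] q by auto
        then have lt: "fst q < fst p \<or> fst q = fst p \<and> snd q < snd p"
          by (simp add: less_prod_def')
        have not: "\<not> (fst p < fst q \<or> fst p = fst q \<and> snd q = \<alpha>' (fst q))"
          using lt True by (metis less_asym less_irrefl)
        have le: "snd q \<le> \<alpha>' (fst q)"
        proof (rule Ind_D(1))
          show "q \<in> Ind" using q FInd by blast
        qed
        have "?l q = 0"
        proof (rule ccontr)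
          assume "?l q \<noteq> 0"
          from shift_nonzero [OF this le] not show False by (rule notE [rotated])
        qed
        then show ?thesis by simp
      qed (simp add: D_def)
    qed
    ultimately have "nsmul (count A p) (?l p) = nsmul (count C p) (?l p)" by simp
    moreover have "shift p = Poly_Mapping.single (fst p) 1"
      using shift_last True by (metis prod.collapse)
    then have "?l p = 1" by simp
    ultimately show False using p by (simp add: nsmul_of_nat D_def)
  next
    case False
    then have lt: "snd p < \<alpha>' (fst p)" using Ind_D(1) [OF pInd] by simp
    define z where "z q = int (count A q) - int (count C q)" for q
    have zD: "{q. z q \<noteq> 0} = D" by (auto simp: z_def D_def)
    have "N p \<le> enat (nat \<bar>z p\<bar>)"
    proof (rule top_coefficient)
      show "finite {r. z r \<noteq> 0}" using fin zD by simp
      show "z p \<noteq> 0" using p zD by blast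
      show "snd r \<le> a (fst r) \<and> r \<le> p" if "z r \<noteq> 0" for r
        using that zD le_p DF FInd Ind_D(2) by blast
      have "(\<Sum>r | z r \<noteq> 0. zsmul (z r) (B r)) = (\<Sum>r\<in>?F. zsmul (z r) (B r))"
        unfolding zD using DF zD by (intro sum.mono_neutral_left) auto
      also have "\<dots> = 0"
        by (simp add: z_def zsmul_diff sum_subtractf eq1)
      finally show "(\<Sum>r | z r \<noteq> 0. zsmul (z r) (B r)) = 0" .
    qed
    moreover have "N p = enat (n (fst p) (snd p))"
      using N_enat [OF less_a' [OF lt]] by simp
    ultimately have "n (fst p) (snd p) \<le> nat \<bar>z p\<bar>" by simp
    moreover have "count A p < n (fst p) (snd p)" "count C p < n (fst p) (snd p)"
      using A C lt by (cases p; simp add: NF_def)+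
    ultimately show False by (simp add: z_def)
  qed
qed

section \<open>The map \<open>nu\<close> as first component of the refined valuation\<close>

sublocale basis_valuation L0 "{I. adic_index a \<beta> U \<alpha>' I}" "key_monomial U"
    "\<lambda>I. mdeg (Abs_multiset I)" "\<lambda>I. wt (Abs_multiset I)"
  by (rule basis_valuationI [OF wt_inj])

lemma monomial_value_eq:
  "adic_index a \<beta> U \<alpha>' I \<Longrightarrow> monomial_value \<beta> I = fst (wt (Abs_multiset I))"
  by (auto simp: adic_index_iff count_inverse monomial_value_count fst_wt)

text \<open>The order is lexicographic, so a term of minimal perturbed weight also has minimal true
  value, even when several terms attain that value.\<close>

lemma nu_initial:
  assumes "initial f I"
  shows "nu a \<beta> U \<alpha>' f = fst (wt (Abs_multiset I))"
  unfolding nu_def adic_expansion_eq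
proof (rule Least_equality)
  show "\<exists>I'. cf f I' \<noteq> 0 \<and> fst (wt (Abs_multiset I)) = monomial_value \<beta> I'"
    using assms monomial_value_eq by (intro exI [of _ I]) (auto simp: initial_def)
  fix y assume "\<exists>I'. cf f I' \<noteq> 0 \<and> y = monomial_value \<beta> I'"
  then obtain I' where I': "cf f I' \<noteq> 0" "y = monomial_value \<beta> I'" by blast
  then have "wt (Abs_multiset I) \<le> wt (Abs_multiset I')"
    using assms by (simp add: initial_def)
  then show "fst (wt (Abs_multiset I)) \<le> y"
    using I' monomial_value_eq cf_in_S [OF I'(1)] by (auto simp: less_eq_prod_def)
qed

lemma nu_mult:
  assumes "f \<noteq> 0" "g \<noteq> 0"
  shows "nu a \<beta> U \<alpha>' (f * g) = nu a \<beta> U \<alpha>' f + nu a \<beta> U \<alpha>' g"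
proof -
  obtain x y where xy: "initial f x" "initial g y" using initial_ex assms by metis
  then obtain z where "initial (f * g) z" "wt (Abs_multiset z) = wt (Abs_multiset x) + wt (Abs_multiset y)"
    using initial_mult by blast
  with xy show ?thesis by (simp add: nu_initial)
qed

lemma nu_add:
  assumes "f \<noteq> 0" "g \<noteq> 0" "f + g \<noteq> 0"
  shows "min (nu a \<beta> U \<alpha>' f) (nu a \<beta> U \<alpha>' g) \<le> nu a \<beta> U \<alpha>' (f + g)"
proof -
  obtain x y z where xyz: "initial f x" "initial g y" "initial (f + g) z"
    using initial_ex assms by metis
  from initial_add [OF this] have "wt (Abs_multiset x) \<le> wt (Abs_multiset z) \<or>
      wt (Abs_multiset y) \<le> wt (Abs_multiset z)"
    by (simp only: min_le_iff_disj)
  then show ?thesis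
    unfolding xyz [THEN nu_initial] min_le_iff_disj by (auto simp: less_eq_prod_def)
qed

lemma nu_mconst: "c \<noteq> 0 \<Longrightarrow> nu a \<beta> U \<alpha>' (mconst c) = 0"
proof -
  assume c: "c \<noteq> 0"
  \<comment> \<open>Exponent 0 satisfies the strict bounds because every \<open>n i j\<close> is at
    least 1.\<close>
  have "{#} \<in> NF"
    using n_pos [OF less_a'] by (force simp: NF_def)
  then have "initial (key_monomial U (count {#})) (count {#})"
    by (intro initial_P) (auto simp: adic_index_iff)
  from initial_smult [OF c this] have "initial (mconst c) (count {#})"
    unfolding key_monomial_count by simp
  from nu_initial [OF this] show ?thesis by (simp only: count_inverse wt_simps fst_zero)
qed

lemma ex_valuation:
  "\<exists>v :: ('n, 'k) mfps fract \<Rightarrow> 'g. k_valuation v \<and>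
     (\<forall>f. f \<noteq> 0 \<longrightarrow> v (Fract f 1) = nu a \<beta> U \<alpha>' f) \<and>
     (\<forall>f g. f \<noteq> 0 \<longrightarrow> g \<noteq> 0 \<longrightarrow> v (Fract f g) = nu a \<beta> U \<alpha>' f - nu a \<beta> U \<alpha>' g)"
proof -
  obtain v :: "('n, 'k) mfps fract \<Rightarrow> 'g" where v: "field_valuation v"
    "\<And>f g. f \<noteq> 0 \<Longrightarrow> g \<noteq> 0 \<Longrightarrow> v (Fract f g) = nu a \<beta> U \<alpha>' f - nu a \<beta> U \<alpha>' g"
    using fract_extension [of "nu a \<beta> U \<alpha>'", OF nu_mult nu_add] by blast
  have "nu a \<beta> U \<alpha>' 1 = 0" using nu_mconst [of 1] by simp
  then have v1: "v (Fract f 1) = nu a \<beta> U \<alpha>' f" if "f \<noteq> 0" for f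
    using v(2) [OF that, of 1] by simp
  have "(mconst c :: ('n, 'k) mfps) \<noteq> 0" if "c \<noteq> 0" for c
    using that by (auto simp: mconst_def mfps_eq_iff)
  then have "k_valuation v"
    unfolding k_valuation_def using v(1) v1 nu_mconst by simp
  with v(2) v1 show ?thesis by blast
qed

text \<open>The approximating monomials need not be normal: \<open>mon_in_Fil\<close> shows that
  their expansions do not lose value. This is what allows monomials taken from another acceptable
  vector.\<close>

lemma nu_ge:
  assumes "f \<noteq> 0"
    and approx: "\<And>T. \<exists>F c. adic_close T (\<Sum>J\<in>F. mconst (c J) * mon J) f \<and>
      (\<forall>J\<in>F. set_mset J \<subseteq> Ind \<and> \<gamma> \<le> (\<Sum>q\<in>#J. B q))"
  shows "\<gamma> \<le> nu a \<beta> U \<alpha>' f"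
proof -
  let ?A = "{I. \<gamma> \<le> fst (wt (Abs_multiset I))}"
  have "f \<in> supported ?A"
  proof (rule supported_closed)
    fix T
    obtain F c where F: "adic_close T (\<Sum>J\<in>F. mconst (c J) * mon J) f"
      "\<forall>J\<in>F. set_mset J \<subseteq> Ind \<and> \<gamma> \<le> (\<Sum>q\<in>#J. B q)"
      using approx [of T] by (elim exE conjE) (rule that)
    have "mon J \<in> supported ?A" if "J \<in> F" for J
    proof -
      have "mon J \<in> Fil (wt J)" using bspec [OF F(2) that] by (intro mon_in_Fil) (rule conjunct1)
      moreover have "\<gamma> \<le> fst (wt J)" using bspec [OF F(2) that] by (simp add: fst_wt)
      ultimately show ?thesis
        unfolding Fil_def by (elim supported_mono) (auto simp: less_eq_prod_def)
    qed
    then have "(\<Sum>J\<in>F. mconst (c J) * mon J) \<in> supported ?A"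
      by (intro supported_sum supported_smult)
    with F(1) show "\<exists>g\<in>supported ?A. adic_close T g f" by blast
  qed
  moreover obtain x where x: "initial f x" using initial_ex assms(1) by blast
  then have "cf f x \<noteq> 0" by (simp add: initial_def)
  ultimately show ?thesis
    by (simp add: nu_initial [OF x] supported_def)
qed

text \<open>Converse of \<open>nu_ge\<close>, from truncated expansions. Together they describe
  \<open>nu\<close> by approximations in which \<open>\<alpha>'\<close> enters only through
  \<open>Ind\<close>.\<close>

lemma nu_approx:
  assumes "f \<noteq> 0"
  shows "\<exists>F c. adic_close T (\<Sum>J\<in>F. mconst (c J) * mon J) f \<and>
      (\<forall>J\<in>F. set_mset J \<subseteq> Ind \<and> nu a \<beta> U \<alpha>' f \<le> (\<Sum>q\<in>#J. B q))"
proof -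
  obtain x where x: "initial f x" using initial_ex assms by blast
  then have "f \<in> supported {I. wt (Abs_multiset x) \<le> wt (Abs_multiset I)}"
    by (auto simp: supported_def initial_def)
  from supported_approx [OF this] obtain F where F: "finite F"
    "F \<subseteq> {I. wt (Abs_multiset x) \<le> wt (Abs_multiset I)} \<inter> {I. adic_index a \<beta> U \<alpha>' I}"
    "adic_close T (\<Sum>I\<in>F. mconst (cf f I) * key_monomial U I) f" by blast
  have FI: "\<exists>J\<in>NF. I = count J" if "I \<in> F" for I
    using that F(2) by (auto simp: adic_index_iff)
  then have inj: "inj_on Abs_multiset F"
    by (intro inj_onI) (metis count_inverse)
  have "(\<Sum>J\<in>Abs_multiset ` F. mconst (cf f (count J)) * mon J) =
      (\<Sum>I\<in>F. mconst (cf f (count (Abs_multiset I))) * mon (Abs_multiset I))"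
    by (simp add: sum.reindex [OF inj])
  also have "\<dots> = (\<Sum>I\<in>F. mconst (cf f I) * key_monomial U I)"
    by (rule sum.cong [OF refl]) (use FI in \<open>force simp: count_inverse\<close>)
  finally have "adic_close T (\<Sum>J\<in>Abs_multiset ` F. mconst (cf f (count J)) * mon J) f"
    using F(3) by simp
  moreover have "set_mset J \<subseteq> Ind \<and> nu a \<beta> U \<alpha>' f \<le> (\<Sum>q\<in>#J. B q)" if "J \<in> Abs_multiset ` F" for J
  proof -
    obtain I where I: "I \<in> F" "J = Abs_multiset I" using \<open>J \<in> Abs_multiset ` F\<close> by blast
    then have "J \<in> NF" using FI [OF I(1)] by (auto simp: count_inverse)
    moreover have "wt (Abs_multiset x) \<le> wt J" using I F(2) by auto
    ultimately show ?thesis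
      by (auto simp: NF_def nu_initial [OF x] less_eq_prod_def simp flip: fst_wt)
  qed
  ultimately show ?thesis
    by (intro exI [of _ "Abs_multiset ` F"] exI [of _ "\<lambda>J. cf f (count J)"]) blast
qed

end

theorem theorem4p7:
  fixes d :: nat
    and a \<alpha> :: "'n::{finite,linorder} \<Rightarrow> 'o::wellorder"
    and \<beta> :: "'n \<Rightarrow> 'o \<Rightarrow> 'g::linordered_ab_group_add"
    and \<theta> :: "'n \<Rightarrow> 'o \<Rightarrow> 'k::field"
    and U :: "'n \<Rightarrow> 'o \<Rightarrow> ('n, 'k) mfps"
  assumes "card (UNIV :: 'n set) = d + 1"
    and "convex_rank TYPE('g) = d + 1"
    and "SKP a \<beta> \<theta> \<alpha> U"
  shows "(\<forall>\<alpha>'. acceptable a \<beta> \<alpha> \<alpha>' \<longrightarrow>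
            (\<exists>v :: ('n, 'k) mfps fract \<Rightarrow> 'g. k_valuation v \<and>
               (\<forall>f. f \<noteq> 0 \<longrightarrow> v (Fract f 1) = nu a \<beta> U \<alpha>' f) \<and>
               (\<forall>f g. f \<noteq> 0 \<longrightarrow> g \<noteq> 0 \<longrightarrow>
                  v (Fract f g) = nu a \<beta> U \<alpha>' f - nu a \<beta> U \<alpha>' g))) \<and>
         (\<forall>\<alpha>' \<alpha>''. acceptable a \<beta> \<alpha> \<alpha>' \<longrightarrow> acceptable a \<beta> \<alpha> \<alpha>'' \<longrightarrow> \<alpha>' \<le> \<alpha>'' \<longrightarrow>
            (\<forall>f. f \<noteq> 0 \<longrightarrow> nu a \<beta> U \<alpha>' f \<le> nu a \<beta> U \<alpha>'' f))"
proof (intro conjI allI impI)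
  fix \<alpha>' assume "acceptable a \<beta> \<alpha> \<alpha>'"
  then interpret acceptable_skp a \<beta> \<theta> \<alpha> U \<alpha>'
    using assms(3) by unfold_locales
  show "\<exists>v :: ('n, 'k) mfps fract \<Rightarrow> 'g. k_valuation v \<and>
      (\<forall>f. f \<noteq> 0 \<longrightarrow> v (Fract f 1) = nu a \<beta> U \<alpha>' f) \<and>
      (\<forall>f g. f \<noteq> 0 \<longrightarrow> g \<noteq> 0 \<longrightarrow> v (Fract f g) = nu a \<beta> U \<alpha>' f - nu a \<beta> U \<alpha>' g)"
    by (rule ex_valuation)
next
  fix \<alpha>' \<alpha>'' and f :: "('n, 'k) mfps"
  assume acc: "acceptable a \<beta> \<alpha> \<alpha>'" "acceptable a \<beta> \<alpha> \<alpha>''" and le: "\<alpha>' \<le> \<alpha>''" and f: "f \<noteq> 0"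
  interpret A: acceptable_skp a \<beta> \<theta> \<alpha> U \<alpha>'
    using assms(3) acc(1) by unfold_locales
  interpret C: acceptable_skp a \<beta> \<theta> \<alpha> U \<alpha>''
    using assms(3) acc(2) by unfold_locales
  \<comment> \<open>Monomials that are normal for \<open>\<alpha>'\<close> remain admissible for
    \<open>\<alpha>''\<close>, though perhaps no longer normal.\<close>
  have "A.Ind \<subseteq> C.Ind"
    using le by (auto simp: A.Ind_def C.Ind_def le_fun_def intro: order_trans)
  then show "nu a \<beta> U \<alpha>' f \<le> nu a \<beta> U \<alpha>'' f"
    using A.nu_approx [OF f] by (intro C.nu_ge [OF f]) (meson subset_trans)
qed

end
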